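(* There is an absolute constant $C>0$ such that for all integers $1\le k\le d$ and all $\epsilon\in(0,1)$ there is a randomized algorithm that makes at most $C\,\frac{k^2}{\epsilon^{12}}\log(k+1)$ non-adaptive vector-matrix-vector queries to an unknown real symmetric matrix $A\in\mathbb{R}^{d\times d}$ and outputs real numbers $\tilde\lambda_1,\ldots,\tilde\lambda_k$ such that, for every such $A$ with (signed) eigenvalues $\lambda_1,\lambda_2,\ldots,\lambda_d$ sorted in decreasing order of magnitude, with probability at least $0.9$ both of the following hold: (i) there exists a permutation $\sigma$ of $\{1,\ldots,k\}$ such that for all $i\in\{1,\dots,k\}$ with $|\lambda_i|\ge|\lambda_k|+2\epsilon\|A\|_F$ we have $|\tilde\lambda_{\sigma(i)}-\lambda_i|\le\epsilon\|A\|_F$; (ii) for all $i\in\{1,\ldots,k\}$ there exists $j$ with $|\lambda_j|\ge|\lambda_k|-\epsilon\|A\|_F$ and $|\tilde\lambda_i-\lambda_j|\le\epsilon\|A\|_F$. Moreover, with one additional round of adaptivity, the same guarantee can be achieved with at most $C\,\frac{k^2}{\epsilon^{8}}\log(k+1)$ vector-matrix-vector queries.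
   Context: $\|A\|_F$ is the Frobenius norm. A vector-matrix-vector query chooses $v,w\in\mathbb{R}^d$ and receives $v^TAw$. Queries are non-adaptive if all query vectors are chosen (possibly at random) before any answer is received. With one additional round of adaptivity, the queries are made in two batches, where the second batch may depend on the answers to the first. Computation is otherwise free. *)

theory Defs
  imports
    "HOL-Probability.Probability"
    "Jordan_Normal_Form.Char_Poly"
    "HOL-Combinatorics.Permutations"
begin

hide_type (open) Finite_Cartesian_Product.vec
hide_const (open) Finite_Cartesian_Product.vec_nth
no_notation Finite_Cartesian_Product.vec_nth (infixl "$" 90)
no_notation Inner_Product.real_inner_class.inner (infix "\<bullet>" 70)

subsection \<open>Matrices\<close>

definition symmetric_mats :: "nat \<Rightarrow> real mat set" where
  "symmetric_mats d = {A \<in> carrier_mat d d. A\<^sup>T = A}"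

definition frobenius_norm :: "real mat \<Rightarrow> real" where
  "frobenius_norm A = sqrt (\<Sum>i<dim_row A. \<Sum>j<dim_col A. (A $$ (i, j))\<^sup>2)"

text \<open>A list of all eigenvalues, repeated according to multiplicity, in decreasing order of
  magnitude. The list is unique only up to the order of eigenvalues of equal magnitude.
  Its indices start at 0, so the \<open>i\<close>-th eigenvalue of the usual numbering is \<open>evs ! (i - 1)\<close>.\<close>

definition eigenvalues_by_magnitude :: "real mat \<Rightarrow> real list \<Rightarrow> bool" where
  "eigenvalues_by_magnitude A evs \<longleftrightarrow>
     char_poly A = (\<Prod>\<mu>\<leftarrow>evs. [:- \<mu>, 1:]) \<and> sorted_wrt (\<lambda>x y. \<bar>y\<bar> \<le> \<bar>x\<bar>) evs"

subsection \<open>Randomized query algorithms\<close>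

text \<open>A randomized algorithm is a family of deterministic algorithms indexed by a random seed.
  A seed is a sequence of reals, drawn from an arbitrary Borel probability measure. Query vectors
  and outputs are jointly measurable in the seed and the answers seen so far, but are otherwise
  unrestricted. Measurability cannot be dropped: without it, choices based on a well-ordering of
  the reals would allow algorithms that recover the matrix from a single real answer.\<close>

type_synonym seed = "nat \<Rightarrow> real"
type_synonym query = "real Matrix.vec \<times> real Matrix.vec"
type_synonym answers = "nat \<Rightarrow> real"

definition seed_measure :: "seed measure \<Rightarrow> bool" where
  "seed_measure M \<longleftrightarrow> prob_space M \<and> sets M = sets borel"

definition query_answer :: "real mat \<Rightarrow> query \<Rightarrow> real" where
  "query_answer A vw = fst vw \<bullet> (A *\<^sub>v snd vw)"

definition answer_space :: "nat \<Rightarrow> answers measure" where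
  "answer_space m = (\<Pi>\<^sub>M i\<in>{..<m}. borel)"

definition batch_answers :: "real mat \<Rightarrow> nat \<Rightarrow> (nat \<Rightarrow> query) \<Rightarrow> answers" where
  "batch_answers A m q = (\<lambda>i\<in>{..<m}. query_answer A (q i))"

text \<open>A batch of \<open>m\<close> queries, chosen measurably from the information \<open>x\<close> in the space \<open>N\<close>.\<close>

definition query_batch :: "nat \<Rightarrow> nat \<Rightarrow> 'a measure \<Rightarrow> ('a \<Rightarrow> nat \<Rightarrow> query) \<Rightarrow> bool" where
  "query_batch d m N q \<longleftrightarrow>
     (\<forall>i<m. (\<forall>x\<in>space N. q x i \<in> carrier_vec d \<times> carrier_vec d) \<and>
            (\<forall>j<d. (\<lambda>x. fst (q x i) $ j) \<in> borel_measurable N \<and>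
                   (\<lambda>x. snd (q x i) $ j) \<in> borel_measurable N))"

definition nonadaptive_algorithm ::
  "nat \<Rightarrow> nat \<Rightarrow> nat \<Rightarrow> seed measure \<Rightarrow> (seed \<Rightarrow> nat \<Rightarrow> query)
    \<Rightarrow> (seed \<times> answers \<Rightarrow> nat \<Rightarrow> real) \<Rightarrow> bool" where
  "nonadaptive_algorithm d k m M q out \<longleftrightarrow>
     seed_measure M \<and> query_batch d m M q \<and>
     out \<in> measurable (M \<Otimes>\<^sub>M answer_space m) (\<Pi>\<^sub>M i\<in>{..<k}. borel)"

definition nonadaptive_output ::
  "real mat \<Rightarrow> nat \<Rightarrow> (seed \<Rightarrow> nat \<Rightarrow> query) \<Rightarrow> (seed \<times> answers \<Rightarrow> nat \<Rightarrow> real)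
    \<Rightarrow> seed \<Rightarrow> nat \<Rightarrow> real" where
  "nonadaptive_output A m q out s = out (s, batch_answers A m (q s))"

definition two_round_algorithm ::
  "nat \<Rightarrow> nat \<Rightarrow> nat \<Rightarrow> nat \<Rightarrow> seed measure \<Rightarrow> (seed \<Rightarrow> nat \<Rightarrow> query)
    \<Rightarrow> (seed \<times> answers \<Rightarrow> nat \<Rightarrow> query) \<Rightarrow> ((seed \<times> answers) \<times> answers \<Rightarrow> nat \<Rightarrow> real)
    \<Rightarrow> bool" where
  "two_round_algorithm d k m1 m2 M q1 q2 out \<longleftrightarrow>
     seed_measure M \<and> query_batch d m1 M q1 \<and>
     query_batch d m2 (M \<Otimes>\<^sub>M answer_space m1) q2 \<and>
     out \<in> measurable ((M \<Otimes>\<^sub>M answer_space m1) \<Otimes>\<^sub>M answer_space m2) (\<Pi>\<^sub>M i\<in>{..<k}. borel)"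

definition two_round_output ::
  "real mat \<Rightarrow> nat \<Rightarrow> nat \<Rightarrow> (seed \<Rightarrow> nat \<Rightarrow> query)
    \<Rightarrow> (seed \<times> answers \<Rightarrow> nat \<Rightarrow> query) \<Rightarrow> ((seed \<times> answers) \<times> answers \<Rightarrow> nat \<Rightarrow> real)
    \<Rightarrow> seed \<Rightarrow> nat \<Rightarrow> real" where
  "two_round_output A m1 m2 q1 q2 out s =
     (let a1 = batch_answers A m1 (q1 s);
          a2 = batch_answers A m2 (q2 (s, a1))
      in out ((s, a1), a2))"

subsection \<open>The approximation guarantee\<close>

definition top_eigenvalues_approx ::
  "nat \<Rightarrow> nat \<Rightarrow> real \<Rightarrow> real mat \<Rightarrow> real list \<Rightarrow> (nat \<Rightarrow> real) \<Rightarrow> bool" where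
  "top_eigenvalues_approx d k \<epsilon> A evs out \<longleftrightarrow>
     (\<exists>\<sigma>. \<sigma> permutes {..<k} \<and>
        (\<forall>i<k. \<bar>evs ! i\<bar> \<ge> \<bar>evs ! (k - 1)\<bar> + 2 * \<epsilon> * frobenius_norm A \<longrightarrow>
               \<bar>out (\<sigma> i) - evs ! i\<bar> \<le> \<epsilon> * frobenius_norm A)) \<and>
     (\<forall>i<k. \<exists>j<d. \<bar>evs ! j\<bar> \<ge> \<bar>evs ! (k - 1)\<bar> - \<epsilon> * frobenius_norm A \<and>
                  \<bar>out i - evs ! j\<bar> \<le> \<epsilon> * frobenius_norm A)"

text \<open>The algorithm given by the random output \<open>out\<close> succeeds with probability at least \<open>0.9\<close>
  on every symmetric matrix; the seed is drawn after the matrix is fixed.\<close>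

definition approximates_top_eigenvalues ::
  "nat \<Rightarrow> nat \<Rightarrow> real \<Rightarrow> seed measure \<Rightarrow> (real mat \<Rightarrow> seed \<Rightarrow> nat \<Rightarrow> real) \<Rightarrow> bool" where
  "approximates_top_eigenvalues d k \<epsilon> M out \<longleftrightarrow>
     (\<forall>A\<in>symmetric_mats d. \<forall>evs. eigenvalues_by_magnitude A evs \<longrightarrow>
        measure M {s \<in> space M. top_eigenvalues_approx d k \<epsilon> A evs (out A s)} \<ge> 9 / 10)"

end

(* Let A = sum_k lambda_k u_k u_k^T and draw m = O(1 / eps^4) independent random sign vectors g_i in
   R^d. The m^2 queries g_i^T A g_j are made at once; the output consists of the k largest eigenvalues
   in magnitude of the matrix M with off-diagonal entries g_i^T A g_j / m, padded with zeros. The number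
   O(1 / eps^8) of queries is below both bounds, and the second round is not needed.

   Put omega = eps |A|_F / 20 and call lambda_k large if |lambda_k| > omega / 800. The large part of M is
   Y J Y^T with columns y_k = sqrt (|lambda_k| / m) (<u_k, g_i>)_i and J the diagonal matrix of signs, up to
   a diagonal of norm at most omega. By second moments Y^T Y is close to diag |lambda_k| with an error of
   Frobenius norm O(omega): there are only O(1 / eps^2) large eigenvalues, and weighting the columns by
   |lambda_k| makes m = O(1 / eps^4) sufficient. The off-diagonal part coming from the small eigenvalues
   has operator norm at most omega, by decoupling, a Hanson-Wright type bound for exponential
   moments and a union bound over a net of size exp (O (m)). Hence M and A have the same number of
   eigenvalues above t up to a shift of t by 5 omega, on the positive and on the negative side, so that
   their sorted spectra (padded with zeros) differ by at most 5 omega entrywise. *)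

theory Submission
  imports Defs
begin

section \<open>Spectral theorem for real symmetric matrices\<close>

text \<open>The diagonal of the sketch is dropped because g_i^T A g_i / m has mean trace A / m, and
  the trace can exceed the Frobenius norm by a factor sqrt d, which no m independent of d absorbs.
  For the large eigenvalues the diagonal can be put back at cost omega; the small ones are only ever
  seen off the diagonal. The exponent 4 comes from the Gram matrix. Its (k, l) error has second
  moment of order |lambda_k lambda_l| / m, so the squared Frobenius norm of the error is of order
  (sum |lambda_k|)^2 / m over the large k. Each of these exceeds omega / 800, so the sum is O(|A|_F
  / eps), and the error is O(omega) once m is of order 1 / eps^4. Signs make every expectation a
  finite average: apart from one auxiliary Gaussian integral, independence and the inequalities of
  Markov and Jensen are statements about finite sums, and measure theory enters only when the
  algorithm is assembled. Signs also bound the answers by d |A|_F, on which the rounding of the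
  sketch relies.\<close>

definition ip :: "nat \<Rightarrow> (nat \<Rightarrow> real) \<Rightarrow> (nat \<Rightarrow> real) \<Rightarrow> real" where
  "ip n x y = (\<Sum>i<n. x i * y i)"

definition mv :: "nat \<Rightarrow> (nat \<Rightarrow> nat \<Rightarrow> real) \<Rightarrow> (nat \<Rightarrow> real) \<Rightarrow> nat \<Rightarrow> real" where
  "mv n A x i = (\<Sum>j<n. A i j * x j)"

lemma ip_commute: "ip n x y = ip n y x"
  by (simp add: ip_def mult.commute)

lemma ip_add_left: "ip n (\<lambda>i. x i + y i) z = ip n x z + ip n y z"
  by (simp add: ip_def distrib_right sum.distrib)

lemma ip_add_right: "ip n z (\<lambda>i. x i + y i) = ip n z x + ip n z y"
  by (simp add: ip_def distrib_left sum.distrib)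

lemma ip_diff_left: "ip n (\<lambda>i. x i - y i) z = ip n x z - ip n y z"
  by (simp add: ip_def left_diff_distrib sum_subtractf)

lemma ip_diff_right: "ip n z (\<lambda>i. x i - y i) = ip n z x - ip n z y"
  by (simp add: ip_def right_diff_distrib sum_subtractf)

lemma ip_scale_left: "ip n (\<lambda>i. c * x i) y = c * ip n x y"
  by (simp add: ip_def sum_distrib_left mult.assoc)

lemma ip_scale_right: "ip n x (\<lambda>i. c * y i) = c * ip n x y"
  by (simp add: ip_def sum_distrib_left mult.left_commute)

lemma ip_sum_left: "ip n (\<lambda>i. \<Sum>k\<in>S. f k i) y = (\<Sum>k\<in>S. ip n (f k) y)"
  unfolding ip_def sum_distrib_right by (rule sum.swap)

lemma ip_sum_right: "ip n y (\<lambda>i. \<Sum>k\<in>S. f k i) = (\<Sum>k\<in>S. ip n y (f k))"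
  using ip_sum_left[of n f S y] by (simp add: ip_commute)

lemma ip_nonneg: "0 \<le> ip n x x"
  by (simp add: ip_def sum_nonneg)

lemma ip_eq_0_iff: "ip n x x = 0 \<longleftrightarrow> (\<forall>i<n. x i = 0)"
  by (auto simp: ip_def sum_nonneg_eq_0_iff)

lemma ip_pos: "i < n \<Longrightarrow> x i \<noteq> 0 \<Longrightarrow> 0 < ip n x x"
  using ip_nonneg[of n x] ip_eq_0_iff[of n x] by force

lemma ip_Cauchy_Schwarz: "(ip n x y)\<^sup>2 \<le> ip n x x * ip n y y"
  using Cauchy_Schwarz_ineq_sum[of x y "{..<n}"] by (simp add: ip_def power2_eq_square)

lemma ip_mv_symmetric:
  assumes "\<And>i j. i < n \<Longrightarrow> j < n \<Longrightarrow> A i j = A j i"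
  shows "ip n x (mv n A y) = ip n (mv n A x) y"
proof -
  have "ip n x (mv n A y) = (\<Sum>i<n. \<Sum>j<n. x i * A i j * y j)"
    by (simp add: ip_def mv_def sum_distrib_left mult.assoc)
  also have "\<dots> = (\<Sum>i<n. \<Sum>j<n. x i * A j i * y j)"
    using assms by (intro sum.cong) auto
  also have "\<dots> = (\<Sum>j<n. \<Sum>i<n. x i * A j i * y j)"
    by (rule sum.swap)
  also have "\<dots> = ip n (mv n A x) y"
    by (simp only: ip_def mv_def sum_distrib_right) (simp add: mult_ac)
  finally show ?thesis .
qed

lemma mv_add: "mv n A (\<lambda>i. x i + y i) i = mv n A x i + mv n A y i"
  by (simp add: mv_def distrib_left sum.distrib)

lemma mv_scale: "mv n A (\<lambda>i. c * x i) i = c * mv n A x i"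
  by (simp add: mv_def sum_distrib_left mult.left_commute)

text \<open>Feeds every dimension count: the next eigenvector in the spectral theorem and both
  eigenvalue comparisons of the sketch. Zero rows make the system square; as
  \<open>card J < card I\<close> the last row is zero, so the determinant vanishes and the kernel
  contains a nonzero vector.\<close>

lemma homogeneous_system:
  fixes c :: "'b \<Rightarrow> 'a \<Rightarrow> real"
  assumes fI: "finite I" and fJ: "finite J" and lt: "card J < card I"
  shows "\<exists>a. (\<exists>i\<in>I. a i \<noteq> 0) \<and> (\<forall>j\<in>J. (\<Sum>i\<in>I. c j i * a i) = 0)"
proof -
  define n where "n = card I"
  obtain f where f: "bij_betw f {0..<n} I"
    using ex_bij_betw_nat_finite[OF fI] n_def by blast
  obtain g where g: "bij_betw g {0..<card J} J"
    using ex_bij_betw_nat_finite[OF fJ] by blast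
  define B where "B = Matrix.mat n n (\<lambda>(i, j). if i < card J then c (g i) (f j) else 0)"
  have B: "B \<in> carrier_mat n n" by (simp add: B_def)
  have "det B\<^sup>T = 0"
  proof -
    have "B\<^sup>T *\<^sub>v unit_vec n (n - 1) = 0\<^sub>v n"
    proof (rule eq_vecI)
      fix i assume "i < dim_vec (0\<^sub>v n :: real Matrix.vec)"
      then have i: "i < n" by simp
      then show "(B\<^sup>T *\<^sub>v unit_vec n (n - 1)) $ i = 0\<^sub>v n $ i"
        using lt by (auto simp: B_def n_def scalar_prod_def unit_vec_def intro!: sum.neutral)
    qed (simp add: B_def)
    moreover have "unit_vec n (n - 1) \<noteq> (0\<^sub>v n :: real Matrix.vec)"
      using lt n_def by (intro unit_vec_nonzero) auto
    ultimately show ?thesis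
      using det_0_iff_vec_prod_zero_field[of "B\<^sup>T" n] B by (metis transpose_carrier_mat unit_vec_carrier)
  qed
  then have "det B = 0" using det_transpose[OF B] by simp
  then obtain v where v: "v \<in> carrier_vec n" "v \<noteq> 0\<^sub>v n" "B *\<^sub>v v = 0\<^sub>v n"
    using det_0_iff_vec_prod_zero_field[OF B] by blast
  define h where "h = inv_into {0..<n} f"
  have hf: "h (f i) = i" if "i < n" for i
    using f that by (simp add: h_def bij_betw_def)
  obtain i0 where i0: "i0 < n" "v $ i0 \<noteq> 0"
    using v(1,2) by (metis carrier_vecD eq_vecI index_zero_vec)
  have "(\<Sum>i\<in>I. c j i * v $ h i) = 0" if j: "j \<in> J" for j
  proof -
    obtain r where r: "r < card J" "g r = j"
      using g j by (force simp: bij_betw_def)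
    have "(\<Sum>i\<in>I. c j i * v $ h i) = (\<Sum>i\<in>{0..<n}. c j (f i) * v $ i)"
      using sum.reindex_bij_betw[OF f, of "\<lambda>i. c j i * v $ h i"] hf by simp
    also have "\<dots> = (B *\<^sub>v v) $ r"
      using r lt v(1) by (simp add: B_def n_def scalar_prod_def)
    also have "\<dots> = 0" using v(3) r lt by (simp add: n_def)
    finally show ?thesis .
  qed
  moreover have "f i0 \<in> I" "v $ h (f i0) \<noteq> 0"
    using i0 f hf by (auto simp: bij_betw_def)
  ultimately show ?thesis by (intro exI[of _ "\<lambda>i. v $ h i"]) auto
qed

text \<open>Vectors are functions on all of \<open>nat\<close>, so compactness comes from the
  product topology; pinning the coordinates from \<open>n\<close> on to 0 keeps every factor
  compact.\<close>

lemma compact_box_fun: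
  fixes n :: nat
  shows "compact {x :: nat \<Rightarrow> real. \<forall>i. x i \<in> (if i < n then {-1..1} else {0})}"
proof -
  have "compactin (product_topology (\<lambda>i. euclidean :: real topology) (UNIV :: nat set))
          (PiE UNIV (\<lambda>i. if i < n then {-1..1} else {0}))"
    by (auto simp: compactin_PiE)
  then have "compact (PiE UNIV (\<lambda>i::nat. if i < n then {-1..1::real} else {0}))"
    by (simp add: euclidean_product_topology)
  moreover have "PiE UNIV (\<lambda>i::nat. if i < n then {-1..1::real} else {0}) =
     {x :: nat \<Rightarrow> real. \<forall>i. x i \<in> (if i < n then {-1..1} else {0})}"
    by (auto simp: PiE_def Pi_def extensional_def)
  ultimately show ?thesis by simp
qed

text \<open>First-order optimality without derivatives: if b were nonzero, the linear term would win
  over the quadratic one at the small step t = - b / D.\<close>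

lemma real_quadratic_linear_zero:
  fixes b c :: real
  assumes "\<And>t. 0 \<le> 2 * t * b + t\<^sup>2 * c"
  shows "b = 0"
proof (rule ccontr)
  assume b: "b \<noteq> 0"
  define D where "D = \<bar>c\<bar> + 1"
  have D: "D > 0" "c \<le> D" by (auto simp: D_def)
  have "(b / D)\<^sup>2 * c \<le> (b / D)\<^sup>2 * D" using D by (intro mult_left_mono) auto
  also have "\<dots> = b\<^sup>2 / D" using D by (simp add: power2_eq_square)
  finally have "2 * (- (b / D)) * b + (- (b / D))\<^sup>2 * c \<le> - (b\<^sup>2 / D)"
    by (simp add: power2_eq_square)
  moreover have "b\<^sup>2 / D > 0" using b D by simp
  ultimately show False using assms[of "- (b / D)"] by linarith
qed

text \<open>The eigenvector is a maximiser of the Rayleigh quotient on the unit sphere of the orthogonal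
  complement of the eigenvectors found so far.\<close>

lemma symmetric_eigenvector_orthogonal:
  fixes A :: "nat \<Rightarrow> nat \<Rightarrow> real" and u :: "nat \<Rightarrow> nat \<Rightarrow> real"
  assumes sym: "\<And>i j. i < n \<Longrightarrow> j < n \<Longrightarrow> A i j = A j i"
    and kn: "k < n"
    and eig: "\<And>l i. l < k \<Longrightarrow> i < n \<Longrightarrow> mv n A (u l) i = \<mu> l * u l i"
  shows "\<exists>x s. ip n x x = 1 \<and> (\<forall>l<k. ip n (u l) x = 0) \<and> (\<forall>i<n. mv n A x i = s * x i)"
proof -
  define S where "S = {x. (\<forall>i. x i \<in> (if i < n then {-1..1::real} else {0})) \<and> ip n x x = 1 \<and> (\<forall>l<k. ip n (u l) x = 0)}"
  define Q where "Q x = ip n x (mv n A x)" for x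
  have cont: "continuous_on UNIV (\<lambda>x. ip n x x)" "continuous_on UNIV (\<lambda>x. ip n y x)"
       "continuous_on UNIV Q" for y
    unfolding Q_def ip_def mv_def
    by (intro continuous_intros continuous_on_product_coordinates)+
  have "compact S"
  proof -
    have "S = {x. \<forall>i. x i \<in> (if i < n then {-1..1::real} else {0})} \<inter>
       ({x. ip n x x = 1} \<inter> (\<Inter>l\<in>{..<k}. {x. ip n (u l) x = 0}))"
      by (auto simp: S_def)
    moreover have "closed ({x. ip n x x = 1} \<inter> (\<Inter>l\<in>{..<k}. {x. ip n (u l) x = 0}))"
      using cont by (intro closed_Int closed_INT ballI closed_Collect_eq continuous_on_const) auto
    ultimately show ?thesis using compact_Int_closed[OF compact_box_fun[of n]] by simp
  qed
  have normalise: "(\<lambda>i. if i < n then x i / sqrt (ip n x x) else 0) \<in> S"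
    if x: "\<forall>l<k. ip n (u l) x = 0" "ip n x x > 0" for x
  proof -
    have e: "ip n (u l) (\<lambda>i. if i < n then x i / sqrt (ip n x x) else 0) = ip n (u l) x / sqrt (ip n x x)" for l
      by (simp add: ip_def sum_divide_distrib)
    have "ip n (\<lambda>i. if i < n then x i / sqrt (ip n x x) else 0) (\<lambda>i. if i < n then x i / sqrt (ip n x x) else 0)
       = ip n x x / (sqrt (ip n x x))\<^sup>2"
      by (simp add: ip_def sum_divide_distrib power2_eq_square)
    then have e2: "ip n (\<lambda>i. if i < n then x i / sqrt (ip n x x) else 0) (\<lambda>i. if i < n then x i / sqrt (ip n x x) else 0) = 1"
      using x(2) by simp
    have "(x i)\<^sup>2 \<le> ip n x x" if "i < n" for i
      using member_le_sum[of i "{..<n}" "\<lambda>i. x i * x i"] that by (simp add: ip_def power2_eq_square)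
    then have "\<bar>x i\<bar> \<le> sqrt (ip n x x)" if "i < n" for i
      using that by (metis real_sqrt_abs real_sqrt_le_mono)
    then have b: "\<bar>x i / sqrt (ip n x x)\<bar> \<le> 1" if "i < n" for i
      using that x(2) by (simp add: abs_divide divide_le_eq)
    have "- 1 \<le> x i / sqrt (ip n x x)" "x i / sqrt (ip n x x) \<le> 1" if "i < n" for i
      using b[OF that] by linarith+
    then show ?thesis using x e e2 by (auto simp: S_def)
  qed
  obtain a where a: "\<exists>i\<in>{..<n}. a i \<noteq> 0" "\<forall>l\<in>{..<k}. (\<Sum>i\<in>{..<n}. u l i * a i) = 0"
    using homogeneous_system[of "{..<n}" "{..<k}" u] kn by auto
  have "S \<noteq> {}"
    using normalise[of a] a ip_pos[of _ n a] by (auto simp: ip_def)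
  then obtain x where x: "x \<in> S" and max: "\<And>y. y \<in> S \<Longrightarrow> Q y \<le> Q x"
    using continuous_attains_sup[OF \<open>compact S\<close>, of Q] cont(3) continuous_on_subset by blast
  define s where "s = Q x"
  have x1: "ip n x x = 1" and xu: "\<And>l. l < k \<Longrightarrow> ip n (u l) x = 0" using x by (auto simp: S_def)
  have Qle: "Q y \<le> s * ip n y y" if y: "\<forall>l<k. ip n (u l) y = 0" for y
  proof (cases "ip n y y = 0")
    case True
    then have "\<forall>i<n. y i = 0" by (simp add: ip_eq_0_iff)
    then have "Q y = 0" by (auto simp: Q_def ip_def)
    then show ?thesis using True by simp
  next
    case False
    then have pos: "ip n y y > 0" using ip_nonneg[of n y] by simp
    let ?c = "1 / sqrt (ip n y y)"
    have "Q (\<lambda>i. if i < n then y i / sqrt (ip n y y) else 0) = ?c * (?c * Q y)"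
      by (simp add: Q_def ip_def mv_def sum_distrib_left mult_ac)
    also have "\<dots> = Q y / ip n y y" using pos by (simp add: field_simps)
    finally have "Q y / ip n y y \<le> s"
      using max[OF normalise[OF y pos]] by (simp add: s_def)
    then show ?thesis using pos by (simp add: divide_simps mult.commute)
  qed
  \<comment> \<open>The residual h = A x - s x is again orthogonal to every \<open>u l\<close>, so x
    + t h is an admissible competitor. Its Rayleigh inequality has linear coefficient - 2 |h|^2 in
    t, which forces h = 0.\<close>
  define h where "h i = mv n A x i - s * x i" for i
  have hu: "ip n (u l) h = 0" if l: "l < k" for l
  proof -
    have "ip n (u l) (mv n A x) = ip n (mv n A (u l)) x"
      using sym by (rule ip_mv_symmetric)
    also have "\<dots> = ip n (\<lambda>i. \<mu> l * u l i) x"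
      using eig[OF l] by (simp add: ip_def)
    also have "\<dots> = 0" by (simp add: ip_scale_left xu l)
    finally show ?thesis unfolding h_def by (simp add: ip_diff_right ip_scale_right xu l)
  qed
  have Axh: "ip n x (mv n A h) = ip n h (mv n A x)"
    using ip_mv_symmetric[of n A x h] sym by (simp add: ip_commute)
  have hh: "ip n h h = ip n h (mv n A x) - s * ip n h x"
  proof -
    have "ip n h h = ip n h (\<lambda>i. mv n A x i - s * x i)" by (simp add: h_def[abs_def])
    then show ?thesis by (simp only: ip_diff_right ip_scale_right)
  qed
  have "0 \<le> 2 * t * (- ip n h h) + t\<^sup>2 * (s * ip n h h - Q h)" for t
  proof -
    let ?y = "\<lambda>i. x i + t * h i"
    have "Q ?y = Q x + 2 * t * ip n h (mv n A x) + t\<^sup>2 * Q h"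
    proof -
      have "mv n A ?y = (\<lambda>i. mv n A x i + t * mv n A h i)"
        by (rule ext) (simp add: mv_add mv_scale)
      then show ?thesis
        by (simp add: Q_def ip_add_left ip_add_right ip_scale_left ip_scale_right Axh
            power2_eq_square algebra_simps)
    qed
    moreover have "ip n ?y ?y = 1 + 2 * t * ip n h x + t\<^sup>2 * ip n h h"
      by (simp add: ip_add_left ip_add_right ip_scale_left ip_scale_right x1
            power2_eq_square algebra_simps ip_commute[of n x h])
    moreover have "Q ?y \<le> s * ip n ?y ?y"
      using Qle[of ?y] by (simp add: ip_add_right ip_scale_right xu hu)
    ultimately have "Q x + 2 * t * ip n h (mv n A x) + t\<^sup>2 * Q h
        \<le> s * (1 + 2 * t * ip n h x + t\<^sup>2 * ip n h h)" by simp
    moreover have "ip n h (mv n A x) = ip n h h + s * ip n h x" using hh by simp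
    ultimately show ?thesis by (simp add: s_def algebra_simps)
  qed
  from real_quadratic_linear_zero[OF this] have "ip n h h = 0" by simp
  then have "\<forall>i<n. mv n A x i = s * x i" by (simp add: ip_eq_0_iff h_def)
  then show ?thesis using x1 xu by blast
qed

text \<open>Orthonormal rows of a square matrix have orthonormal columns, because a one-sided
  inverse is two-sided.\<close>

lemma orthonormal_square_complete:
  fixes u :: "nat \<Rightarrow> nat \<Rightarrow> real"
  assumes orth: "\<And>k l. k < n \<Longrightarrow> l < n \<Longrightarrow> ip n (u k) (u l) = (if k = l then 1 else 0)"
    and ij: "i < n" "j < n"
  shows "(\<Sum>k<n. u k i * u k j) = (if i = j then 1 else 0)"
proof -
  define U where "U = Matrix.mat n n (\<lambda>(k, i). u k i)"
  have U: "U \<in> carrier_mat n n" "U\<^sup>T \<in> carrier_mat n n" by (auto simp: U_def)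
  have "U * U\<^sup>T = 1\<^sub>m n"
    using orth by (intro eq_matI) (auto simp: U_def scalar_prod_def ip_def lessThan_atLeast0)
  then have "U\<^sup>T * U = 1\<^sub>m n" by (rule mat_mult_left_right_inverse[OF U])
  then have "(U\<^sup>T * U) $$ (i, j) = (1\<^sub>m n :: real mat) $$ (i, j)" by simp
  then show ?thesis using ij by (simp add: U_def scalar_prod_def lessThan_atLeast0)
qed

definition spectral_decomp :: "nat \<Rightarrow> (nat \<Rightarrow> nat \<Rightarrow> real) \<Rightarrow> (nat \<Rightarrow> real) \<Rightarrow> (nat \<Rightarrow> nat \<Rightarrow> real) \<Rightarrow> bool" where
  "spectral_decomp n A \<mu> u \<longleftrightarrow>
     (\<forall>k<n. \<forall>l<n. ip n (u k) (u l) = (if k = l then 1 else 0)) \<and>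
     (\<forall>i<n. \<forall>j<n. A i j = (\<Sum>k<n. \<mu> k * u k i * u k j))"

theorem spectral_theorem:
  fixes A :: "nat \<Rightarrow> nat \<Rightarrow> real"
  assumes sym: "\<And>i j. i < n \<Longrightarrow> j < n \<Longrightarrow> A i j = A j i"
  shows "\<exists>\<mu> u. spectral_decomp n A \<mu> u"
proof -
  have ex: "\<exists>\<mu> u. (\<forall>k<r. \<forall>l<r. ip n (u k) (u l) = (if k = l then 1 else 0)) \<and>
       (\<forall>k<r. \<forall>i<n. mv n A (u k) i = \<mu> k * u k i)" if "r \<le> n" for r
    using that
  proof (induction r)
    case 0
    then show ?case by simp
  next
    case (Suc r)
    then obtain \<mu> u where 1: "\<forall>k<r. \<forall>l<r. ip n (u k) (u l) = (if k = l then 1 else 0)"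
      and 2: "\<forall>k<r. \<forall>i<n. mv n A (u k) i = \<mu> k * u k i" by auto
    obtain x s where x: "ip n x x = 1" "\<forall>l<r. ip n (u l) x = 0" "\<forall>i<n. mv n A x i = s * x i"
      using symmetric_eigenvector_orthogonal[of n A r u \<mu>] sym 2 Suc.prems by auto
    then have x': "\<forall>l<r. ip n x (u l) = 0" by (simp add: ip_commute)
    show ?case
    proof (intro exI[of _ "\<mu>(r := s)"] exI[of _ "u(r := x)"] conjI allI impI)
      fix k l assume kl: "k < Suc r" "l < Suc r"
      show "ip n ((u(r := x)) k) ((u(r := x)) l) = (if k = l then 1 else 0)"
        using 1 x x' kl by (cases "k = r"; cases "l = r") auto
    next
      fix k i assume "k < Suc r" "i < n"
      then show "mv n A ((u(r := x)) k) i = (\<mu>(r := s)) k * (u(r := x)) k i"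
        using 2 x by (cases "k = r") auto
    qed
  qed
  obtain \<mu> u where 1: "\<forall>k<n. \<forall>l<n. ip n (u k) (u l) = (if k = l then 1 else 0)"
      and 2: "\<forall>k<n. \<forall>i<n. mv n A (u k) i = \<mu> k * u k i" using ex[OF order_refl] by auto
  have "A i j = (\<Sum>k<n. \<mu> k * u k i * u k j)" if ij: "i < n" "j < n" for i j
  proof -
    have "(\<Sum>k<n. \<mu> k * u k i * u k j) = (\<Sum>k<n. mv n A (u k) i * u k j)"
      using 2 ij by simp
    also have "\<dots> = (\<Sum>k<n. \<Sum>l<n. A i l * (u k l * u k j))"
      by (simp add: mv_def sum_distrib_right mult.assoc)
    also have "\<dots> = (\<Sum>l<n. A i l * (\<Sum>k<n. u k l * u k j))"
      by (subst sum.swap) (simp add: sum_distrib_left)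
    also have "\<dots> = (\<Sum>l<n. A i l * (if l = j then 1 else 0))"
      using orthonormal_square_complete[of n u] 1 ij by (intro sum.cong) auto
    also have "\<dots> = A i j" using ij by (simp add: if_distrib cong: if_cong)
    finally show ?thesis ..
  qed
  then show ?thesis using 1 unfolding spectral_decomp_def by blast
qed

section \<open>Averages over random signs\<close>

definition rad :: "'a set \<Rightarrow> (('a \<Rightarrow> real) \<Rightarrow> real) \<Rightarrow> real" where
  "rad K f = (\<Sum>s\<in>PiE K (\<lambda>_. {-1, 1}). f s) / 2 ^ card K"

text \<open>Independence of \<open>f\<close> from the signs indexed by \<open>I\<close>, expressed
  as invariance under changing these coordinates; it replaces conditioning in the averages
  below.\<close>

definition free_of :: "'a set \<Rightarrow> (('a \<Rightarrow> real) \<Rightarrow> 'b) \<Rightarrow> bool" where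
  "free_of I f \<longleftrightarrow> (\<forall>s a x. a \<in> I \<longrightarrow> f (s(a := x)) = f s)"

lemma free_ofD: "free_of I f \<Longrightarrow> a \<in> I \<Longrightarrow> f (s(a := x)) = f s"
  by (simp add: free_of_def)

lemma finite_signs: "finite K \<Longrightarrow> finite (PiE K (\<lambda>_. {-1, 1::real}))"
  by (intro finite_PiE) auto

lemma card_signs: "finite K \<Longrightarrow> card (PiE K (\<lambda>_. {-1, 1::real})) = 2 ^ card K"
  by (simp add: card_PiE numeral_2_eq_2)

lemma rad_cong: "(\<And>s. s \<in> PiE K (\<lambda>_. {-1, 1}) \<Longrightarrow> f s = g s) \<Longrightarrow> rad K f = rad K g"
  unfolding rad_def by (intro arg_cong2[where f = "(/)"] sum.cong) auto

lemma rad_mono: "(\<And>s. s \<in> PiE K (\<lambda>_. {-1, 1}) \<Longrightarrow> f s \<le> g s) \<Longrightarrow> rad K f \<le> rad K g"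
  unfolding rad_def by (intro divide_right_mono sum_mono) auto

lemma rad_const: "finite K \<Longrightarrow> rad K (\<lambda>s. c) = c"
  by (simp add: rad_def card_signs)

lemma rad_add: "rad K (\<lambda>s. f s + g s) = rad K f + rad K g"
  by (simp add: rad_def sum.distrib add_divide_distrib)

lemma rad_diff: "rad K (\<lambda>s. f s - g s) = rad K f - rad K g"
  by (simp add: rad_def sum_subtractf diff_divide_distrib)

lemma rad_mult_left: "rad K (\<lambda>s. c * f s) = c * rad K f"
  by (simp add: rad_def sum_distrib_left)

lemma rad_mult_right: "rad K (\<lambda>s. f s * c) = rad K f * c"
  by (simp add: rad_def sum_distrib_right)

lemma rad_sum: "rad K (\<lambda>s. \<Sum>i\<in>I. f i s) = (\<Sum>i\<in>I. rad K (f i))"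
proof -
  have "(\<Sum>s\<in>PiE K (\<lambda>_. {-1, 1}). \<Sum>i\<in>I. f i s) = (\<Sum>i\<in>I. \<Sum>s\<in>PiE K (\<lambda>_. {-1, 1}). f i s)"
    by (rule sum.swap)
  then show ?thesis by (simp add: rad_def sum_divide_distrib)
qed

text \<open>Flipping the sign at \<open>a\<close> is an involution of the cube, so averaging over
  its orbits integrates out this coordinate while the others stay fixed.\<close>

lemma rad_coordinate:
  assumes "finite K" "a \<in> K"
  shows "rad K f = rad K (\<lambda>s. (f (s(a := 1)) + f (s(a := -1))) / 2)"
proof -
  let ?S = "PiE K (\<lambda>_. {-1, 1::real})"
  define \<phi> where "\<phi> s = s(a := - s a)" for s :: "'a \<Rightarrow> real"
  have bij: "bij_betw \<phi> ?S ?S"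
  proof (rule bij_betwI[where g = \<phi>])
    have "\<phi> s \<in> ?S" if s: "s \<in> ?S" for s
    proof (rule PiE_I)
      fix x assume x: "x \<in> K"
      have "s x \<in> {-1, 1}" "s a \<in> {-1, 1}" using PiE_mem[OF s] x assms by blast+
      then show "\<phi> s x \<in> {-1, 1}" by (auto simp: \<phi>_def)
    next
      fix x assume "x \<notin> K"
      then show "\<phi> s x = undefined" using PiE_arb[OF s \<open>x \<notin> K\<close>] assms(2) by (auto simp: \<phi>_def)
    qed
    then show "\<phi> \<in> ?S \<rightarrow> ?S" "\<phi> \<in> ?S \<rightarrow> ?S" by auto
  qed (auto simp: \<phi>_def)
  have "(\<Sum>s\<in>?S. f (s(a := 1)) + f (s(a := -1))) = (\<Sum>s\<in>?S. f s + f (\<phi> s))"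
  proof (rule sum.cong[OF refl])
    fix s assume "s \<in> ?S"
    then have "s a \<in> {-1, 1}" using PiE_mem assms(2) by fast
    then consider "s a = 1" | "s a = -1" by auto
    then show "f (s(a := 1)) + f (s(a := -1)) = f s + f (\<phi> s)"
    proof cases
      case 1
      then have "s(a := 1) = s" by (simp add: fun_upd_idem)
      then show ?thesis using 1 by (simp add: \<phi>_def)
    next
      case 2
      then have "s(a := -1) = s" by (simp add: fun_upd_idem)
      then show ?thesis using 2 by (simp add: \<phi>_def)
    qed
  qed
  also have "\<dots> = 2 * (\<Sum>s\<in>?S. f s)"
    using sum.reindex_bij_betw[OF bij, of f] by (simp add: sum.distrib)
  finally show ?thesis by (simp add: rad_def flip: sum_divide_distrib)
qed

lemma rad_linear_free:
  assumes "finite K" "a \<in> K" "free_of {a} h"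
  shows "rad K (\<lambda>s. s a * h s) = 0"
  using rad_coordinate[OF assms(1,2), of "\<lambda>s. s a * h s"] assms
  by (simp add: free_of_def rad_const)

text \<open>Signs are orthonormal, also against a weight independent of them. With \<open>I\<close>
  one row of the sign array this is the isotropy of the random vectors.\<close>

lemma rad_bilinear_free:
  assumes "finite K" "I \<subseteq> K" "free_of I h"
  shows "rad K (\<lambda>s. (\<Sum>a\<in>I. u a * s a) * (\<Sum>b\<in>I. v b * s b) * h s) = (\<Sum>a\<in>I. u a * v a) * rad K h"
proof -
  have fI: "finite I" using assms finite_subset by blast
  have ab: "rad K (\<lambda>s. s a * s b * h s) = (if a = b then rad K h else 0)" if "a \<in> I" "b \<in> I" for a b
  proof (cases "a = b")
    case True
    have "rad K (\<lambda>s. s a * s b * h s) = rad K h"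
    proof (rule rad_cong)
      fix s assume "s \<in> PiE K (\<lambda>_. {-1, 1::real})"
      from PiE_mem[OF this] have "s a \<in> {-1, 1}" using that assms(2) by auto
      then show "s a * s b * h s = h s" using True by auto
    qed
    then show ?thesis using True by simp
  next
    case False
    have "rad K (\<lambda>s. s a * (s b * h s)) = 0"
      using assms that False by (intro rad_linear_free) (auto simp: free_of_def)
    then show ?thesis using False by (simp add: mult.assoc)
  qed
  have "(\<lambda>s. (\<Sum>a\<in>I. u a * s a) * (\<Sum>b\<in>I. v b * s b) * h s) =
     (\<lambda>s. \<Sum>a\<in>I. \<Sum>b\<in>I. (u a * v b) * (s a * s b * h s))"
    by (rule ext) (simp only: sum_product sum_distrib_right, intro sum.cong refl, simp add: sum_distrib_left mult_ac)
  then have "rad K (\<lambda>s. (\<Sum>a\<in>I. u a * s a) * (\<Sum>b\<in>I. v b * s b) * h s) =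
     (\<Sum>a\<in>I. \<Sum>b\<in>I. (u a * v b) * rad K (\<lambda>s. s a * s b * h s))"
    by (simp only: rad_sum rad_mult_left)
  also have "\<dots> = (\<Sum>a\<in>I. \<Sum>b\<in>I. if b = a then u a * v b * rad K h else 0)"
    by (intro sum.cong refl) (auto simp: ab)
  also have "\<dots> = (\<Sum>a\<in>I. u a * v a) * rad K h"
    using fI by (simp add: sum_distrib_right)
  finally show ?thesis .
qed

text \<open>The difference y^2 / 2 - ln (cosh y) has derivative y - tanh y, which is nonnegative for
  y >= 0 because y cosh y - sinh y has derivative y sinh y.\<close>

lemma cosh_le_exp_square: "(exp x + exp (- x)) / 2 \<le> exp (x\<^sup>2 / 2)" for x :: real
proof -
  have nonneg: "cosh x \<le> exp (x\<^sup>2 / 2)" if x: "0 \<le> x" for x :: real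
  proof -
    have D: "0 \<le> y * cosh y - sinh y" if y: "0 \<le> y" for y :: real
    proof -
      have "0 * cosh 0 - sinh 0 \<le> y * cosh y - sinh y"
        by (rule DERIV_nonneg_imp_nondecreasing[OF y])
          (auto intro!: exI derivative_eq_intros mult_nonneg_nonneg)
      then show ?thesis by simp
    qed
    have "0\<^sup>2 / 2 - ln (cosh 0) \<le> x\<^sup>2 / 2 - ln (cosh x)"
    proof (rule DERIV_nonneg_imp_nondecreasing[OF x])
      fix y :: real assume y: "0 \<le> y" "y \<le> x"
      have "((\<lambda>y. y\<^sup>2 / 2 - ln (cosh y)) has_real_derivative (y - sinh y / cosh y)) (at y)"
        by (auto intro!: derivative_eq_intros simp: cosh_real_pos)
      moreover have "0 \<le> y - sinh y / cosh y"
        using D[OF y(1)] cosh_real_pos[of y] by (simp add: field_simps)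
      ultimately show "\<exists>z. ((\<lambda>y. y\<^sup>2 / 2 - ln (cosh y)) has_real_derivative z) (at y) \<and> 0 \<le> z" by blast
    qed
    then have "ln (cosh x) \<le> x\<^sup>2 / 2" by simp
    then show ?thesis using cosh_real_pos[of x] by (metis exp_le_cancel_iff exp_ln)
  qed
  have "cosh x \<le> exp (x\<^sup>2 / 2)"
    using nonneg[of x] nonneg[of "- x"] by (cases "0 \<le> x") auto
  then show ?thesis by (simp add: cosh_field_def)
qed

text \<open>Conditional sub-Gaussian bound: the coefficients \<open>y a\<close> may depend on signs
  outside \<open>I\<close>, as they do after decoupling. The induction replaces the linear terms by
  half their squares one sign at a time; \<open>J\<close> collects the terms that are still
  linear.\<close>

lemma rad_exp_linear_le:
  fixes y :: "'a \<Rightarrow> ('a \<Rightarrow> real) \<Rightarrow> real"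
  assumes "finite K" "I \<subseteq> K" and y: "\<And>a. a \<in> I \<Longrightarrow> free_of I (y a)" and F: "free_of I F"
  shows "rad K (\<lambda>s. exp ((\<Sum>a\<in>I. s a * y a s) + F s)) \<le> rad K (\<lambda>s. exp ((\<Sum>a\<in>I. (y a s)\<^sup>2) / 2 + F s))"
proof -
  have fI: "finite I" using assms finite_subset by blast
  have "rad K (\<lambda>s. exp ((\<Sum>a\<in>J. s a * y a s) + (\<Sum>a\<in>I - J. (y a s)\<^sup>2) / 2 + F s))
      \<le> rad K (\<lambda>s. exp ((\<Sum>a\<in>I. (y a s)\<^sup>2) / 2 + F s))" if "J \<subseteq> I" for J
    using finite_subset[OF that fI] that
  proof (induction J rule: finite_induct)
    case empty
    then show ?case by simp
  next
    case (insert b J)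
    have b: "b \<in> K" "b \<in> I" using insert assms by auto
    define R where "R s = (\<Sum>a\<in>J. s a * y a s) + (\<Sum>a\<in>I - insert b J. (y a s)\<^sup>2) / 2 + F s" for s
    have Rfree: "R (s(b := x)) = R s" and yfree: "y b (s(b := x)) = y b s" for s x
    proof -
      have "y a (s(b := x)) = y a s" if "a \<in> I" for a
        using free_ofD[OF y[OF that] b(2)] .
      moreover have "F (s(b := x)) = F s" using free_ofD[OF F b(2)] .
      moreover have "(s(b := x)) a = s a" if "a \<in> J" for a using that insert by auto
      ultimately show "R (s(b := x)) = R s" "y b (s(b := x)) = y b s"
        using insert.prems b by (auto simp: R_def intro!: sum.cong arg_cong2[where f = "(+)"])
    qed
    have "rad K (\<lambda>s. exp ((\<Sum>a\<in>insert b J. s a * y a s) + (\<Sum>a\<in>I - insert b J. (y a s)\<^sup>2) / 2 + F s))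
       = rad K (\<lambda>s. exp (s b * y b s + R s))"
      using insert by (simp add: R_def add.assoc)
    also have "\<dots> = rad K (\<lambda>s. (exp (y b s + R s) + exp (- y b s + R s)) / 2)"
      by (subst rad_coordinate[OF assms(1) b(1)]) (simp add: Rfree yfree)
    also have "\<dots> \<le> rad K (\<lambda>s. exp ((y b s)\<^sup>2 / 2 + R s))"
    proof (rule rad_mono)
      fix s
      have "(exp (y b s + R s) + exp (- y b s + R s)) / 2 = (exp (y b s) + exp (- y b s)) / 2 * exp (R s)"
        by (simp add: exp_add algebra_simps exp_minus exp_diff divide_simps)
      also have "\<dots> \<le> exp ((y b s)\<^sup>2 / 2) * exp (R s)"
        by (intro mult_right_mono cosh_le_exp_square) auto
      finally show "(exp (y b s + R s) + exp (- y b s + R s)) / 2 \<le> exp ((y b s)\<^sup>2 / 2 + R s)"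
        by (simp add: exp_add)
    qed
    also have "(\<lambda>s. (y b s)\<^sup>2 / 2 + R s) = (\<lambda>s. (\<Sum>a\<in>J. s a * y a s) + (\<Sum>a\<in>I - J. (y a s)\<^sup>2) / 2 + F s)"
    proof (rule ext)
      fix s
      have "I - J = insert b (I - insert b J)" using insert b by auto
      then have "(\<Sum>a\<in>I - J. (y a s)\<^sup>2) = (y b s)\<^sup>2 + (\<Sum>a\<in>I - insert b J. (y a s)\<^sup>2)"
        by (metis (no_types, lifting) Diff_iff fI finite_Diff insertI1 sum.insert)
      then show "(y b s)\<^sup>2 / 2 + R s = (\<Sum>a\<in>J. s a * y a s) + (\<Sum>a\<in>I - J. (y a s)\<^sup>2) / 2 + F s"
        by (simp add: R_def add_divide_distrib)
    qed
    finally show ?case using insert.IH insert.prems by auto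
  qed
  from this[OF subset_refl] show ?thesis by simp
qed

lemma rad_exp_linear:
  assumes "finite K"
  shows "rad K (\<lambda>s. exp (\<Sum>a\<in>K. s a * y a)) \<le> exp ((\<Sum>a\<in>K. (y a)\<^sup>2) / 2)"
  using rad_exp_linear_le[of K K "\<lambda>a s. y a" "\<lambda>s. 0"] assms by (simp add: free_of_def rad_const)

text \<open>Linearising the squares with a Gaussian variable keeps the estimate independent of the
  dimension: \<open>exp (c y\<^sup>2)\<close> is the mean of \<open>exp (sqrt (2 c) \<gamma> y)\<close>.\<close>

lemma gaussian_mgf_quadratic:
  fixes a b :: real
  assumes b: "b < 1 / 2"
  shows "has_bochner_integral lborel (\<lambda>x. std_normal_density x * exp (a * x + b * x\<^sup>2))
     (exp (a\<^sup>2 / (2 * (1 - 2 * b))) / sqrt (1 - 2 * b))"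
proof -
  \<comment> \<open>Completing the square shows that the integrand is \<open>c\<close> times the
    normal density with mean a sigma^2 and standard deviation sigma.\<close>
  define \<sigma> where "\<sigma> = 1 / sqrt (1 - 2 * b)"
  define c where "c = exp (a\<^sup>2 / (2 * (1 - 2 * b))) / sqrt (1 - 2 * b)"
  have s: "\<sigma> > 0" "\<sigma>\<^sup>2 = 1 / (1 - 2 * b)" using b by (auto simp: \<sigma>_def power_divide)
  have eq: "std_normal_density x * exp (a * x + b * x\<^sup>2) = c * normal_density (a * \<sigma>\<^sup>2) \<sigma> x" for x
  proof -
    have e: "- x\<^sup>2 / 2 + (a * x + b * x\<^sup>2) = a\<^sup>2 / (2 * (1 - 2 * b)) - (x - a * \<sigma>\<^sup>2)\<^sup>2 / (2 * \<sigma>\<^sup>2)"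
    proof -
      define w where "w = 1 - 2 * b"
      have w: "w > 0" "b = (1 - w) / 2" using b by (auto simp: w_def)
      have "- x\<^sup>2 / 2 + (a * x + b * x\<^sup>2) = a\<^sup>2 / (2 * w) - (x - a * (1 / w))\<^sup>2 / (2 * (1 / w))"
        using w(1) unfolding w(2) by (simp add: field_simps power2_eq_square)
      then show ?thesis by (simp add: s(2) w_def)
    qed
    have sq: "sqrt (2 * pi * \<sigma>\<^sup>2) = sqrt (2 * pi) * \<sigma>"
      using s(1) by (simp add: real_sqrt_mult)
    have "std_normal_density x * exp (a * x + b * x\<^sup>2) = exp (- x\<^sup>2 / 2 + (a * x + b * x\<^sup>2)) / sqrt (2 * pi)"
      unfolding std_normal_density_def by (simp only: exp_add) simp
    also have "\<dots> = exp (a\<^sup>2 / (2 * (1 - 2 * b))) * exp (- ((x - a * \<sigma>\<^sup>2)\<^sup>2 / (2 * \<sigma>\<^sup>2))) / sqrt (2 * pi)"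
      unfolding e exp_add[symmetric] by simp
    also have "\<dots> = c * normal_density (a * \<sigma>\<^sup>2) \<sigma> x"
    proof -
      have "1 / sqrt (1 - 2 * b) * (1 / (sqrt (2 * pi) * \<sigma>)) = 1 / sqrt (2 * pi)"
        using b by (simp add: \<sigma>_def)
      then show ?thesis unfolding c_def normal_density_def sq by (simp add: field_simps)
    qed
    finally show ?thesis .
  qed
  have "has_bochner_integral lborel (\<lambda>x. c * normal_density (a * \<sigma>\<^sup>2) \<sigma> x) (c * 1)"
    using s(1) by (intro has_bochner_integral_mult_right)
      (simp add: has_bochner_integral_iff integral_normal_density integrable_normal_density)
  then show ?thesis unfolding eq c_def by simp
qed

text \<open>Only the exponential transform of \<open>q\<close> is controlled, so the squares are
  traded for linear terms one direction at a time, each by a Gaussian average. A free linear term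
  \<open>t\<close> in the induction collects the shifts that this creates, and orthogonality keeps
  the directions from interacting.\<close>

lemma rad_exp_square_le:
  fixes q :: "('a \<Rightarrow> real) \<Rightarrow> nat \<Rightarrow> real" and u :: "'b \<Rightarrow> nat \<Rightarrow> real"
  assumes fK: "finite K" and fT: "finite T" and rho: "0 \<le> \<rho>"
    and sub: "\<And>t. rad K (\<lambda>s. exp (ip d t (q s))) \<le> exp (\<rho> * ip d t t / 2)"
    and orth: "\<And>k l. k \<in> T \<Longrightarrow> l \<in> T \<Longrightarrow> ip d (u k) (u l) = (if k = l then 1 else 0)"
    and c: "\<And>k. k \<in> T \<Longrightarrow> 0 \<le> c k \<and> 2 * \<rho> * c k < 1"
  shows "rad K (\<lambda>s. exp (\<Sum>k\<in>T. c k * (ip d (u k) (q s))\<^sup>2)) \<le> (\<Prod>k\<in>T. 1 / sqrt (1 - 2 * \<rho> * c k))"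
proof -
  \<comment> \<open>For a Gaussian \<open>q\<close> with covariance rho times the identity, the
    average in the next claim would equal \<open>P S * exp (B S t)\<close>; the sub-Gaussian
    assumption makes this value an upper bound.\<close>
  define B where "B S t = \<rho> * ip d t t / 2 + (\<Sum>k\<in>S. \<rho>\<^sup>2 * c k * (ip d (u k) t)\<^sup>2 / (1 - 2 * \<rho> * c k))" for S t
  define P where "P S = (\<Prod>k\<in>S. 1 / sqrt (1 - 2 * \<rho> * c k))" for S
  have "rad K (\<lambda>s. exp ((\<Sum>k\<in>S. c k * (ip d (u k) (q s))\<^sup>2) + ip d t (q s))) \<le> P S * exp (B S t)"
    if "S \<subseteq> T" for S t
    using finite_subset[OF that fT] that
  proof (induction S arbitrary: t rule: finite_induct)
    case empty
    then show ?case using sub[of t] by (simp add: P_def B_def)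
  next
    case (insert k S)
    have k: "k \<in> T" "0 \<le> c k" "2 * \<rho> * c k < 1" using c insert by auto
    have P: "P S \<ge> 0" unfolding P_def using c insert by (intro prod_nonneg) (auto simp: less_imp_le)
    define \<tau> where "\<tau> = sqrt (2 * c k)"
    have tau: "\<tau>\<^sup>2 = 2 * c k" using k by (simp add: \<tau>_def)
    let ?n = std_normal_density
    define L where "L s = (\<Sum>k\<in>S. c k * (ip d (u k) (q s))\<^sup>2) + ip d t (q s)" for s
    define W where "W x = rad K (\<lambda>s. exp ((\<Sum>k\<in>S. c k * (ip d (u k) (q s))\<^sup>2) + ip d (\<lambda>i. t i + \<tau> * x * u k i) (q s)))" for x
    have tk: "ip d (\<lambda>i. t i + \<tau> * x * u k i) y = ip d t y + \<tau> * x * ip d (u k) y"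
      "ip d y (\<lambda>i. t i + \<tau> * x * u k i) = ip d y t + \<tau> * x * ip d y (u k)" for x y
      by (simp_all only: ip_add_left ip_scale_left ip_add_right ip_scale_right)
    have W: "W x = rad K (\<lambda>s. exp (L s) * exp (\<tau> * ip d (u k) (q s) * x + 0 * x\<^sup>2))" for x
      unfolding W_def L_def
      by (intro rad_cong) (simp only: tk exp_add, simp add: mult_ac)
    have int1: "has_bochner_integral lborel (\<lambda>x. ?n x * W x)
       (rad K (\<lambda>s. exp ((\<Sum>k\<in>insert k S. c k * (ip d (u k) (q s))\<^sup>2) + ip d t (q s))))"
    proof -
      have "has_bochner_integral lborel (\<lambda>x. exp (L s) * (?n x * exp (\<tau> * ip d (u k) (q s) * x + 0 * x\<^sup>2)))
          (exp (L s) * exp (c k * (ip d (u k) (q s))\<^sup>2))" for s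
        using gaussian_mgf_quadratic[of 0 "\<tau> * ip d (u k) (q s)"]
        by (intro has_bochner_integral_mult_right) (simp add: power_mult_distrib tau)
      then have "has_bochner_integral lborel (\<lambda>x. (\<Sum>s\<in>PiE K (\<lambda>_. {-1, 1}). exp (L s) * (?n x * exp (\<tau> * ip d (u k) (q s) * x + 0 * x\<^sup>2))) / 2 ^ card K)
          (rad K (\<lambda>s. exp (L s) * exp (c k * (ip d (u k) (q s))\<^sup>2)))"
        unfolding rad_def by (intro has_bochner_integral_divide has_bochner_integral_sum)
      moreover have "(\<lambda>x. (\<Sum>s\<in>PiE K (\<lambda>_. {-1, 1}). exp (L s) * (?n x * exp (\<tau> * ip d (u k) (q s) * x + 0 * x\<^sup>2))) / 2 ^ card K)
         = (\<lambda>x. ?n x * W x)"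
        unfolding W rad_def by (simp add: sum_distrib_left mult_ac)
      moreover have "rad K (\<lambda>s. exp (L s) * exp (c k * (ip d (u k) (q s))\<^sup>2))
        = rad K (\<lambda>s. exp ((\<Sum>k\<in>insert k S. c k * (ip d (u k) (q s))\<^sup>2) + ip d t (q s)))"
        using insert by (intro rad_cong) (simp add: L_def exp_add mult_ac)
      ultimately show ?thesis by simp
    qed
    have orthk: "ip d (u l) (u k) = 0" if "l \<in> S" for l
      using that insert orth[of l k] by auto
    \<comment> \<open>As \<open>u k\<close> is orthogonal to the directions in \<open>S\<close>, the
      shift of \<open>t\<close> changes only the term rho |t|^2 / 2, by a quadratic polynomial in x
      that \<open>gaussian_mgf_quadratic\<close> integrates.\<close>
    have Bexp: "B S (\<lambda>i. t i + \<tau> * x * u k i) = B S t + (\<rho> * \<tau> * ip d (u k) t * x + \<rho> * c k * x\<^sup>2)" for x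
    proof -
      have "ip d (u l) (\<lambda>i. t i + \<tau> * x * u k i) = ip d (u l) t" if "l \<in> S" for l
        using orthk[OF that] by (simp add: tk)
      then have 1: "(\<Sum>l\<in>S. \<rho>\<^sup>2 * c l * (ip d (u l) (\<lambda>i. t i + \<tau> * x * u k i))\<^sup>2 / (1 - 2 * \<rho> * c l)) =
           (\<Sum>l\<in>S. \<rho>\<^sup>2 * c l * (ip d (u l) t)\<^sup>2 / (1 - 2 * \<rho> * c l))"
        by (intro sum.cong) auto
      have "ip d (\<lambda>i. t i + \<tau> * x * u k i) (\<lambda>i. t i + \<tau> * x * u k i)
         = ip d t t + 2 * (\<tau> * x) * ip d (u k) t + (\<tau> * x) * (\<tau> * x) * ip d (u k) (u k)"
        by (simp only: tk ip_commute[of d t "u k"]) (simp add: algebra_simps)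
      also have "\<dots> = ip d t t + 2 * (\<tau> * x) * ip d (u k) t + 2 * c k * x\<^sup>2"
        using orth[OF k(1) k(1)] tau by (simp add: power2_eq_square algebra_simps)
      finally show ?thesis unfolding B_def 1 by (simp add: algebra_simps)
    qed
    have "has_bochner_integral lborel (\<lambda>x. P S * exp (B S t) * (?n x * exp (\<rho> * \<tau> * ip d (u k) t * x + \<rho> * c k * x\<^sup>2)))
       (P S * exp (B S t) * (exp ((\<rho> * \<tau> * ip d (u k) t)\<^sup>2 / (2 * (1 - 2 * (\<rho> * c k)))) / sqrt (1 - 2 * (\<rho> * c k))))"
      using k by (intro has_bochner_integral_mult_right gaussian_mgf_quadratic) simp
    moreover have "P S * exp (B S t) * (exp ((\<rho> * \<tau> * ip d (u k) t)\<^sup>2 / (2 * (1 - 2 * (\<rho> * c k)))) / sqrt (1 - 2 * (\<rho> * c k)))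
        = P (insert k S) * exp (B (insert k S) t)"
    proof -
      have "(\<rho> * \<tau> * ip d (u k) t)\<^sup>2 / (2 * (1 - 2 * (\<rho> * c k))) = \<rho>\<^sup>2 * c k * (ip d (u k) t)\<^sup>2 / (1 - 2 * \<rho> * c k)"
        using k(3) by (simp add: power_mult_distrib tau field_simps)
      then show ?thesis using insert by (simp add: P_def B_def exp_add mult_ac)
    qed
    moreover have "?n x * W x \<le> P S * exp (B S t) * (?n x * exp (\<rho> * \<tau> * ip d (u k) t * x + \<rho> * c k * x\<^sup>2))" for x
    proof -
      have "W x \<le> P S * exp (B S (\<lambda>i. t i + \<tau> * x * u k i))"
        unfolding W_def using insert by (intro insert.IH) auto
      then have "?n x * W x \<le> ?n x * (P S * exp (B S (\<lambda>i. t i + \<tau> * x * u k i)))"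
        by (intro mult_left_mono) auto
      then show ?thesis unfolding Bexp by (simp add: exp_add mult_ac)
    qed
    ultimately show ?case
      using int1 by (metis (no_types, lifting) has_bochner_integral_iff integral_mono)
  qed
  from this[OF subset_refl, of "\<lambda>i. 0"] show ?thesis
    by (simp add: B_def P_def ip_def)
qed

section \<open>Exponential moments of the off-diagonal sketch\<close>

lemma rad_swap: "rad K (\<lambda>s. rad L (\<lambda>r. f s r)) = rad L (\<lambda>r. rad K (\<lambda>s. f s r))"
proof -
  have "rad K (\<lambda>s. rad L (\<lambda>r. f s r)) =
      (\<Sum>s\<in>PiE K (\<lambda>_. {-1, 1}). \<Sum>r\<in>PiE L (\<lambda>_. {-1, 1}). f s r / 2 ^ card L / 2 ^ card K)"
    by (simp add: rad_def sum_divide_distrib)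
  also have "\<dots> = (\<Sum>r\<in>PiE L (\<lambda>_. {-1, 1}). \<Sum>s\<in>PiE K (\<lambda>_. {-1, 1}). f s r / 2 ^ card K / 2 ^ card L)"
    by (subst sum.swap) (simp add: mult.commute)
  also have "\<dots> = rad L (\<lambda>r. rad K (\<lambda>s. f s r))"
    by (simp add: rad_def sum_divide_distrib)
  finally show ?thesis .
qed

lemma exp_rad_le:
  assumes "finite K"
  shows "exp (rad K f) \<le> rad K (\<lambda>s. exp (f s))"
proof -
  \<comment> \<open>Jensen's inequality from the tangent of exp at the mean
    \<open>a\<close>.\<close>
  define a where "a = rad K f"
  have "exp a * (1 + f s - a) \<le> exp (f s)" for s
  proof -
    have "exp a * (1 + (f s - a)) \<le> exp a * exp (f s - a)"
      by (intro mult_left_mono exp_ge_add_one_self) auto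
    then show ?thesis by (simp add: exp_diff algebra_simps)
  qed
  then have "rad K (\<lambda>s. exp a * (1 + f s - a)) \<le> rad K (\<lambda>s. exp (f s))"
    by (intro rad_mono) auto
  moreover have "rad K (\<lambda>s. exp a * (1 + f s - a)) = exp a"
    by (simp add: rad_mult_left rad_add rad_diff rad_const assms a_def)
  ultimately show ?thesis by (simp add: a_def)
qed

lemma rad_sign_split:
  fixes m :: nat
  assumes "i < m" "j < m"
  shows "rad {..<m} (\<lambda>r. (1 + r i) * (1 - r j)) = (if i = j then 0 else 1)"
proof -
  have lin: "rad {..<m} (\<lambda>r. r k) = 0" if "k < m" for k
    using rad_linear_free[of "{..<m}" k "\<lambda>_. 1"] that by (simp add: free_of_def)
  have "rad {..<m} (\<lambda>r. r i * r j) = (if i = j then 1 else 0)"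
  proof (cases "i = j")
    case True
    have "rad {..<m} (\<lambda>r. r i * r j) = rad {..<m} (\<lambda>r. 1)"
    proof (rule rad_cong)
      fix r assume "r \<in> PiE {..<m} (\<lambda>_. {-1, 1::real})"
      from PiE_mem[OF this, of i] show "r i * r j = 1" using assms True by auto
    qed
    then show ?thesis using True by (simp add: rad_const)
  next
    case False
    then show ?thesis
      using rad_linear_free[of "{..<m}" i "\<lambda>r. r j"] assms by (simp add: free_of_def)
  qed
  moreover have "rad {..<m} (\<lambda>r. (1 + r i) * (1 - r j)) =
     rad {..<m} (\<lambda>r. 1 + r i - r j - r i * r j)"
    by (intro rad_cong) (simp add: algebra_simps)
  ultimately show ?thesis using lin assms by (simp add: rad_add rad_diff rad_const)
qed

text \<open>Row i of the sign array \<open>s\<close> is the random vector g_i, so this is the inner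
  product of u_k and g_i.\<close>

definition proj :: "nat \<Rightarrow> ('b \<Rightarrow> nat \<Rightarrow> real) \<Rightarrow> (nat \<times> nat \<Rightarrow> real) \<Rightarrow> 'b \<Rightarrow> nat \<Rightarrow> real" where
  "proj d u s k i = ip d (u k) (\<lambda>l. s (i, l))"

text \<open>Weighted sums of rows are sub-Gaussian, with the sum of the squared weights as variance
  proxy. This supplies the hypothesis \<open>sub\<close> of \<open>rad_exp_square_le\<close>, and
  with a single row it bounds the moments of a projection.\<close>

lemma subgaussian_combination:
  fixes x :: "nat \<Rightarrow> real"
  assumes J: "J \<subseteq> {..<m}" and R: "ip m x x \<le> R"
  shows "rad ({..<m} \<times> {..<d}) (\<lambda>s. exp (ip d t (\<lambda>l. \<Sum>j\<in>J. x j * s (j, l)))) \<le> exp (R * ip d t t / 2)"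
proof -
  let ?K = "{..<m} \<times> {..<d}"
  define y where "y a = (if fst a \<in> J then x (fst a) * t (snd a) else 0)" for a :: "nat \<times> nat"
  have fJ: "finite J" using J finite_subset by blast
  have J1: "(\<Sum>i<m. if i \<in> J then f i else 0) = (\<Sum>i\<in>J. f i)" for f :: "nat \<Rightarrow> real"
    using J by (simp add: sum.inter_restrict[symmetric] Int_absorb1)
  have lin: "ip d t (\<lambda>l. \<Sum>j\<in>J. x j * s (j, l)) = (\<Sum>a\<in>?K. s a * y a)" for s
  proof -
    have "(\<Sum>a\<in>?K. s a * y a) = (\<Sum>j<m. \<Sum>l<d. s (j, l) * y (j, l))"
      by (simp add: sum.cartesian_product)
    also have "\<dots> = (\<Sum>j<m. if j \<in> J then (\<Sum>l<d. t l * (x j * s (j, l))) else 0)"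
      by (intro sum.cong) (auto simp: y_def mult_ac)
    also have "\<dots> = ip d t (\<lambda>l. \<Sum>j\<in>J. x j * s (j, l))"
      unfolding J1 ip_sum_right by (simp add: ip_def)
    finally show ?thesis ..
  qed
  have "(\<Sum>a\<in>?K. (y a)\<^sup>2) = (\<Sum>j<m. \<Sum>l<d. (y (j, l))\<^sup>2)"
    by (simp add: sum.cartesian_product)
  also have "\<dots> = (\<Sum>j<m. if j \<in> J then x j * x j * ip d t t else 0)"
    by (intro sum.cong) (auto simp: y_def ip_def sum_distrib_left power2_eq_square mult_ac)
  also have "\<dots> \<le> (\<Sum>j<m. x j * x j * ip d t t)"
    by (intro sum_mono) (auto simp: ip_nonneg)
  also have "\<dots> = ip m x x * ip d t t" by (simp add: ip_def[of m] sum_distrib_right)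
  also have "\<dots> \<le> R * ip d t t" using R by (intro mult_right_mono ip_nonneg)
  finally have "exp ((\<Sum>a\<in>?K. (y a)\<^sup>2) / 2) \<le> exp (R * ip d t t / 2)" by simp
  then show ?thesis unfolding lin using rad_exp_linear[of ?K y] by (meson finite_SigmaI finite_lessThan order_trans)
qed

lemma inverse_sqrt_le_exp:
  fixes y :: real
  assumes "0 \<le> y" "y \<le> 1 / 2"
  shows "1 / sqrt (1 - y) \<le> exp y"
proof -
  have "- y - 2 * y\<^sup>2 \<le> ln (1 - y)"
    using assms by (intro ln_one_minus_pos_lower_bound)
  moreover have "2 * y\<^sup>2 \<le> y"
    using mult_left_mono[of "2 * y" 1 y] assms by (simp add: power2_eq_square)
  ultimately have "- (2 * y) \<le> ln (1 - y)" by linarith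
  then have "exp (- (2 * y)) \<le> 1 - y" using assms by (simp add: ln_ge_iff)
  then have "sqrt (exp (- (2 * y))) \<le> sqrt (1 - y)" by (rule real_sqrt_le_mono)
  moreover have "sqrt (exp (- (2 * y))) = exp (- y)"
    by (rule real_sqrt_unique) (auto simp: power2_eq_square simp flip: exp_add)
  ultimately have "exp (- y) \<le> sqrt (1 - y)" by simp
  then show ?thesis using assms by (simp add: exp_minus field_simps)
qed

text \<open>A Hanson-Wright estimate in two layers. For fixed rows outside \<open>I\<close> the form
  is linear in the rows of \<open>I\<close>, so averaging leaves theta^2 R |w|^2 / 2, where |w|^2 is
  the sum of lam_k^2 <u_k, q>^2 and \<open>q\<close> combines the remaining rows. These squares go
  to \<open>rad_exp_square_le\<close>, and 1 / sqrt (1 - y) <= exp y turns its product into the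
  exponential of a squared Frobenius norm.\<close>

lemma decoupled_mgf:
  fixes u :: "'b \<Rightarrow> nat \<Rightarrow> real" and x :: "nat \<Rightarrow> real"
  assumes fT: "finite T"
    and orth: "\<And>k l. k \<in> T \<Longrightarrow> l \<in> T \<Longrightarrow> ip d (u k) (u l) = (if k = l then 1 else 0)"
    and I: "I \<subseteq> {..<m}" and R: "ip m x x \<le> R"
    and small: "\<And>k. k \<in> T \<Longrightarrow> \<theta>\<^sup>2 * R\<^sup>2 * (lam k)\<^sup>2 \<le> 1 / 2"
  shows "rad ({..<m} \<times> {..<d}) (\<lambda>s. exp (\<theta> * (\<Sum>i\<in>I. \<Sum>j\<in>{..<m} - I. x i * x j * (\<Sum>k\<in>T. lam k * proj d u s k i * proj d u s k j))))
    \<le> exp (\<theta>\<^sup>2 * R\<^sup>2 * (\<Sum>k\<in>T. (lam k)\<^sup>2))"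
proof -
  let ?K = "{..<m} \<times> {..<d}" and ?J = "{..<m} - I"
  define q where "q s l = (\<Sum>j\<in>?J. x j * s (j, l))" for s :: "nat \<times> nat \<Rightarrow> real" and l
  define w where "w s l = (\<Sum>k\<in>T. lam k * ip d (u k) (q s) * u k l)" for s l
  define y where "y a s = \<theta> * x (fst a) * w s (snd a)" for a :: "nat \<times> nat" and s
  have fI: "finite I" using I finite_subset by blast
  have R0: "0 \<le> R" using R ip_nonneg[of m x] by linarith
  have projq: "(\<Sum>j\<in>?J. x j * proj d u s k j) = ip d (u k) (q s)" for s k
    unfolding proj_def q_def ip_sum_right by (simp add: ip_scale_right)
  have lin: "\<theta> * (\<Sum>i\<in>I. \<Sum>j\<in>?J. x i * x j * (\<Sum>k\<in>T. lam k * proj d u s k i * proj d u s k j))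
      = (\<Sum>a\<in>I \<times> {..<d}. s a * y a s)" for s
  proof -
    have "(\<Sum>a\<in>I \<times> {..<d}. s a * y a s) = (\<Sum>i\<in>I. \<Sum>l<d. s (i, l) * y (i, l) s)"
      by (simp add: sum.cartesian_product)
    also have "\<dots> = (\<Sum>i\<in>I. \<theta> * x i * ip d (w s) (\<lambda>l. s (i, l)))"
      by (intro sum.cong refl) (simp add: y_def ip_def sum_distrib_left mult_ac)
    also have "\<dots> = (\<Sum>i\<in>I. \<theta> * x i * (\<Sum>k\<in>T. lam k * ip d (u k) (q s) * proj d u s k i))"
      unfolding w_def ip_sum_left ip_scale_left proj_def by simp
    also have "\<dots> = (\<Sum>i\<in>I. \<theta> * x i * (\<Sum>k\<in>T. lam k * (\<Sum>j\<in>?J. x j * proj d u s k j) * proj d u s k i))"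
      unfolding projq ..
    also have "\<dots> = (\<Sum>i\<in>I. \<theta> * x i * (\<Sum>k\<in>T. \<Sum>j\<in>?J. x j * (lam k * proj d u s k i * proj d u s k j)))"
      by (simp add: sum_distrib_left sum_distrib_right mult_ac)
    also have "\<dots> = (\<Sum>i\<in>I. \<theta> * x i * (\<Sum>j\<in>?J. x j * (\<Sum>k\<in>T. lam k * proj d u s k i * proj d u s k j)))"
      by (subst sum.swap) (simp add: sum_distrib_left)
    also have "\<dots> = \<theta> * (\<Sum>i\<in>I. \<Sum>j\<in>?J. x i * x j * (\<Sum>k\<in>T. lam k * proj d u s k i * proj d u s k j))"
      by (simp add: sum_distrib_left mult.assoc)
    finally show ?thesis ..
  qed
  have free: "free_of (I \<times> {..<d}) (y a)" for a
  proof -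
    have "q (s(b := z)) = q s" if "b \<in> I \<times> {..<d}" for s b z
      using that by (auto simp: q_def fun_eq_iff intro!: sum.cong)
    then show ?thesis by (simp add: free_of_def y_def w_def)
  qed
  have sq: "(\<Sum>a\<in>I \<times> {..<d}. (y a s)\<^sup>2) / 2 \<le> (\<Sum>k\<in>T. (\<theta>\<^sup>2 * R * (lam k)\<^sup>2 / 2) * (ip d (u k) (q s))\<^sup>2)" for s
  proof -
    have ww: "ip d (w s) (w s) = (\<Sum>k\<in>T. (lam k)\<^sup>2 * (ip d (u k) (q s))\<^sup>2)"
    proof -
      have uw: "ip d (u k) (w s) = lam k * ip d (u k) (q s)" if "k \<in> T" for k
      proof -
        have "ip d (u k) (w s) = (\<Sum>l\<in>T. lam l * ip d (u l) (q s) * ip d (u k) (u l))"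
          unfolding w_def ip_sum_right ip_scale_right ..
        also have "\<dots> = (\<Sum>l\<in>T. if k = l then lam l * ip d (u l) (q s) else 0)"
          using orth that by (intro sum.cong) auto
        finally show ?thesis using that fT by simp
      qed
      have "ip d (w s) (w s) = (\<Sum>k\<in>T. lam k * ip d (u k) (q s) * ip d (u k) (w s))"
      proof -
        have "ip d (w s) z = (\<Sum>k\<in>T. lam k * ip d (u k) (q s) * ip d (u k) z)" for z
          unfolding w_def[abs_def] by (simp only: ip_sum_left ip_scale_left)
        then show ?thesis .
      qed
      then show ?thesis by (simp add: uw power2_eq_square mult_ac)
    qed
    have "(\<Sum>a\<in>I \<times> {..<d}. (y a s)\<^sup>2) = (\<Sum>i\<in>I. \<Sum>l<d. (y (i, l) s)\<^sup>2)"
      by (simp add: sum.cartesian_product)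
    also have "\<dots> = (\<Sum>i\<in>I. x i * x i * (\<theta>\<^sup>2 * ip d (w s) (w s)))"
      by (intro sum.cong refl) (simp add: y_def ip_def sum_distrib_left power2_eq_square mult_ac)
    also have "\<dots> \<le> (\<Sum>i<m. x i * x i * (\<theta>\<^sup>2 * ip d (w s) (w s)))"
      using I by (intro sum_mono2) (auto simp: ip_nonneg)
    also have "\<dots> = ip m x x * (\<theta>\<^sup>2 * ip d (w s) (w s))"
      by (simp add: ip_def[of m] sum_distrib_right)
    also have "\<dots> \<le> R * (\<theta>\<^sup>2 * ip d (w s) (w s))"
      using R by (intro mult_right_mono) (auto simp: ip_nonneg)
    finally have "(\<Sum>a\<in>I \<times> {..<d}. (y a s)\<^sup>2) / 2 \<le> R * (\<theta>\<^sup>2 * ip d (w s) (w s)) / 2" by simp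
    also have "\<dots> = (\<Sum>k\<in>T. (\<theta>\<^sup>2 * R * (lam k)\<^sup>2 / 2) * (ip d (u k) (q s))\<^sup>2)"
      unfolding ww by (simp add: sum_distrib_left sum_divide_distrib mult_ac)
    finally show ?thesis .
  qed
  have "rad ?K (\<lambda>s. exp (\<Sum>a\<in>I \<times> {..<d}. s a * y a s)) \<le> rad ?K (\<lambda>s. exp ((\<Sum>a\<in>I \<times> {..<d}. (y a s)\<^sup>2) / 2))"
    using rad_exp_linear_le[of ?K "I \<times> {..<d}" y "\<lambda>_. 0"] I free by (auto simp: free_of_def)
  also have "\<dots> \<le> rad ?K (\<lambda>s. exp (\<Sum>k\<in>T. (\<theta>\<^sup>2 * R * (lam k)\<^sup>2 / 2) * (ip d (u k) (q s))\<^sup>2))"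
    using sq by (intro rad_mono) simp
  also have "\<dots> \<le> (\<Prod>k\<in>T. 1 / sqrt (1 - 2 * R * (\<theta>\<^sup>2 * R * (lam k)\<^sup>2 / 2)))"
  proof (rule rad_exp_square_le)
    show "rad ?K (\<lambda>s. exp (ip d t (q s))) \<le> exp (R * ip d t t / 2)" for t
      unfolding q_def[abs_def] using R by (intro subgaussian_combination) auto
    show "0 \<le> \<theta>\<^sup>2 * R * (lam k)\<^sup>2 / 2 \<and> 2 * R * (\<theta>\<^sup>2 * R * (lam k)\<^sup>2 / 2) < 1" if "k \<in> T" for k
    proof
      show "0 \<le> \<theta>\<^sup>2 * R * (lam k)\<^sup>2 / 2" using R0 by simp
      show "2 * R * (\<theta>\<^sup>2 * R * (lam k)\<^sup>2 / 2) < 1"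
        using small[OF that] by (simp add: power2_eq_square mult_ac)
    qed
  qed (use fT R0 orth in auto)
  also have "\<dots> \<le> (\<Prod>k\<in>T. exp (\<theta>\<^sup>2 * R\<^sup>2 * (lam k)\<^sup>2))"
  proof (rule prod_mono, safe)
    fix k assume k: "k \<in> T"
    have e: "2 * R * (\<theta>\<^sup>2 * R * (lam k)\<^sup>2 / 2) = \<theta>\<^sup>2 * R\<^sup>2 * (lam k)\<^sup>2"
      by (simp add: power2_eq_square)
    show "1 / sqrt (1 - 2 * R * (\<theta>\<^sup>2 * R * (lam k)\<^sup>2 / 2)) \<le> exp (\<theta>\<^sup>2 * R\<^sup>2 * (lam k)\<^sup>2)"
      unfolding e using small[OF k] by (intro inverse_sqrt_le_exp) auto
    show "0 \<le> 1 / sqrt (1 - 2 * R * (\<theta>\<^sup>2 * R * (lam k)\<^sup>2 / 2))"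
      unfolding e using small[OF k] by auto
  qed
  also have "\<dots> = exp (\<theta>\<^sup>2 * R\<^sup>2 * (\<Sum>k\<in>T. (lam k)\<^sup>2))"
    using fT by (simp add: exp_sum sum_distrib_left)
  finally show ?thesis unfolding lin .
qed

text \<open>A random splitting of the rows decouples the form: the weight \<open>(1 + r\<^sub>i) (1 - r\<^sub>j)\<close> vanishes unless
  \<open>r\<^sub>i = 1\<close> and \<open>r\<^sub>j = -1\<close>, and has mean \<open>1\<close> for \<open>i \<noteq> j\<close>.\<close>

lemma off_diagonal_mgf:
  fixes u :: "'b \<Rightarrow> nat \<Rightarrow> real" and x :: "nat \<Rightarrow> real"
  assumes fT: "finite T"
    and orth: "\<And>k l. k \<in> T \<Longrightarrow> l \<in> T \<Longrightarrow> ip d (u k) (u l) = (if k = l then 1 else 0)"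
    and R: "ip m x x \<le> R"
    and small: "\<And>k. k \<in> T \<Longrightarrow> 16 * \<theta>\<^sup>2 * R\<^sup>2 * (lam k)\<^sup>2 \<le> 1 / 2"
  shows "rad ({..<m} \<times> {..<d}) (\<lambda>s. exp (\<theta> * (\<Sum>i<m. \<Sum>j<m. if i = j then 0 else x i * x j * (\<Sum>k\<in>T. lam k * proj d u s k i * proj d u s k j))))
    \<le> exp (16 * \<theta>\<^sup>2 * R\<^sup>2 * (\<Sum>k\<in>T. (lam k)\<^sup>2))"
proof -
  let ?K = "{..<m} \<times> {..<d}"
  define a where "a s i j = x i * x j * (\<Sum>k\<in>T. lam k * proj d u s k i * proj d u s k j)" for s i j
  define Q where "Q s r = \<theta> * (\<Sum>i<m. \<Sum>j<m. (1 + r i) * (1 - r j) * a s i j)" for s and r :: "nat \<Rightarrow> real"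
  have mean: "\<theta> * (\<Sum>i<m. \<Sum>j<m. if i = j then 0 else a s i j) = rad {..<m} (Q s)" for s
  proof -
    have "rad {..<m} (Q s) = \<theta> * (\<Sum>i<m. \<Sum>j<m. rad {..<m} (\<lambda>r. (1 + r i) * (1 - r j)) * a s i j)"
      unfolding Q_def[abs_def] by (simp only: rad_mult_left rad_sum rad_mult_right)
    also have "\<dots> = \<theta> * (\<Sum>i<m. \<Sum>j<m. if i = j then 0 else a s i j)"
      by (intro arg_cong2[where f = "(*)"] sum.cong refl) (auto simp: rad_sign_split)
    finally show ?thesis ..
  qed
  have "rad ?K (\<lambda>s. exp (\<theta> * (\<Sum>i<m. \<Sum>j<m. if i = j then 0 else a s i j)))
      \<le> rad ?K (\<lambda>s. rad {..<m} (\<lambda>r. exp (Q s r)))"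
    unfolding mean by (intro rad_mono exp_rad_le) simp
  also have "\<dots> = rad {..<m} (\<lambda>r. rad ?K (\<lambda>s. exp (Q s r)))" by (rule rad_swap)
  also have "\<dots> \<le> rad {..<m} (\<lambda>r. exp (16 * \<theta>\<^sup>2 * R\<^sup>2 * (\<Sum>k\<in>T. (lam k)\<^sup>2)))"
  proof (rule rad_mono)
    fix r assume r: "r \<in> PiE {..<m} (\<lambda>_. {-1, 1::real})"
    \<comment> \<open>For a fixed splitting the weight is 4 on the rows of \<open>I\<close> against
      the others and 0 elsewhere, so the decoupled bound applies with 4 theta; hence the factor
      16.\<close>
    define I where "I = {i. i < m \<and> r i = 1}"
    have I: "I \<subseteq> {..<m}" "finite I" by (auto simp: I_def)
    have "(\<Sum>i<m. \<Sum>j<m. (1 + r i) * (1 - r j) * a s i j) = (\<Sum>i\<in>I. \<Sum>j\<in>{..<m} - I. 4 * a s i j)" for s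
    proof -
      have r': "r i = 1 \<or> r i = -1" if "i < m" for i using PiE_mem[OF r, of i] that by auto
      have "(\<Sum>i<m. \<Sum>j<m. (1 + r i) * (1 - r j) * a s i j) = (\<Sum>i<m. \<Sum>j<m. if i \<in> I \<and> j \<in> {..<m} - I then 4 * a s i j else 0)"
        using r' by (intro sum.cong refl) (force simp: I_def)
      also have "\<dots> = (\<Sum>i<m. if i \<in> I then (\<Sum>j<m. if j \<in> {..<m} - I then 4 * a s i j else 0) else 0)"
        by (intro sum.cong refl) auto
      also have "\<dots> = (\<Sum>i\<in>I. \<Sum>j<m. if j \<in> {..<m} - I then 4 * a s i j else 0)"
        using I by (simp add: sum.inter_restrict[symmetric] Int_absorb1)
      also have "\<dots> = (\<Sum>i\<in>I. \<Sum>j\<in>{..<m} - I. 4 * a s i j)"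
        by (simp add: sum.inter_restrict[symmetric] Int_absorb1 del: Diff_iff)
      finally show ?thesis .
    qed
    then have Q: "Q s r = (4 * \<theta>) * (\<Sum>i\<in>I. \<Sum>j\<in>{..<m} - I. a s i j)" for s
      by (simp add: Q_def sum_distrib_left mult_ac)
    have "rad ?K (\<lambda>s. exp (Q s r)) \<le> exp ((4 * \<theta>)\<^sup>2 * R\<^sup>2 * (\<Sum>k\<in>T. (lam k)\<^sup>2))"
      unfolding Q a_def using small
      by (intro decoupled_mgf[OF fT orth I(1) R]) (auto simp: power_mult_distrib)
    then show "rad ?K (\<lambda>s. exp (Q s r)) \<le> exp (16 * \<theta>\<^sup>2 * R\<^sup>2 * (\<Sum>k\<in>T. (lam k)\<^sup>2))"
      by (simp add: power_mult_distrib)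
  qed
  finally show ?thesis unfolding a_def by (simp add: rad_const)
qed

section \<open>Operator norm of the sketched tail\<close>

lemma
  assumes "spectral_decomp n A \<mu> u"
  shows spectral_decomp_orth: "\<And>k l. k < n \<Longrightarrow> l < n \<Longrightarrow> ip n (u k) (u l) = (if k = l then 1 else 0)"
    and spectral_decomp_entry: "\<And>i j. i < n \<Longrightarrow> j < n \<Longrightarrow> A i j = (\<Sum>k<n. \<mu> k * u k i * u k j)"
  using assms by (auto simp: spectral_decomp_def)

lemma spectral_decomp_complete:
  assumes "spectral_decomp n A \<mu> u" "i < n" "j < n"
  shows "(\<Sum>k<n. u k i * u k j) = (if i = j then 1 else 0)"
  using orthonormal_square_complete[OF spectral_decomp_orth[OF assms(1)] assms(2,3)] .

lemma spectral_decomp_parseval: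
  assumes "spectral_decomp n A \<mu> u"
  shows "(\<Sum>k<n. (ip n (u k) x)\<^sup>2) = ip n x x"
proof -
  have "(\<Sum>k<n. (ip n (u k) x)\<^sup>2) = (\<Sum>k<n. \<Sum>i<n. \<Sum>j<n. (u k i * u k j) * (x i * x j))"
    by (simp add: ip_def power2_eq_square sum_product mult_ac)
  also have "\<dots> = (\<Sum>i<n. \<Sum>k<n. \<Sum>j<n. (u k i * u k j) * (x i * x j))"
    by (rule sum.swap)
  also have "\<dots> = (\<Sum>i<n. \<Sum>j<n. \<Sum>k<n. (u k i * u k j) * (x i * x j))"
    by (intro sum.cong refl sum.swap)
  also have "\<dots> = (\<Sum>i<n. \<Sum>j<n. (if j = i then x i * x j else 0))"
    unfolding sum_distrib_right[symmetric]
    by (intro sum.cong refl) (simp add: spectral_decomp_complete[OF assms])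
  also have "\<dots> = ip n x x" by (simp add: ip_def)
  finally show ?thesis .
qed

lemma quadratic_rank_one_sum:
  assumes "\<And>i j. i < n \<Longrightarrow> j < n \<Longrightarrow> A i j = (\<Sum>k\<in>S. \<mu> k * u k i * u k j)"
  shows "ip n x (mv n A y) = (\<Sum>k\<in>S. \<mu> k * ip n (u k) x * ip n (u k) y)"
proof -
  have "ip n x (mv n A y) = (\<Sum>i<n. \<Sum>j<n. \<Sum>k\<in>S. \<mu> k * (u k i * x i) * (u k j * y j))"
    unfolding ip_def mv_def sum_distrib_left
    by (intro sum.cong refl) (simp add: assms sum_distrib_left sum_distrib_right mult_ac)
  also have "\<dots> = (\<Sum>i<n. \<Sum>k\<in>S. \<Sum>j<n. \<mu> k * (u k i * x i) * (u k j * y j))"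
    by (intro sum.cong refl sum.swap)
  also have "\<dots> = (\<Sum>k\<in>S. \<Sum>i<n. \<Sum>j<n. \<mu> k * (u k i * x i) * (u k j * y j))"
    by (rule sum.swap)
  also have "\<dots> = (\<Sum>k\<in>S. \<mu> k * ip n (u k) x * ip n (u k) y)"
    by (simp add: ip_def sum_distrib_left sum_distrib_right mult_ac)
  finally show ?thesis .
qed

lemma spectral_decomp_quadratic:
  assumes "spectral_decomp n A \<mu> u"
  shows "ip n x (mv n A x) = (\<Sum>k<n. \<mu> k * (ip n (u k) x)\<^sup>2)"
proof -
  have "ip n x (mv n A x) = (\<Sum>k<n. \<mu> k * ip n (u k) x * ip n (u k) x)"
    by (intro quadratic_rank_one_sum spectral_decomp_entry[OF assms])
  then show ?thesis by (simp add: power2_eq_square mult.assoc)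
qed

lemma spectral_decomp_eigenvector:
  assumes "spectral_decomp n A \<mu> u" "k < n"
  shows "ip n x (mv n A (u k)) = \<mu> k * ip n x (u k)"
proof -
  have "ip n x (mv n A (u k)) = (\<Sum>l<n. \<mu> l * ip n (u l) x * ip n (u l) (u k))"
    by (intro quadratic_rank_one_sum spectral_decomp_entry[OF assms(1)])
  also have "\<dots> = (\<Sum>l<n. if l = k then \<mu> l * ip n (u l) x else 0)"
    by (intro sum.cong refl) (simp add: spectral_decomp_orth[OF assms(1)] assms(2))
  also have "\<dots> = \<mu> k * ip n x (u k)" using assms(2) by (simp add: ip_commute)
  finally show ?thesis .
qed

lemma spectral_decomp_frobenius:
  assumes "spectral_decomp n A \<mu> u"
  shows "(\<Sum>i<n. \<Sum>j<n. (A i j)\<^sup>2) = (\<Sum>k<n. (\<mu> k)\<^sup>2)"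
proof -
  have row: "(\<Sum>j<n. (A i j)\<^sup>2) = (\<Sum>k<n. (\<mu> k)\<^sup>2 * (u k i * u k i))" if i: "i < n" for i
  proof -
    have Ai: "A i j = (\<Sum>k<n. (\<mu> k * u k i) * u k j)" if "j < n" for j
      using spectral_decomp_entry[OF assms i that] by (simp add: mult.assoc)
    have "(\<Sum>j<n. (A i j)\<^sup>2) = ip n (A i) (A i)" by (simp add: ip_def power2_eq_square)
    also have "\<dots> = ip n (\<lambda>j. \<Sum>k<n. (\<mu> k * u k i) * u k j) (\<lambda>j. \<Sum>k<n. (\<mu> k * u k i) * u k j)"
      unfolding ip_def by (intro sum.cong refl) (simp add: Ai)
    also have "\<dots> = (\<Sum>k<n. \<Sum>l<n. (\<mu> k * u k i) * ((\<mu> l * u l i) * ip n (u k) (u l)))"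
      unfolding ip_sum_left ip_scale_left unfolding ip_sum_right ip_scale_right sum_distrib_left ..
    also have "\<dots> = (\<Sum>k<n. \<Sum>l<n. if l = k then (\<mu> k)\<^sup>2 * (u k i * u k i) else 0)"
      by (intro sum.cong refl) (auto simp: spectral_decomp_orth[OF assms] power2_eq_square mult_ac)
    also have "\<dots> = (\<Sum>k<n. (\<mu> k)\<^sup>2 * (u k i * u k i))" by simp
    finally show ?thesis .
  qed
  have "(\<Sum>i<n. \<Sum>j<n. (A i j)\<^sup>2) = (\<Sum>i<n. \<Sum>k<n. (\<mu> k)\<^sup>2 * (u k i * u k i))"
    using row by simp
  also have "\<dots> = (\<Sum>k<n. (\<mu> k)\<^sup>2 * ip n (u k) (u k))"
    by (subst sum.swap) (simp add: ip_def sum_distrib_left)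
  also have "\<dots> = (\<Sum>k<n. (\<mu> k)\<^sup>2)"
    by (intro sum.cong refl) (simp add: spectral_decomp_orth[OF assms])
  finally show ?thesis .
qed

text \<open>Lattice points in the role of a net of a sphere of radius of order sqrt m, so that
  approximation is coordinatewise rounding. The box follows from the bound on the squares and makes
  finiteness immediate.\<close>

definition int_net :: "nat \<Rightarrow> (nat \<Rightarrow> int) set" where
  "int_net m = {z \<in> PiE {..<m} (\<lambda>_. {- (7 * int m)..7 * int m}). (\<Sum>i<m. (real_of_int (z i))\<^sup>2) \<le> 7 * m}"

lemma finite_int_net: "finite (int_net m)"
proof -
  have "finite (PiE {..<m} (\<lambda>_. {- (7 * int m)..7 * int m}))" by (intro finite_PiE) auto
  then show ?thesis unfolding int_net_def by (rule rev_finite_subset) auto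
qed

lemma sum_exp_neg_square_le:
  "(\<Sum>z\<in>{- int L..int L}. exp (- (real_of_int z)\<^sup>2)) \<le> 3 - 2 * (1 / 2) ^ L"
proof (induction L)
  case 0
  then show ?case by simp
next
  case (Suc L)
  \<comment> \<open>The two new terms are together at most (1 / 2)^L, which is exactly the decrease
    of the term subtracted in the claim.\<close>
  have e: "exp (- (real (Suc L))\<^sup>2) \<le> (1 / 2) ^ Suc L"
  proof -
    have "exp (- (real (Suc L))\<^sup>2) \<le> exp (real (Suc L) * (- 1))"
      using mult_left_mono[of 1 "real (Suc L)" "real (Suc L)"] by (simp add: power2_eq_square del: of_nat_Suc)
    also have "\<dots> = exp (- 1) ^ Suc L" by (simp only: exp_of_nat_mult)
    also have "\<dots> \<le> (1 / 2) ^ Suc L"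
    proof (intro power_mono)
      have "(2::real) \<le> exp 1" using exp_ge_add_one_self[of 1] by simp
      then show "exp (- 1 :: real) \<le> 1 / 2" by (simp add: exp_minus field_simps)
    qed simp
    finally show ?thesis .
  qed
  have "{- int (Suc L)..int (Suc L)} = insert (- int (Suc L)) (insert (int (Suc L)) {- int L..int L})"
    by auto
  then have "(\<Sum>z\<in>{- int (Suc L)..int (Suc L)}. exp (- (real_of_int z)\<^sup>2))
      = 2 * exp (- (real (Suc L))\<^sup>2) + (\<Sum>z\<in>{- int L..int L}. exp (- (real_of_int z)\<^sup>2))"
    by (simp del: of_nat_Suc)
  then show ?case using Suc e by simp
qed

text \<open>Chernoff counting: the weight exp (7 m - |z|^2) is at least 1 on the net, and its sum
  over the whole box factorises into one-dimensional sums of at most 3 <= exp 2.\<close>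

lemma card_int_net_le: "real (card (int_net m)) \<le> exp (9 * real m)"
proof -
  let ?B = "{- (7 * int m)..7 * int m}"
  have "real (card (int_net m)) = (\<Sum>z\<in>int_net m. 1)" by simp
  also have "\<dots> \<le> (\<Sum>z\<in>int_net m. exp (7 * real m) * (\<Prod>i<m. exp (- (real_of_int (z i))\<^sup>2)))"
  proof (rule sum_mono)
    fix z assume "z \<in> int_net m"
    then have "(\<Sum>i<m. (real_of_int (z i))\<^sup>2) \<le> 7 * m" by (simp add: int_net_def)
    then have "1 \<le> exp (7 * real m + (\<Sum>i<m. - (real_of_int (z i))\<^sup>2))" by (simp add: sum_negf)
    also have "\<dots> = exp (7 * real m) * (\<Prod>i<m. exp (- (real_of_int (z i))\<^sup>2))"
      unfolding exp_add by (simp add: exp_sum)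
    finally show "1 \<le> exp (7 * real m) * (\<Prod>i<m. exp (- (real_of_int (z i))\<^sup>2))" .
  qed
  also have "\<dots> \<le> (\<Sum>z\<in>PiE {..<m} (\<lambda>_. ?B). exp (7 * real m) * (\<Prod>i<m. exp (- (real_of_int (z i))\<^sup>2)))"
  proof (rule sum_mono2)
    show "finite (PiE {..<m} (\<lambda>_. ?B))" by (intro finite_PiE) auto
    show "int_net m \<subseteq> PiE {..<m} (\<lambda>_. ?B)" unfolding int_net_def by blast
  qed (intro mult_nonneg_nonneg prod_nonneg, simp_all)
  also have "\<dots> = exp (7 * real m) * (\<Prod>i<m. \<Sum>z\<in>?B. exp (- (real_of_int z)\<^sup>2))"
    unfolding sum_distrib_left[symmetric] by (subst prod_sum_PiE) auto
  also have "\<dots> \<le> exp (7 * real m) * (\<Prod>i<m. exp 2)"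
  proof (intro mult_left_mono prod_mono conjI)
    fix i
    have "?B = {- int (7 * m)..int (7 * m)}" by simp
    then have "(\<Sum>z\<in>?B. exp (- (real_of_int z)\<^sup>2)) \<le> 3"
      using sum_exp_neg_square_le[of "7 * m"]
      by (metis (no_types, lifting) diff_le_eq le_add_same_cancel1 mult_nonneg_nonneg order_trans
          zero_le_divide_1_iff zero_le_numeral zero_le_power)
    also have "3 \<le> exp (2::real)" using exp_ge_add_one_self[of 2] by simp
    finally show "(\<Sum>z\<in>?B. exp (- (real_of_int z)\<^sup>2)) \<le> exp 2" .
  qed (auto intro: sum_nonneg)
  also have "\<dots> = exp (9 * real m)"
    by (simp flip: exp_of_nat_mult exp_add)
  finally show ?thesis .
qed

text \<open>It suffices to test a scaled eigenvector of largest absolute eigenvalue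
  \<open>M\<close>: the form at its nearest integer point is still at least M m in
  magnitude.\<close>

lemma quadratic_form_bound_from_net:
  assumes sym: "\<And>i j. i < m \<Longrightarrow> j < m \<Longrightarrow> W i j = W j i"
    and net: "\<And>z. z \<in> int_net m \<Longrightarrow> \<bar>ip m (\<lambda>i. real_of_int (z i)) (mv m W (\<lambda>i. real_of_int (z i)))\<bar> \<le> \<tau> * m"
  shows "\<bar>ip m x (mv m W x)\<bar> \<le> \<tau> * ip m x x"
proof (cases "m = 0")
  case True
  then show ?thesis by (simp add: ip_def)
next
  case False
  obtain \<mu> w where sp: "spectral_decomp m W \<mu> w" using spectral_theorem[of m W] sym by blast
  define M where "M = Max ((\<lambda>k. \<bar>\<mu> k\<bar>) ` {..<m})"
  have "M \<in> (\<lambda>k. \<bar>\<mu> k\<bar>) ` {..<m}" unfolding M_def using False by (intro Max_in) auto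
  then obtain k where k: "k < m" "\<bar>\<mu> k\<bar> = M" by auto
  have leM: "\<bar>\<mu> l\<bar> \<le> M" if "l < m" for l unfolding M_def using that by (intro Max_ge) auto
  have quad: "\<bar>ip m y (mv m W y)\<bar> \<le> M * ip m y y" for y
  proof -
    have "\<bar>ip m y (mv m W y)\<bar> \<le> (\<Sum>l<m. \<bar>\<mu> l * (ip m (w l) y)\<^sup>2\<bar>)"
      unfolding spectral_decomp_quadratic[OF sp] by (rule sum_abs)
    also have "\<dots> \<le> (\<Sum>l<m. M * (ip m (w l) y)\<^sup>2)"
      by (intro sum_mono) (auto simp: abs_mult intro!: mult_right_mono leM)
    also have "\<dots> = M * ip m y y"
      unfolding spectral_decomp_parseval[OF sp, symmetric] by (simp add: sum_distrib_left)
    finally show ?thesis .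
  qed
  \<comment> \<open>Squared norm 4 m beats the rounding: \<open>e\<close> has squared norm at most m
    / 4 and inner product at most m with \<open>y\<close>, so \<open>z\<close> has squared norm at
    most 25 m / 4 <= 7 m, and its form is at least (4 - 2 - 1 / 4) M m in magnitude.\<close>
  define y where "y i = 2 * sqrt m * w k i" for i
  define z where "z i = (if i < m then round (y i) else undefined)" for i
  define e where "e i = y i - real_of_int (z i)" for i
  have yy: "ip m y y = 4 * m"
    unfolding y_def ip_scale_left ip_scale_right using spectral_decomp_orth[OF sp k(1) k(1)] by simp
  have e: "\<bar>e i\<bar> \<le> 1 / 2" if "i < m" for i
    using of_int_round_abs_le[of "y i"] that by (simp add: e_def z_def abs_minus_commute)
  have ee: "ip m e e \<le> m / 4"
  proof -
    have "ip m e e \<le> (\<Sum>i<m. 1 / 4)" unfolding ip_def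
    proof (rule sum_mono)
      fix i assume "i \<in> {..<m}"
      then have "\<bar>e i\<bar> * \<bar>e i\<bar> \<le> (1 / 2) * (1 / 2)" using e by (intro mult_mono) auto
      then show "e i * e i \<le> 1 / 4" by (simp add: abs_mult[symmetric])
    qed
    then show ?thesis by simp
  qed
  have ey: "\<bar>ip m e y\<bar> \<le> m"
  proof -
    have "(ip m e y)\<^sup>2 \<le> ip m e e * ip m y y" by (rule ip_Cauchy_Schwarz)
    also have "\<dots> \<le> (m / 4) * (4 * m)" unfolding yy using ee by (intro mult_right_mono) auto
    also have "\<dots> = (real m)\<^sup>2" by (simp add: power2_eq_square)
    finally show ?thesis by (simp add: abs_le_square_iff[symmetric])
  qed
  let ?z = "\<lambda>i. real_of_int (z i)"
  have zy: "?z = (\<lambda>i. y i - e i)" by (simp add: e_def)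
  have zz: "ip m ?z ?z \<le> 7 * m"
  proof -
    have "ip m ?z ?z = 4 * m - 2 * ip m e y + ip m e e"
      unfolding zy by (simp add: ip_diff_left ip_diff_right yy ip_commute[of m y e])
    then show ?thesis using ey ee by simp
  qed
  have "z \<in> int_net m"
  proof -
    have sq: "(\<Sum>i<m. (real_of_int (z i))\<^sup>2) \<le> 7 * m" using zz by (simp add: ip_def power2_eq_square)
    have "\<bar>z i\<bar> \<le> 7 * int m" if "i < m" for i
    proof -
      have "(real_of_int (z i))\<^sup>2 \<le> 7 * m"
        using member_le_sum[of i "{..<m}" "\<lambda>i. (real_of_int (z i))\<^sup>2"] sq that by simp
      then have "real_of_int ((z i)\<^sup>2) \<le> real_of_int (7 * int m)" by simp
      then have "(z i)\<^sup>2 \<le> 7 * int m" by (simp only: of_int_le_iff)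
      moreover have "\<bar>z i\<bar> \<le> \<bar>z i\<bar> * \<bar>z i\<bar>"
        using mult_right_mono[of 1 "\<bar>z i\<bar>" "\<bar>z i\<bar>"] by (cases "z i = 0") auto
      then have "\<bar>z i\<bar> \<le> (z i)\<^sup>2" by (simp add: power2_eq_square flip: abs_mult)
      ultimately show ?thesis by linarith
    qed
    then have "- (7 * int m) \<le> z i \<and> z i \<le> 7 * int m" if "i < m" for i
      using that by (meson abs_le_D1 abs_le_D2 minus_le_iff)
    then have "z \<in> PiE {..<m} (\<lambda>_. {- (7 * int m)..7 * int m})"
      by (intro PiE_I) (simp_all add: z_def)
    then show ?thesis using sq by (simp add: int_net_def)
  qed
  have mvz: "mv m W ?z = (\<lambda>i. mv m W y i - mv m W e i)"
    unfolding zy by (rule ext) (simp add: mv_def right_diff_distrib sum_subtractf)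
  have mvy: "ip m v (mv m W y) = \<mu> k * ip m v y" for v
  proof -
    have "mv m W y = (\<lambda>i. 2 * sqrt m * mv m W (w k) i)" unfolding y_def[abs_def] by (rule ext) (simp only: mv_scale)
    then show ?thesis unfolding y_def[abs_def]
      by (simp only: ip_scale_right spectral_decomp_eigenvector[OF sp k(1)]) simp
  qed
  have "ip m y (mv m W e) = \<mu> k * ip m e y"
    using ip_mv_symmetric[of m W y e] sym mvy[of e] by (simp add: ip_commute)
  then have "ip m ?z (mv m W ?z) = \<mu> k * (4 * m - 2 * ip m e y) + ip m e (mv m W e)"
    unfolding mvz unfolding zy by (simp add: ip_diff_left ip_diff_right mvy yy algebra_simps)
  moreover have "\<bar>\<mu> k * (4 * m - 2 * ip m e y)\<bar> \<ge> M * (2 * m)"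
  proof -
    have "M * (2 * m) \<le> M * \<bar>4 * m - 2 * ip m e y\<bar>"
      using ey k(2) by (intro mult_left_mono) auto
    then show ?thesis by (simp add: abs_mult k(2))
  qed
  moreover have "\<bar>ip m e (mv m W e)\<bar> \<le> M * (m / 4)"
    using quad[of e] mult_left_mono[OF ee, of M] k(2) by linarith
  ultimately have "M * (2 * m) - M * (m / 4) \<le> \<tau> * m"
    using net[OF \<open>z \<in> int_net m\<close>] by linarith
  moreover have "M * m \<le> M * (2 * m) - M * (m / 4)"
    using mult_nonneg_nonneg[of M "real m"] k(2) by (simp add: algebra_simps)
  ultimately have "M * m \<le> \<tau> * m" by linarith
  then have "M \<le> \<tau>" using False by simp
  then show ?thesis using quad[of x] mult_right_mono[OF _ ip_nonneg[of m x], of M \<tau>] by linarith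
qed

section \<open>Union bound for the off-diagonal tail\<close>

definition off_diag :: "nat \<Rightarrow> (nat \<Rightarrow> nat \<Rightarrow> real) \<Rightarrow> nat \<Rightarrow> nat \<Rightarrow> real" where
  "off_diag m G i j = (if i = j then 0 else G i j / m)"

definition sketch_form :: "nat \<Rightarrow> ('b \<Rightarrow> nat \<Rightarrow> real) \<Rightarrow> 'b set \<Rightarrow> ('b \<Rightarrow> real) \<Rightarrow> (nat \<times> nat \<Rightarrow> real) \<Rightarrow> nat \<Rightarrow> nat \<Rightarrow> real" where
  "sketch_form d u T lam s i j = (\<Sum>k\<in>T. lam k * proj d u s k i * proj d u s k j)"

lemma rad_markov:
  assumes "\<And>s. s \<in> PiE K (\<lambda>_. {-1, 1}) \<Longrightarrow> 0 \<le> f s" "\<And>s. s \<in> PiE K (\<lambda>_. {-1, 1}) \<Longrightarrow> P s \<Longrightarrow> c \<le> f s" "0 < c"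
  shows "rad K (\<lambda>s. of_bool (P s)) \<le> rad K f / c"
proof -
  have "rad K (\<lambda>s. of_bool (P s)) \<le> rad K (\<lambda>s. f s * (1 / c))"
    using assms by (intro rad_mono) (auto simp: field_simps)
  then show ?thesis by (simp only: rad_mult_right) simp
qed

lemma tail_sketch_bound:
  fixes u :: "'b \<Rightarrow> nat \<Rightarrow> real"
  assumes m: "0 < m" and \<delta>: "0 < \<delta>" and fT: "finite T"
    and orth: "\<And>k l. k \<in> T \<Longrightarrow> l \<in> T \<Longrightarrow> ip d (u k) (u l) = (if k = l then 1 else 0)"
    and small: "\<And>k. k \<in> T \<Longrightarrow> 800 * \<bar>lam k\<bar> \<le> \<delta>"
    and big: "313600 * (\<Sum>k\<in>T. (lam k)\<^sup>2) \<le> \<delta>\<^sup>2 * m"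
  shows "rad ({..<m} \<times> {..<d}) (\<lambda>s. of_bool (\<not> (\<forall>x. \<bar>ip m x (mv m (off_diag m (sketch_form d u T lam s)) x)\<bar> \<le> \<delta> * ip m x x))) \<le> 1 / 50"
proof -
  let ?K = "{..<m} \<times> {..<d}"
  define Z where "Z s z = (\<Sum>i<m. \<Sum>j<m. if i = j then 0 else real_of_int (z i) * real_of_int (z j) * (\<Sum>k\<in>T. lam k * proj d u s k i * proj d u s k j))" for s and z :: "nat \<Rightarrow> int"
  \<comment> \<open>This theta makes the exponent 20 m at the failure level |Z| = delta m^2. With R
    = 7 m the moment bound carries 16 * 400 * 49 = 313600, and twice this is below 800^2; hence the
    constants in \<open>big\<close> and \<open>small\<close>.\<close>
  define \<theta> where "\<theta> = 20 / (\<delta> * m)"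
  define F where "F s = (\<Sum>z\<in>int_net m. exp (\<theta> * Z s z) + exp (- \<theta> * Z s z))" for s
  have mgf: "rad ?K (\<lambda>s. exp (t * Z s z)) \<le> exp m" if z: "z \<in> int_net m" and t: "t\<^sup>2 = \<theta>\<^sup>2" for z t
  proof -
    have th: "\<theta>\<^sup>2 * (7 * real m)\<^sup>2 = 19600 / \<delta>\<^sup>2"
      using m \<delta> by (simp add: \<theta>_def field_simps power2_eq_square)
    have "rad ?K (\<lambda>s. exp (t * Z s z)) \<le> exp (16 * t\<^sup>2 * (7 * real m)\<^sup>2 * (\<Sum>k\<in>T. (lam k)\<^sup>2))"
      unfolding Z_def
    proof (rule off_diagonal_mgf[OF fT orth])
      show "ip m (\<lambda>i. real_of_int (z i)) (\<lambda>i. real_of_int (z i)) \<le> 7 * real m"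
        using z by (simp add: int_net_def ip_def power2_eq_square)
      fix k assume k: "k \<in> T"
      have "(800 * \<bar>lam k\<bar>)\<^sup>2 \<le> \<delta>\<^sup>2" using small[OF k] by (intro power_mono) auto
      then have "640000 * (lam k)\<^sup>2 \<le> \<delta>\<^sup>2" by (simp add: power_mult_distrib)
      then have "627200 * (lam k)\<^sup>2 \<le> \<delta>\<^sup>2" using zero_le_power2[of "lam k"] by linarith
      moreover have "16 * t\<^sup>2 * (7 * real m)\<^sup>2 * (lam k)\<^sup>2 = 16 * (\<theta>\<^sup>2 * (7 * real m)\<^sup>2) * (lam k)\<^sup>2"
        unfolding t by simp
      then have "16 * t\<^sup>2 * (7 * real m)\<^sup>2 * (lam k)\<^sup>2 = 313600 * (lam k)\<^sup>2 / \<delta>\<^sup>2"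
        unfolding th by simp
      ultimately show "16 * t\<^sup>2 * (7 * real m)\<^sup>2 * (lam k)\<^sup>2 \<le> 1 / 2"
        using \<delta> by (simp add: divide_le_eq)
    qed auto
    also have "16 * t\<^sup>2 * (7 * real m)\<^sup>2 * (\<Sum>k\<in>T. (lam k)\<^sup>2) = 16 * (\<theta>\<^sup>2 * (7 * real m)\<^sup>2) * (\<Sum>k\<in>T. (lam k)\<^sup>2)"
      unfolding t by simp
    also have "\<dots> \<le> m" unfolding th using big \<delta> by (simp add: divide_le_eq mult.commute)
    finally show ?thesis by simp
  qed
  have "rad ?K F \<le> (\<Sum>z\<in>int_net m. exp m + exp m)"
    unfolding F_def rad_sum rad_add by (intro sum_mono add_mono mgf) auto
  also have "\<dots> \<le> 2 * exp (9 * real m) * exp m"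
    using card_int_net_le[of m] by simp
  finally have F: "rad ?K F \<le> 2 * exp (9 * real m) * exp m" .
  have "rad ?K (\<lambda>s. of_bool (\<not> (\<forall>x. \<bar>ip m x (mv m (off_diag m (sketch_form d u T lam s)) x)\<bar> \<le> \<delta> * ip m x x)))
     \<le> rad ?K F / exp (20 * real m)"
  proof (rule rad_markov)
    show "0 \<le> F s" for s unfolding F_def by (intro sum_nonneg add_nonneg_nonneg) auto
    fix s
    assume bad: "\<not> (\<forall>x. \<bar>ip m x (mv m (off_diag m (sketch_form d u T lam s)) x)\<bar> \<le> \<delta> * ip m x x)"
    let ?W = "off_diag m (sketch_form d u T lam s)"
    have "?W i j = ?W j i" for i j
      by (simp add: off_diag_def sketch_form_def mult_ac)
    then obtain z where z: "z \<in> int_net m" "\<not> \<bar>ip m (\<lambda>i. real_of_int (z i)) (mv m ?W (\<lambda>i. real_of_int (z i)))\<bar> \<le> \<delta> * m"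
      using quadratic_form_bound_from_net[of m ?W \<delta>] bad by blast
    have eq: "ip m (\<lambda>i. real_of_int (z i)) (mv m ?W (\<lambda>i. real_of_int (z i))) = Z s z / m"
      unfolding ip_def mv_def Z_def sum_distrib_left[of _ _ "{..<m}"] sum_divide_distrib[of _ "{..<m}"]
      by (intro sum.cong refl) (simp add: off_diag_def sketch_form_def)
    have "\<delta> * m * m < \<bar>Z s z\<bar>"
      using z(2) m unfolding eq by (simp add: abs_divide pos_less_divide_eq mult.assoc not_le)
    then have "\<theta> * (\<delta> * m * m) \<le> \<theta> * \<bar>Z s z\<bar>" using m \<delta> by (intro mult_left_mono) (auto simp: \<theta>_def)
    moreover have "\<theta> * (\<delta> * m * m) = 20 * m" using m \<delta> by (simp add: \<theta>_def)
    ultimately have "exp (20 * real m) \<le> exp (\<theta> * \<bar>Z s z\<bar>)" by simp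
    also have "\<dots> \<le> exp (\<theta> * Z s z) + exp (- \<theta> * Z s z)" by (cases "Z s z \<ge> 0") auto
    also have "\<dots> \<le> F s" unfolding F_def using z(1) finite_int_net
      by (intro member_le_sum) (auto intro: add_nonneg_nonneg)
    finally show "exp (20 * real m) \<le> F s" .
  qed simp
  \<comment> \<open>The net contributes exp (9 m) and the two moments 2 exp m; against the level exp
    (20 m) this leaves 2 exp (- 10 m).\<close>
  also have "\<dots> \<le> 2 * exp (9 * real m) * exp m / exp (20 * real m)"
    using F by (intro divide_right_mono) auto
  also have "\<dots> = 2 * exp (9 * real m + m - 20 * real m)" by (simp only: exp_diff exp_add times_divide_eq_right mult.assoc)
  also have "\<dots> \<le> 2 * exp (- 10)" using m by simp
  also have "\<dots> \<le> 1 / 50"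
  proof -
    have "(2::real) ^ 10 \<le> exp 1 ^ 10"
      using exp_ge_add_one_self[of 1] by (intro power_mono) auto
    also have "\<dots> = exp 10" by (simp flip: exp_of_nat_mult)
    finally have "100 \<le> exp (10::real)" by simp
    then show ?thesis by (simp add: exp_minus field_simps)
  qed
  finally show ?thesis .
qed

section \<open>Second moments of the large part\<close>

lemma proj_eq_sum: "proj d u s k i = (\<Sum>a\<in>{i} \<times> {..<d}. u k (snd a) * s a)"
proof -
  have "{i} \<times> {..<d} = Pair i ` {..<d}" by auto
  then show ?thesis by (simp add: proj_def ip_def sum.reindex inj_on_def)
qed

lemma rad_proj_mult_free:
  assumes "i < m" "free_of ({i} \<times> {..<d}) h"
  shows "rad ({..<m} \<times> {..<d}) (\<lambda>s. proj d u s k i * proj d u s l i * h s) = ip d (u k) (u l) * rad ({..<m} \<times> {..<d}) h"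
proof -
  have "{i} \<times> {..<d} = Pair i ` {..<d}" by auto
  then have "(\<Sum>a\<in>{i} \<times> {..<d}. u k (snd a) * u l (snd a)) = ip d (u k) (u l)"
    by (simp add: ip_def sum.reindex inj_on_def)
  then show ?thesis
    unfolding proj_eq_sum using assms
    by (subst rad_bilinear_free) auto
qed

lemma power4_le_exp:
  fixes y :: real
  shows "y ^ 4 \<le> 256 * (exp y + exp (- y))"
proof -
  have pos: "y ^ 4 \<le> 256 * exp y" if "0 \<le> y" for y :: real
  proof -
    have "y / 4 \<le> exp (y / 4)"
      by (rule order_trans[OF _ exp_ge_add_one_self]) simp
    then have "(y / 4) ^ 4 \<le> exp (y / 4) ^ 4" using that by (intro power_mono) auto
    also have "\<dots> = exp y" by (simp flip: exp_of_nat_mult)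
    finally show ?thesis by (simp add: power_divide)
  qed
  have "y ^ 4 = (- y) ^ 4" by simp
  then show ?thesis using pos[of y] pos[of "- y"]
    by (smt (verit, best) exp_gt_zero)
qed

text \<open>Any absolute constant serves: both exponential moments are at most exp (1 / 2) <= 2, and
  \<open>power4_le_exp\<close> turns them into 256 * (2 + 2).\<close>

lemma rad_proj_power4:
  assumes i: "i < m" and u: "ip d (u k) (u k) = 1"
  shows "rad ({..<m} \<times> {..<d}) (\<lambda>s. proj d u s k i ^ 4) \<le> 1024"
proof -
  let ?K = "{..<m} \<times> {..<d}"
  have ex: "rad ?K (\<lambda>s. exp (c * proj d u s k i)) \<le> 2" if "c = 1 \<or> c = - 1" for c :: real
  proof -
    have "rad ?K (\<lambda>s. exp (ip d (\<lambda>l. c * u k l) (\<lambda>l. \<Sum>j\<in>{i}. (if j = i then 1 else 0) * s (j, l)))) \<le>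
       exp (1 * ip d (\<lambda>l. c * u k l) (\<lambda>l. c * u k l) / 2)"
      using i by (intro subgaussian_combination) (auto simp: ip_def if_distrib cong: if_cong)
    also have "\<dots> = exp (1 / 2)"
      unfolding ip_scale_left ip_scale_right u using that by auto
    also have "\<dots> \<le> 2"
    proof -
      have "exp (1 / 2 :: real) ^ 2 = exp 1" by (simp flip: exp_of_nat_mult)
      also have "\<dots> \<le> 2 ^ 2" using exp_le by simp
      finally show ?thesis using power2_le_imp_le[of "exp (1 / 2 :: real)" 2] by simp
    qed
    finally show ?thesis by (simp add: ip_scale_left proj_def)
  qed
  have "rad ?K (\<lambda>s. proj d u s k i ^ 4) \<le> rad ?K (\<lambda>s. 256 * (exp (1 * proj d u s k i) + exp (- 1 * proj d u s k i)))"
    using power4_le_exp by (intro rad_mono) simp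
  also have "\<dots> \<le> 256 * (2 + 2)"
    unfolding rad_mult_left rad_add by (intro mult_left_mono add_mono ex) auto
  finally show ?thesis by simp
qed

text \<open>Variance of a sum over rows: distinct rows are independent, so the cross terms of the
  centred products vanish and m terms remain, each bounded by fourth moments.\<close>

lemma rad_gram_entry:
  assumes m: "0 < m" and kl: "ip d (u k) (u k) = 1" "ip d (u l) (u l) = 1"
  shows "rad ({..<m} \<times> {..<d}) (\<lambda>s. ((\<Sum>i<m. proj d u s k i * proj d u s l i) - m * ip d (u k) (u l))\<^sup>2) \<le> 1024 * m"
proof -
  let ?K = "{..<m} \<times> {..<d}"
  define c where "c = ip d (u k) (u l)"
  define Q where "Q i s = proj d u s k i * proj d u s l i" for i s
  have free: "free_of ({i} \<times> {..<d}) (Q j)" if "i \<noteq> j" for i j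
    using that by (auto simp: free_of_def Q_def proj_def ip_def intro!: sum.cong)
  have mean: "rad ?K (\<lambda>s. Q i s * h s) = c * rad ?K h" if "i < m" "free_of ({i} \<times> {..<d}) h" for i h
    unfolding Q_def c_def using that by (rule rad_proj_mult_free)
  have mean1: "rad ?K (Q i) = c" if "i < m" for i
    using mean[OF that, of "\<lambda>_. 1"] by (simp add: free_of_def rad_const)
  have cross: "rad ?K (\<lambda>s. (Q i s - c) * (Q j s - c)) \<le> (if i = j then 1024 else 0)" if ij: "i < m" "j < m" for i j
  proof (cases "i = j")
    case False
    have "rad ?K (\<lambda>s. (Q i s - c) * (Q j s - c)) = rad ?K (\<lambda>s. Q i s * (Q j s - c) - c * (Q j s - c))"
      by (intro rad_cong) (simp add: algebra_simps)
    also have "\<dots> = 0"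
      unfolding rad_diff rad_mult_left using free[OF False] ij
      by (subst mean) (auto simp: free_of_def rad_diff)
    finally show ?thesis using False by simp
  next
    case True
    have "rad ?K (\<lambda>s. (Q i s - c) * (Q i s - c)) = rad ?K (\<lambda>s. (Q i s)\<^sup>2 - 2 * c * Q i s + c\<^sup>2)"
      by (intro rad_cong) (simp add: algebra_simps power2_eq_square)
    also have "\<dots> = rad ?K (\<lambda>s. (Q i s)\<^sup>2) - c\<^sup>2"
      by (simp add: rad_add rad_diff rad_mult_left mean1[OF ij(1)] rad_const power2_eq_square)
    also have "\<dots> \<le> rad ?K (\<lambda>s. (Q i s)\<^sup>2)" by simp
    also have "\<dots> \<le> rad ?K (\<lambda>s. (proj d u s k i ^ 4 + proj d u s l i ^ 4) * (1 / 2))"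
    proof (rule rad_mono)
      fix s
      have "2 * ((proj d u s k i)\<^sup>2 * (proj d u s l i)\<^sup>2) \<le> ((proj d u s k i)\<^sup>2)\<^sup>2 + ((proj d u s l i)\<^sup>2)\<^sup>2"
        using sum_squares_bound[of "(proj d u s k i)\<^sup>2" "(proj d u s l i)\<^sup>2"] by simp
      then show "(Q i s)\<^sup>2 \<le> (proj d u s k i ^ 4 + proj d u s l i ^ 4) * (1 / 2)"
        by (simp add: Q_def power_mult_distrib)
    qed
    also have "\<dots> \<le> (1024 + 1024) * (1 / 2)"
      unfolding rad_mult_right rad_add using ij kl by (intro mult_right_mono add_mono rad_proj_power4) auto
    finally show ?thesis using True by simp
  qed
  have "rad ?K (\<lambda>s. ((\<Sum>i<m. Q i s) - m * c)\<^sup>2) = rad ?K (\<lambda>s. \<Sum>i<m. \<Sum>j<m. (Q i s - c) * (Q j s - c))"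
    by (intro rad_cong) (simp add: power2_eq_square sum_product[symmetric] sum_subtractf)
  also have "\<dots> = (\<Sum>i<m. \<Sum>j<m. rad ?K (\<lambda>s. (Q i s - c) * (Q j s - c)))" by (simp only: rad_sum)
  also have "\<dots> \<le> (\<Sum>i<m. \<Sum>j<m. if i = j then 1024 else 0)"
    by (intro sum_mono cross) auto
  also have "\<dots> = 1024 * m" by simp
  finally show ?thesis by (simp add: Q_def c_def)
qed

definition weighted_col :: "nat \<Rightarrow> nat \<Rightarrow> ('b \<Rightarrow> nat \<Rightarrow> real) \<Rightarrow> ('b \<Rightarrow> real) \<Rightarrow> (nat \<times> nat \<Rightarrow> real) \<Rightarrow> 'b \<Rightarrow> nat \<Rightarrow> real" where
  "weighted_col m d u lam s k i = sqrt (\<bar>lam k\<bar> / m) * proj d u s k i"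

text \<open>The weights make the mean squared error at (k, l) proportional to |lam_k| |lam_l|, so
  the double sum collapses to the square of a single sum.\<close>

lemma rad_gram_error:
  fixes u :: "'b \<Rightarrow> nat \<Rightarrow> real"
  assumes m: "0 < m" and fS: "finite S"
    and orth: "\<And>k l. k \<in> S \<Longrightarrow> l \<in> S \<Longrightarrow> ip d (u k) (u l) = (if k = l then 1 else 0)"
  shows "rad ({..<m} \<times> {..<d}) (\<lambda>s. \<Sum>k\<in>S. \<Sum>l\<in>S.
       (ip m (weighted_col m d u lam s k) (weighted_col m d u lam s l) - (if k = l then \<bar>lam k\<bar> else 0))\<^sup>2)
     \<le> 1024 * (\<Sum>k\<in>S. \<bar>lam k\<bar>)\<^sup>2 / m"
proof -
  let ?K = "{..<m} \<times> {..<d}" and ?y = "weighted_col m d u lam"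
  have entry: "rad ?K (\<lambda>s. (ip m (?y s k) (?y s l) - (if k = l then \<bar>lam k\<bar> else 0))\<^sup>2) \<le> 1024 * (\<bar>lam k\<bar> * \<bar>lam l\<bar>) / m"
    if kl: "k \<in> S" "l \<in> S" for k l
  proof -
    have "(ip m (?y s k) (?y s l) - (if k = l then \<bar>lam k\<bar> else 0))\<^sup>2
       = \<bar>lam k\<bar> * \<bar>lam l\<bar> / (real m)\<^sup>2 * ((\<Sum>i<m. proj d u s k i * proj d u s l i) - m * ip d (u k) (u l))\<^sup>2" for s
    proof -
      define r where "r = sqrt (\<bar>lam k\<bar> / m) * sqrt (\<bar>lam l\<bar> / m)"
      have r2: "r\<^sup>2 = \<bar>lam k\<bar> * \<bar>lam l\<bar> / (real m)\<^sup>2"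
        unfolding r_def power_mult_distrib by (simp add: power2_eq_square[of "real m"])
      have "ip m (?y s k) (?y s l) = r * (\<Sum>i<m. proj d u s k i * proj d u s l i)"
        unfolding weighted_col_def[abs_def] ip_scale_left ip_scale_right by (simp add: r_def ip_def)
      moreover have "(if k = l then \<bar>lam k\<bar> else 0) = r * (m * ip d (u k) (u l))"
        using m orth[OF kl] by (auto simp: r_def)
      ultimately have "ip m (?y s k) (?y s l) - (if k = l then \<bar>lam k\<bar> else 0)
         = r * ((\<Sum>i<m. proj d u s k i * proj d u s l i) - m * ip d (u k) (u l))"
        by (simp add: right_diff_distrib)
      then show ?thesis by (simp add: power_mult_distrib r2)
    qed
    then have "rad ?K (\<lambda>s. (ip m (?y s k) (?y s l) - (if k = l then \<bar>lam k\<bar> else 0))\<^sup>2)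
       = \<bar>lam k\<bar> * \<bar>lam l\<bar> / (real m)\<^sup>2 * rad ?K (\<lambda>s. ((\<Sum>i<m. proj d u s k i * proj d u s l i) - m * ip d (u k) (u l))\<^sup>2)"
      by (simp only: rad_mult_left)
    also have "\<dots> \<le> \<bar>lam k\<bar> * \<bar>lam l\<bar> / (real m)\<^sup>2 * (1024 * real m)"
    proof (rule mult_left_mono)
      have "ip d (u k) (u k) = 1" "ip d (u l) (u l) = 1" using orth kl by auto
      from rad_gram_entry[OF m this]
      show "rad ?K (\<lambda>s. ((\<Sum>i<m. proj d u s k i * proj d u s l i) - m * ip d (u k) (u l))\<^sup>2) \<le> 1024 * real m" .
    qed simp
    also have "\<dots> = 1024 * (\<bar>lam k\<bar> * \<bar>lam l\<bar>) / m" using m by (simp add: power2_eq_square)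
    finally show ?thesis .
  qed
  have "rad ?K (\<lambda>s. \<Sum>k\<in>S. \<Sum>l\<in>S. (ip m (?y s k) (?y s l) - (if k = l then \<bar>lam k\<bar> else 0))\<^sup>2)
     = (\<Sum>k\<in>S. \<Sum>l\<in>S. rad ?K (\<lambda>s. (ip m (?y s k) (?y s l) - (if k = l then \<bar>lam k\<bar> else 0))\<^sup>2))"
    by (simp only: rad_sum)
  also have "\<dots> \<le> (\<Sum>k\<in>S. \<Sum>l\<in>S. 1024 * (\<bar>lam k\<bar> * \<bar>lam l\<bar>) / m)"
    by (intro sum_mono entry)
  also have "\<dots> = 1024 * (\<Sum>k\<in>S. \<bar>lam k\<bar>)\<^sup>2 / m"
    by (simp only: sum_divide_distrib[symmetric] sum_distrib_left[symmetric] power2_eq_square sum_product)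
  finally show ?thesis .
qed

lemma rad_diagonal_error:
  fixes u :: "'b \<Rightarrow> nat \<Rightarrow> real"
  assumes m: "0 < m" and fS: "finite S"
    and orth: "\<And>k. k \<in> S \<Longrightarrow> ip d (u k) (u k) = 1"
  shows "rad ({..<m} \<times> {..<d}) (\<lambda>s. \<Sum>i<m. (sketch_form d u S lam s i i / m)\<^sup>2) \<le> 1024 * (\<Sum>k\<in>S. \<bar>lam k\<bar>)\<^sup>2 / m"
proof -
  let ?K = "{..<m} \<times> {..<d}" and ?T = "\<Sum>k\<in>S. \<bar>lam k\<bar>"
  have row: "rad ?K (\<lambda>s. (sketch_form d u S lam s i i / m)\<^sup>2) \<le> 1024 * ?T\<^sup>2 / (real m)\<^sup>2" if i: "i < m" for i
  proof -
    have "rad ?K (\<lambda>s. (sketch_form d u S lam s i i / m)\<^sup>2)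
        \<le> rad ?K (\<lambda>s. ?T / (real m)\<^sup>2 * (\<Sum>k\<in>S. \<bar>lam k\<bar> * proj d u s k i ^ 4))"
    proof (rule rad_mono)
      fix s
      have "\<bar>sketch_form d u S lam s i i\<bar> \<le> (\<Sum>k\<in>S. \<bar>lam k * proj d u s k i * proj d u s k i\<bar>)"
        unfolding sketch_form_def by (rule sum_abs)
      \<comment> \<open>Splitting |lam_k| into two square roots before Cauchy-Schwarz leaves one
        factor \<open>?T\<close> and a weighted sum of fourth powers, so the cardinality of
        \<open>S\<close> never appears.\<close>
      also have "\<dots> = (\<Sum>k\<in>S. sqrt \<bar>lam k\<bar> * (sqrt \<bar>lam k\<bar> * (proj d u s k i)\<^sup>2))"
        by (intro sum.cong refl) (simp add: abs_mult power2_eq_square mult.assoc flip: mult.assoc[of "sqrt _" "sqrt _"])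
      finally have "(sketch_form d u S lam s i i)\<^sup>2 \<le> (\<Sum>k\<in>S. sqrt \<bar>lam k\<bar> * (sqrt \<bar>lam k\<bar> * (proj d u s k i)\<^sup>2))\<^sup>2"
        using power_mono[OF _ abs_ge_zero, of "sketch_form d u S lam s i i" _ 2] by simp
      also have "\<dots> \<le> (\<Sum>k\<in>S. (sqrt \<bar>lam k\<bar>)\<^sup>2) * (\<Sum>k\<in>S. (sqrt \<bar>lam k\<bar> * (proj d u s k i)\<^sup>2)\<^sup>2)"
        by (rule Cauchy_Schwarz_ineq_sum)
      also have "\<dots> = ?T * (\<Sum>k\<in>S. \<bar>lam k\<bar> * proj d u s k i ^ 4)"
        by (simp add: power_mult_distrib)
      finally show "(sketch_form d u S lam s i i / m)\<^sup>2 \<le> ?T / (real m)\<^sup>2 * (\<Sum>k\<in>S. \<bar>lam k\<bar> * proj d u s k i ^ 4)"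
        by (simp add: power_divide divide_right_mono)
    qed
    also have "\<dots> = ?T / (real m)\<^sup>2 * (\<Sum>k\<in>S. \<bar>lam k\<bar> * rad ?K (\<lambda>s. proj d u s k i ^ 4))"
      by (simp only: rad_mult_left rad_sum)
    also have "\<dots> \<le> ?T / (real m)\<^sup>2 * (\<Sum>k\<in>S. \<bar>lam k\<bar> * 1024)"
      using i orth by (intro mult_left_mono sum_mono rad_proj_power4) (auto intro: divide_nonneg_nonneg sum_nonneg)
    also have "\<dots> = 1024 * ?T\<^sup>2 / (real m)\<^sup>2"
      by (simp add: sum_distrib_right[symmetric] power2_eq_square)
    finally show ?thesis .
  qed
  have "rad ?K (\<lambda>s. \<Sum>i<m. (sketch_form d u S lam s i i / m)\<^sup>2) \<le> (\<Sum>i<m. 1024 * ?T\<^sup>2 / (real m)\<^sup>2)"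
    unfolding rad_sum by (intro sum_mono row) auto
  also have "\<dots> = 1024 * ?T\<^sup>2 / m" using m by (simp add: power2_eq_square)
  finally show ?thesis .
qed

text \<open>The Frobenius norm dominates the operator norm; this turns second moments into bounds on
  quadratic forms.\<close>

lemma bilinear_frobenius_bound:
  fixes E :: "'b \<Rightarrow> 'b \<Rightarrow> real"
  assumes "(\<Sum>k\<in>S. \<Sum>l\<in>S. (E k l)\<^sup>2) \<le> \<delta>\<^sup>2" "0 \<le> \<delta>"
  shows "\<bar>\<Sum>k\<in>S. \<Sum>l\<in>S. a k * a l * E k l\<bar> \<le> \<delta> * (\<Sum>k\<in>S. (a k)\<^sup>2)"
proof -
  have "(\<Sum>k\<in>S. \<Sum>l\<in>S. a k * a l * E k l)\<^sup>2 = (\<Sum>z\<in>S \<times> S. (a (fst z) * a (snd z)) * E (fst z) (snd z))\<^sup>2"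
    by (simp add: sum.cartesian_product case_prod_unfold)
  also have "\<dots> \<le> (\<Sum>z\<in>S \<times> S. (a (fst z) * a (snd z))\<^sup>2) * (\<Sum>z\<in>S \<times> S. (E (fst z) (snd z))\<^sup>2)"
    by (rule Cauchy_Schwarz_ineq_sum)
  also have "(\<Sum>z\<in>S \<times> S. (a (fst z) * a (snd z))\<^sup>2) = (\<Sum>k\<in>S. (a k)\<^sup>2)\<^sup>2"
    by (simp add: power_mult_distrib power2_eq_square[of "sum _ _"] sum_product sum.cartesian_product case_prod_unfold)
  also have "(\<Sum>z\<in>S \<times> S. (E (fst z) (snd z))\<^sup>2) = (\<Sum>k\<in>S. \<Sum>l\<in>S. (E k l)\<^sup>2)"
    by (simp add: sum.cartesian_product case_prod_unfold)
  also have "(\<Sum>k\<in>S. (a k)\<^sup>2)\<^sup>2 * (\<Sum>k\<in>S. \<Sum>l\<in>S. (E k l)\<^sup>2) \<le> (\<Sum>k\<in>S. (a k)\<^sup>2)\<^sup>2 * \<delta>\<^sup>2"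
    using assms by (intro mult_left_mono) auto
  also have "\<dots> = (\<delta> * (\<Sum>k\<in>S. (a k)\<^sup>2))\<^sup>2" by (simp add: power_mult_distrib mult.commute)
  finally show ?thesis using assms by (simp add: abs_le_square_iff[symmetric] sum_nonneg)
qed

section \<open>Eigenvalue counts of the sketch\<close>

lemma ip_combination_gram:
  fixes y :: "'b \<Rightarrow> nat \<Rightarrow> real"
  assumes fS: "finite S"
    and gram: "\<bar>\<Sum>k\<in>S. \<Sum>l\<in>S. a k * a l * (ip m (y k) (y l) - (if k = l then p k else 0))\<bar> \<le> \<delta> * (\<Sum>k\<in>S. (a k)\<^sup>2)"
  shows "\<bar>ip m (\<lambda>i. \<Sum>k\<in>S. a k * y k i) (\<lambda>i. \<Sum>k\<in>S. a k * y k i) - (\<Sum>k\<in>S. p k * (a k)\<^sup>2)\<bar> \<le> \<delta> * (\<Sum>k\<in>S. (a k)\<^sup>2)"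
proof -
  have "ip m (\<lambda>i. \<Sum>k\<in>S. a k * y k i) (\<lambda>i. \<Sum>k\<in>S. a k * y k i) = (\<Sum>k\<in>S. \<Sum>l\<in>S. a k * a l * ip m (y k) (y l))"
    unfolding ip_sum_left ip_scale_left unfolding ip_sum_right ip_scale_right
    by (simp add: sum_distrib_left mult.assoc)
  moreover have "(\<Sum>k\<in>S. \<Sum>l\<in>S. a k * a l * (if k = l then p k else 0)) = (\<Sum>k\<in>S. p k * (a k)\<^sup>2)"
  proof -
    have "(\<Sum>k\<in>S. \<Sum>l\<in>S. a k * a l * (if k = l then p k else 0)) = (\<Sum>k\<in>S. \<Sum>l\<in>S. if k = l then p k * (a k)\<^sup>2 else 0)"
      by (intro sum.cong refl) (auto simp: power2_eq_square)
    then show ?thesis using fS by simp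
  qed
  ultimately show ?thesis using gram by (simp add: right_diff_distrib sum_subtractf)
qed

text \<open>For \<open>x = \<Sum>\<^sub>k a\<^sub>k y\<^sub>k\<close> let \<open>b\<^sub>k = \<langle>y\<^sub>k, x\<rangle>\<close>. If \<open>b\<close> vanishes off the eigenvalues above \<open>t\<close>, then completing
  squares in \<open>\<parallel>x\<parallel>\<^sup>2 = \<langle>a, b\<rangle>\<close> bounds \<open>\<parallel>x\<parallel>\<^sup>2\<close> by \<open>\<parallel>b\<parallel>\<^sup>2 / (t - \<delta>)\<close>. A dimension count makes \<open>x\<close> also orthogonal
  to the top eigenvectors of \<open>B\<close> if these are too few.\<close>

lemma sketch_eigenvalue_count_ge:
  fixes y :: "'b \<Rightarrow> nat \<Rightarrow> real"
  assumes fS: "finite S"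
    and gram: "\<And>a. \<bar>\<Sum>k\<in>S. \<Sum>l\<in>S. a k * a l * (ip m (y k) (y l) - (if k = l then \<bar>lam k\<bar> else 0))\<bar> \<le> \<delta> * (\<Sum>k\<in>S. (a k)\<^sup>2)"
    and res: "\<And>x. \<bar>ip m x (mv m B x) - (\<Sum>k\<in>S. sgn (lam k) * (ip m (y k) x)\<^sup>2)\<bar> \<le> \<rho> * ip m x x"
    and sp: "spectral_decomp m B \<mu> w"
    and big: "\<And>k. k \<in> S \<Longrightarrow> \<delta> < \<bar>lam k\<bar>"
    and t: "0 \<le> \<delta>" "\<delta> < t"
  shows "card {k \<in> S. t \<le> lam k} \<le> card {j. j < m \<and> t - \<delta> - \<rho> \<le> \<mu> j}"
proof (rule ccontr)
  define K where "K = {k \<in> S. t \<le> lam k}"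
  define N where "N = {j. j < m \<and> t - \<delta> - \<rho> \<le> \<mu> j}"
  assume "\<not> card {k \<in> S. t \<le> lam k} \<le> card {j. j < m \<and> t - \<delta> - \<rho> \<le> \<mu> j}"
  then have less: "card N < card K" by (simp add: K_def N_def)
  have fin: "finite K" "finite N" "K \<subseteq> S" using fS by (auto simp: K_def N_def)
  \<comment> \<open>The unknowns are the coefficients a_k. The constraints make x orthogonal to the
    eigenvectors w_j with j in \<open>N\<close> and to the columns y_l with l in
    \<open>S - K\<close>; there are fewer than \<open>card S\<close> of them since
    \<open>card N < card K\<close>.\<close>
  define c where "c e k = (case e of Inl j \<Rightarrow> ip m (w j) (y k) | Inr l \<Rightarrow> ip m (y l) (y k))" for e k
  have "card (N <+> (S - K)) = card N + card (S - K)"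
    using fin fS by (simp add: card_Plus)
  also have "\<dots> < card S"
    using less card_mono[OF fS fin(3)] by (simp add: card_Diff_subset fin)
  finally obtain a where a: "\<exists>k\<in>S. a k \<noteq> 0" "\<forall>e\<in>N <+> (S - K). (\<Sum>k\<in>S. c e k * a k) = 0"
    using homogeneous_system[OF fS, of "N <+> (S - K)" c] fin fS by auto
  define x where "x i = (\<Sum>k\<in>S. a k * y k i)" for i
  define b where "b k = ip m (y k) x" for k
  have ipx: "ip m z x = (\<Sum>k\<in>S. ip m z (y k) * a k)" for z
    unfolding x_def ip_sum_right ip_scale_right by (simp add: mult.commute)
  have wx: "ip m (w j) x = 0" if "j \<in> N" for j
    using bspec[OF a(2) InlI[OF that]] by (simp add: ipx c_def)
  have b0: "b k = 0" if "k \<in> S - K" for k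
    using bspec[OF a(2) InrI[OF that]] by (simp add: b_def ipx c_def)
  have xb: "ip m x x = (\<Sum>k\<in>S. a k * b k)"
  proof -
    have "ip m x z = (\<Sum>k\<in>S. a k * ip m (y k) z)" for z
      unfolding x_def ip_sum_left ip_scale_left ..
    then show ?thesis by (simp add: b_def)
  qed
  define q where "q k = \<bar>lam k\<bar> - \<delta>" for k
  have q: "0 < q k" if "k \<in> S" for k using big[OF that] by (simp add: q_def)
  have xq: "(\<Sum>k\<in>S. q k * (a k)\<^sup>2) \<le> ip m x x"
    using ip_combination_gram[OF fS gram[of a]] unfolding x_def[symmetric]
    by (simp add: q_def left_diff_distrib sum_subtractf sum_distrib_left)
  have "0 < (\<Sum>k\<in>S. q k * (a k)\<^sup>2)"
  proof -
    obtain k where k: "k \<in> S" "a k \<noteq> 0" using a(1) by blast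
    show ?thesis
      by (rule sum_pos2[OF fS k(1)]) (use k q in \<open>auto intro!: mult_nonneg_nonneg less_imp_le[OF q]\<close>)
  qed
  then have xpos: "0 < ip m x x" using xq by linarith
  \<comment> \<open>Here |x|^2 = sum a_k b_k is also at least sum q_k a_k^2, so twice the former
    minus the latter is still at least |x|^2; each summand of this is maximal at a_k = b_k /
    q_k.\<close>
  have "ip m x x \<le> (\<Sum>k\<in>S. 2 * (a k * b k) - q k * (a k)\<^sup>2)"
    using xq xb by (simp add: sum_subtractf sum_distrib_left[symmetric])
  also have "\<dots> \<le> (\<Sum>k\<in>S. (b k)\<^sup>2 / q k)"
  proof (rule sum_mono)
    fix k assume k: "k \<in> S"
    have "0 \<le> (q k * a k - b k)\<^sup>2 / q k" using q[OF k] by simp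
    also have "\<dots> = q k * (a k)\<^sup>2 - 2 * (a k * b k) + (b k)\<^sup>2 / q k"
      using q[OF k] by (simp add: power2_eq_square field_simps)
    finally show "2 * (a k * b k) - q k * (a k)\<^sup>2 \<le> (b k)\<^sup>2 / q k" by simp
  qed
  also have "\<dots> = (\<Sum>k\<in>K. (b k)\<^sup>2 / q k)"
    using fin fS b0 by (intro sum.mono_neutral_right) auto
  also have "\<dots> \<le> (\<Sum>k\<in>K. (b k)\<^sup>2 / (t - \<delta>))"
    using t by (intro sum_mono divide_left_mono) (auto simp: K_def q_def intro!: mult_pos_pos)
  finally have bx: "(t - \<delta>) * ip m x x \<le> (\<Sum>k\<in>K. (b k)\<^sup>2)"
    using t by (simp add: sum_divide_distrib[symmetric] pos_le_divide_eq mult.commute)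
  have "(\<Sum>k\<in>S. sgn (lam k) * (ip m (y k) x)\<^sup>2) = (\<Sum>k\<in>K. (b k)\<^sup>2)"
    using fin fS b0 t by (intro sum.mono_neutral_cong_right) (auto simp: b_def K_def)
  then have "(t - \<delta> - \<rho>) * ip m x x \<le> ip m x (mv m B x)"
    using res[of x] bx by (simp add: left_diff_distrib)
  \<comment> \<open>As x only meets eigenvectors below the threshold, its form is strictly smaller
    than the lower bound just found.\<close>
  moreover have "ip m x (mv m B x) < (t - \<delta> - \<rho>) * ip m x x"
  proof -
    have "\<exists>j<m. ip m (w j) x \<noteq> 0"
      using xpos spectral_decomp_parseval[OF sp, of x] by (metis (mono_tags, lifting) lessThan_iff order_less_irrefl sum.neutral zero_power2)
    then obtain j where j: "j < m" "ip m (w j) x \<noteq> 0" by blast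
    have "0 < (\<Sum>j<m. (t - \<delta> - \<rho> - \<mu> j) * (ip m (w j) x)\<^sup>2)"
    proof (rule sum_pos2[of _ j])
      show "0 < (t - \<delta> - \<rho> - \<mu> j) * (ip m (w j) x)\<^sup>2"
        using wx[of j] j by (cases "j \<in> N") (auto simp: N_def)
      show "0 \<le> (t - \<delta> - \<rho> - \<mu> i) * (ip m (w i) x)\<^sup>2" if "i \<in> {..<m}" for i
        using wx[of i] that by (cases "i \<in> N") (auto simp: N_def)
    qed (use j in auto)
    then show ?thesis
      unfolding spectral_decomp_quadratic[OF sp] spectral_decomp_parseval[OF sp, symmetric]
      by (simp add: left_diff_distrib[of _ "\<mu> _"] sum_subtractf sum_distrib_left)
  qed
  ultimately show False by linarith
qed

text \<open>Too many eigenvalues of \<open>B\<close> above t would give a nonzero x in the span of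
  their eigenvectors that is orthogonal to every column y_k with lam_k >= s. Negative lam_k only
  lower the form, and the positive ones below s contribute at most (s + delta) |x|^2, which is too
  little for t.\<close>

lemma sketch_eigenvalue_count_le:
  fixes y :: "'b \<Rightarrow> nat \<Rightarrow> real"
  assumes fS: "finite S"
    and gram: "\<And>a. \<bar>\<Sum>k\<in>S. \<Sum>l\<in>S. a k * a l * (ip m (y k) (y l) - (if k = l then \<bar>lam k\<bar> else 0))\<bar> \<le> \<delta> * (\<Sum>k\<in>S. (a k)\<^sup>2)"
    and res: "\<And>x. \<bar>ip m x (mv m B x) - (\<Sum>k\<in>S. sgn (lam k) * (ip m (y k) x)\<^sup>2)\<bar> \<le> \<rho> * ip m x x"
    and sp: "spectral_decomp m B \<mu> w"
    and s: "0 < s" "s + \<delta> + \<rho> < t" "0 \<le> \<delta>"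
  shows "card {j. j < m \<and> t \<le> \<mu> j} \<le> card {k \<in> S. s \<le> lam k}"
proof (rule ccontr)
  define K where "K = {k \<in> S. s \<le> lam k}"
  define N where "N = {j. j < m \<and> t \<le> \<mu> j}"
  assume "\<not> card {j. j < m \<and> t \<le> \<mu> j} \<le> card {k \<in> S. s \<le> lam k}"
  then have less: "card K < card N" by (simp add: K_def N_def)
  have fin: "finite K" "finite N" using fS by (auto simp: K_def N_def)
  obtain c where c: "\<exists>j\<in>N. c j \<noteq> 0" "\<forall>k\<in>K. (\<Sum>j\<in>N. ip m (y k) (w j) * c j) = 0"
    using homogeneous_system[OF fin(2,1) less, of "\<lambda>k j. ip m (y k) (w j)"] by blast
  define x where "x i = (\<Sum>j\<in>N. c j * w j i)" for i
  define b where "b k = ip m (y k) x" for k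
  have ipx: "ip m z x = (\<Sum>j\<in>N. ip m z (w j) * c j)" for z
    unfolding x_def ip_sum_right ip_scale_right by (simp add: mult.commute)
  have b0: "b k = 0" if "k \<in> K" for k using c(2) that by (simp add: b_def ipx)
  have wx: "ip m (w j) x = (if j \<in> N then c j else 0)" if "j < m" for j
  proof -
    have "ip m (w j) x = (\<Sum>i\<in>N. if i = j then c i else 0)"
      unfolding ipx using that by (intro sum.cong refl) (auto simp: N_def spectral_decomp_orth[OF sp])
    then show ?thesis using fin by simp
  qed
  obtain j where j: "j \<in> N" "c j \<noteq> 0" using c(1) by blast
  have xpos: "0 < ip m x x"
    unfolding spectral_decomp_parseval[OF sp, symmetric]
    by (rule sum_pos2[of _ j]) (use j wx in \<open>auto simp: N_def\<close>)
  have low: "t * ip m x x \<le> ip m x (mv m B x)"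
    unfolding spectral_decomp_quadratic[OF sp] spectral_decomp_parseval[OF sp, symmetric] sum_distrib_left
    by (intro sum_mono) (auto simp: wx N_def intro: mult_right_mono)
  \<comment> \<open>Duality: \<open>a\<close> keeps \<open>b\<close> only where lam_k is positive.
    Then <v, x> = |a|^2 and |v|^2 <= (s + delta) |a|^2, so Cauchy-Schwarz bounds |a|^2 by (s +
    delta) |x|^2.\<close>
  define a where "a k = (if 0 < lam k then b k else 0)" for k
  define v where "v i = (\<Sum>k\<in>S. a k * y k i)" for i
  define bb where "bb = (\<Sum>k\<in>S. (a k)\<^sup>2)"
  have bb0: "0 \<le> bb" unfolding bb_def by (intro sum_nonneg) auto
  have vx: "ip m v x = bb"
    unfolding v_def ip_sum_left ip_scale_left bb_def
    by (intro sum.cong refl) (auto simp: a_def b_def power2_eq_square)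
  have "ip m v v \<le> (\<Sum>k\<in>S. \<bar>lam k\<bar> * (a k)\<^sup>2) + \<delta> * bb"
    using ip_combination_gram[OF fS gram[of a]] unfolding v_def[symmetric] bb_def by linarith
  also have "(\<Sum>k\<in>S. \<bar>lam k\<bar> * (a k)\<^sup>2) \<le> (\<Sum>k\<in>S. s * (a k)\<^sup>2)"
  proof (rule sum_mono)
    fix k assume k: "k \<in> S"
    show "\<bar>lam k\<bar> * (a k)\<^sup>2 \<le> s * (a k)\<^sup>2"
    proof (cases "a k = 0")
      case False
      then have "0 < lam k" "k \<notin> K" using b0[of k] by (auto simp: a_def split: if_splits)
      then have "0 < lam k" "lam k < s" using k by (auto simp: K_def)
      then show ?thesis by (intro mult_right_mono) auto
    qed simp
  qed
  finally have vv: "ip m v v \<le> (s + \<delta>) * bb" by (simp only: bb_def sum_distrib_left[symmetric] distrib_right)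
  have bbx: "bb \<le> (s + \<delta>) * ip m x x"
  proof (cases "bb = 0")
    case False
    have "bb * bb \<le> ip m v v * ip m x x" using ip_Cauchy_Schwarz[of m v x] by (simp add: vx power2_eq_square)
    also have "\<dots> \<le> ((s + \<delta>) * bb) * ip m x x" using vv ip_nonneg by (intro mult_right_mono)
    finally have "bb * bb \<le> bb * ((s + \<delta>) * ip m x x)" by (simp add: mult_ac)
    then show ?thesis using False bb0 by simp
  qed (use s xpos in simp)
  have "(\<Sum>k\<in>S. sgn (lam k) * (ip m (y k) x)\<^sup>2) \<le> bb"
    unfolding bb_def by (intro sum_mono) (auto simp: a_def b_def sgn_if)
  then have "t * ip m x x \<le> (s + \<delta> + \<rho>) * ip m x x"
    using res[of x] low bbx by (simp add: distrib_right abs_le_iff)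
  then show False using s xpos by simp
qed

section \<open>Counting functions and sorted spectra\<close>

definition cnt :: "real list \<Rightarrow> real \<Rightarrow> nat" where
  "cnt xs t = length (filter (\<lambda>x. t \<le> x) xs)"

lemma cnt_append: "cnt (xs @ ys) t = cnt xs t + cnt ys t"
  by (simp add: cnt_def)

lemma cnt_replicate_0: "cnt (replicate r 0) t = (if t \<le> 0 then r else 0)"
  by (simp add: cnt_def)

lemma cnt_le_length: "cnt xs t \<le> length xs"
  by (simp add: cnt_def)

lemma cnt_mset: "mset xs = mset ys \<Longrightarrow> cnt xs t = cnt ys t"
  unfolding cnt_def by (metis mset_filter size_mset)

lemma cnt_card: "cnt xs t = card {i. i < length xs \<and> t \<le> xs ! i}"
  unfolding cnt_def by (rule length_filter_conv_card)

text \<open>Tested at t = \<open>xs ! i\<close>: at least \<open>length xs - i\<close> entries of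
  \<open>xs\<close> reach t, hence as many entries of \<open>ys\<close> reach t - eta, but
  \<open>ys ! i\<close> below t - eta would leave fewer.\<close>

lemma sorted_nth_diff_le:
  fixes xs ys :: "real list"
  assumes "sorted xs" "sorted ys" "length xs = length ys" "i < length xs"
    and le: "\<And>t. cnt xs t \<le> cnt ys (t - \<eta>)"
  shows "xs ! i - \<eta> \<le> ys ! i"
proof (rule ccontr)
  assume "\<not> xs ! i - \<eta> \<le> ys ! i"
  then have less: "ys ! i < xs ! i - \<eta>" by simp
  let ?n = "length xs"
  have "{i..<?n} \<subseteq> {j. j < ?n \<and> xs ! i \<le> xs ! j}"
    using assms(1) by (auto intro: sorted_nth_mono)
  then have "?n - i \<le> cnt xs (xs ! i)"
    unfolding cnt_card using card_mono[of "{j. j < ?n \<and> xs ! i \<le> xs ! j}" "{i..<?n}"] by simp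
  moreover have "{j. j < length ys \<and> xs ! i - \<eta> \<le> ys ! j} \<subseteq> {Suc i..<?n}"
  proof
    fix j assume j: "j \<in> {j. j < length ys \<and> xs ! i - \<eta> \<le> ys ! j}"
    have "i < j"
    proof (rule ccontr)
      assume "\<not> i < j"
      then have "ys ! j \<le> ys ! i" using assms by (intro sorted_nth_mono) auto
      then show False using j less by simp
    qed
    then show "j \<in> {Suc i..<?n}" using j assms(3) by simp
  qed
  then have "cnt ys (xs ! i - \<eta>) \<le> ?n - Suc i"
    unfolding cnt_card using card_mono[of "{Suc i..<?n}" "{j. j < length ys \<and> xs ! i - \<eta> \<le> ys ! j}"] by simp
  ultimately show False using le[of "xs ! i"] assms(4) by simp
qed

text \<open>The spectra have different lengths, so each is padded with zeros by the length of the
  other. Thresholds in (0, eta] are settled by the padding; for t <= 0 the claim is read on the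
  complements, the entries below the threshold, where \<open>neg\<close> applies.\<close>

lemma cnt_padded_le:
  fixes A B :: "real list"
  assumes pos: "\<And>t. \<eta> < t \<Longrightarrow> cnt A t \<le> cnt B (t - \<eta>)"
    and neg: "\<And>t. \<eta> < t \<Longrightarrow> cnt (map uminus B) t \<le> cnt (map uminus A) (t - \<eta>)"
    and eta: "0 \<le> \<eta>"
  shows "cnt (A @ replicate (length B) 0) t \<le> cnt (B @ replicate (length A) 0) (t - \<eta>)"
proof -
  consider "\<eta> < t" | "0 < t" "t \<le> \<eta>" | "t \<le> 0" by linarith
  then show ?thesis
  proof cases
    case 1
    then show ?thesis using pos[of t] eta by (simp add: cnt_append cnt_replicate_0)
  next
    case 2
    then show ?thesis using cnt_le_length[of A t] by (simp add: cnt_append cnt_replicate_0)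
  next
    case 3
    define L where "L = filter (\<lambda>x. x < t - \<eta>) B"
    have lt: "length (filter (\<lambda>x. x < c) X) + cnt X c = length X" for X c
      using sum_length_filter_compl[of "\<lambda>x. c \<le> x" X] by (simp add: cnt_def not_le)
    have "length L \<le> length (filter (\<lambda>x. x < t) A)"
    proof (cases "L = []")
      case False
      \<comment> \<open>The hypothesis \<open>neg\<close> counts with weak inequalities, so the
        strict threshold is replaced by the largest entry \<open>M\<close> below it; as t <= 0, - M
        exceeds eta.\<close>
      define M where "M = Max (set L)"
      have "M \<in> set L" unfolding M_def using False by (intro Max_in) auto
      then have M: "M < t - \<eta>" by (simp add: L_def)
      have leM: "x \<le> M" if "x \<in> set L" for x unfolding M_def using that by (intro Max_ge) auto
      have fl: "length (filter P X) \<le> length (filter Q X)" if "\<And>x. x \<in> set X \<Longrightarrow> P x \<Longrightarrow> Q x" for P Q and X :: "real list"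
        using that by (induction X) auto
      have "length L \<le> length (filter (\<lambda>x. x \<le> M) B)"
        unfolding L_def using leM by (intro fl) (auto simp: L_def)
      also have "\<dots> = cnt (map uminus B) (- M)" by (simp add: cnt_def filter_map o_def)
      also have "\<dots> \<le> cnt (map uminus A) (- M - \<eta>)" using M 3 eta by (intro neg) linarith
      also have "\<dots> = length (filter (\<lambda>x. - M - \<eta> \<le> - x) A)" by (simp add: cnt_def filter_map o_def)
      also have "\<dots> \<le> length (filter (\<lambda>x. x < t) A)" using M by (intro fl) auto
      finally show ?thesis .
    qed simp
    then show ?thesis using lt[of t A] lt[of "t - \<eta>" B] 3 eta
      by (simp add: cnt_append cnt_replicate_0 L_def)
  qed
qed

section \<open>From eigenvalue counts to the guarantee\<close>

lemma extend_injection_permutes: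
  fixes g :: "nat \<Rightarrow> nat"
  assumes "inj_on g I" "I \<subseteq> {..<k}" "g ` I \<subseteq> {..<k}"
  shows "\<exists>\<sigma>. \<sigma> permutes {..<k} \<and> (\<forall>i\<in>I. \<sigma> i = g i)"
proof -
  have fI: "finite I" using assms finite_subset by blast
  have "card ({..<k} - I) = card ({..<k} - g ` I)"
    using assms fI by (simp add: card_Diff_subset card_image)
  then obtain h where h: "bij_betw h ({..<k} - I) ({..<k} - g ` I)"
    using finite_same_card_bij[of "{..<k} - I" "{..<k} - g ` I"] by auto
  define \<sigma> where "\<sigma> i = (if i \<in> I then g i else if i < k then h i else i)" for i
  have "bij_betw \<sigma> I (g ` I)"
    using assms(1) by (auto simp: bij_betw_def \<sigma>_def inj_on_def)
  moreover have "bij_betw \<sigma> ({..<k} - I) ({..<k} - g ` I)"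
    using h by (subst bij_betw_cong[of _ _ h]) (auto simp: \<sigma>_def)
  ultimately have "bij_betw \<sigma> (I \<union> ({..<k} - I)) (g ` I \<union> ({..<k} - g ` I))"
    by (rule bij_betw_combine) auto
  moreover have "I \<union> ({..<k} - I) = {..<k}" "g ` I \<union> ({..<k} - g ` I) = {..<k}"
    using assms by auto
  ultimately have "\<sigma> permutes {..<k}"
    using assms by (intro bij_imp_permutes) (auto simp: \<sigma>_def)
  then show ?thesis by (intro exI[of _ \<sigma>]) (auto simp: \<sigma>_def)
qed

text \<open>The matching \<open>g\<close> only pairs close signed values and may disturb the order
  by magnitude, so both parts of the guarantee are pigeonhole arguments around position k.\<close>

lemma top_eigenvalues_approx_of_matching:
  fixes evs zs :: "real list"
  assumes k: "1 \<le> k" "k \<le> d" and len: "length evs = d" "length zs = d + m"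
    and sev: "sorted_wrt (\<lambda>x y. \<bar>y\<bar> \<le> \<bar>x\<bar>) evs" and szs: "sorted_wrt (\<lambda>x y. \<bar>y\<bar> \<le> \<bar>x\<bar>) zs"
    and g: "g permutes {..<d + m}"
    and close: "\<And>i. i < d + m \<Longrightarrow> \<bar>zs ! g i - (evs @ replicate m 0) ! i\<bar> \<le> \<eta>"
    and eta: "0 \<le> \<eta>" "3 * \<eta> \<le> \<epsilon> * frobenius_norm A" "0 < \<epsilon> * frobenius_norm A"
  shows "top_eigenvalues_approx d k \<epsilon> A evs (\<lambda>i. zs ! i)"
proof -
  define E where "E = evs @ replicate m 0"
  define L where "L = \<bar>evs ! (k - 1)\<bar>"
  define F where "F = \<epsilon> * frobenius_norm A"
  let ?n = "d + m"
  have eF: "0 \<le> \<eta>" "3 * \<eta> \<le> F" "0 < F" using eta by (auto simp: F_def)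
  have Enth: "E ! i = evs ! i" if "i < d" for i using that len by (simp add: E_def nth_append)
  have E0: "E ! i = 0" if "d \<le> i" "i < ?n" for i using that len by (simp add: E_def nth_append)
  have L0: "0 \<le> L" by (simp add: L_def)
  have evs_le: "\<bar>evs ! j\<bar> \<le> \<bar>evs ! i\<bar>" if "i \<le> j" "j < d" for i j
    using sorted_wrt_nth_less[OF sev, of i j] that len by (cases "i = j") auto
  have zs_le: "\<bar>zs ! j\<bar> \<le> \<bar>zs ! i\<bar>" if "i \<le> j" "j < ?n" for i j
    using sorted_wrt_nth_less[OF szs, of i j] that len by (cases "i = j") auto
  have gn: "g i < ?n" if "i < ?n" for i using permutes_in_image[OF g] that by simp
  have close': "\<bar>zs ! g i - E ! i\<bar> \<le> \<eta>" if "i < ?n" for i using close[OF that] by (simp add: E_def)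
  have inj: "inj_on g X" for X using permutes_inj[OF g] by (rule inj_on_subset) simp
  define I where "I = {i. i < k \<and> \<bar>evs ! i\<bar> \<ge> L + 2 * F}"
  \<comment> \<open>Otherwise the k + 1 outputs at \<open>g i\<close> and at the positions below k
    all have magnitude at least L + 2 F - eta. Their partners then exceed L in magnitude, so they
    lie among the first k - 1 eigenvalues.\<close>
  have gI: "g i < k" if i: "i \<in> I" for i
  proof (rule ccontr)
    assume "\<not> g i < k"
    then have gk: "k \<le> g i" by simp
    have ii: "i < k" "L + 2 * F \<le> \<bar>evs ! i\<bar>" using i by (auto simp: I_def)
    have "\<bar>zs ! g i\<bar> \<ge> L + 2 * F - \<eta>" using close'[of i] Enth[of i] ii k by auto
    then have zP: "\<bar>zs ! p\<bar> \<ge> L + 2 * F - \<eta>" if "p \<in> insert (g i) {..<k}" for p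
      using zs_le[of p "g i"] gn[of i] gk ii k that by fastforce
    define P where "P = {j. j < ?n \<and> g j \<in> insert (g i) {..<k}}"
    have "P \<subseteq> {..<k - 1}"
    proof
      fix j assume j: "j \<in> P"
      then have jn: "j < ?n" by (simp add: P_def)
      have "\<bar>zs ! g j\<bar> \<ge> L + 2 * F - \<eta>" using zP j by (auto simp: P_def)
      then have "\<bar>E ! j\<bar> > L" using close'[OF jn] eF by linarith
      then show "j \<in> {..<k - 1}"
        using E0[of j] Enth[of j] evs_le[of "k - 1" j] jn L0 L_def by (cases "j < d") (auto simp: not_less intro: ccontr)
    qed
    then have "card P \<le> k - 1" using card_mono[of "{..<k - 1}" P] by simp
    moreover have "g ` P = insert (g i) {..<k}"
    proof -
      have "insert (g i) {..<k} \<subseteq> {..<?n}" using gn[of i] ii k by auto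
      then have "insert (g i) {..<k} \<subseteq> g ` {..<?n}" using permutes_image[OF g] by simp
      then show ?thesis by (auto simp: P_def)
    qed
    then have "card P = k + 1" using card_image[OF inj, of P] gk by simp
    ultimately show False by simp
  qed
  obtain \<sigma> where \<sigma>: "\<sigma> permutes {..<k}" "\<forall>i\<in>I. \<sigma> i = g i"
    using extend_injection_permutes[of g I k] inj gI by (auto simp: I_def)
  have "\<bar>zs ! \<sigma> i - evs ! i\<bar> \<le> F" if "i < k" "\<bar>evs ! i\<bar> \<ge> L + 2 * F" for i
  proof -
    have "\<sigma> i = g i" using \<sigma>(2) that by (simp add: I_def)
    then show ?thesis using close'[of i] Enth[of i] that k eF by simp
  qed
  moreover have "\<exists>j<d. \<bar>evs ! j\<bar> \<ge> L - F \<and> \<bar>zs ! i - evs ! j\<bar> \<le> F" if i: "i < k" for i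
  proof -
    \<comment> \<open>Otherwise the partners of the first k eigenvalues, of magnitude at least L -
      eta, would all fit before position i < k.\<close>
    have zi: "L - \<eta> \<le> \<bar>zs ! i\<bar>"
    proof (rule ccontr)
      assume less: "\<not> L - \<eta> \<le> \<bar>zs ! i\<bar>"
      have "g ` {..<k} \<subseteq> {..<i}"
      proof safe
        fix j assume j: "j < k"
        have "L \<le> \<bar>E ! j\<bar>" using evs_le[of j "k - 1"] Enth[of j] j k by (simp add: L_def)
        then have "L - \<eta> \<le> \<bar>zs ! g j\<bar>" using close'[of j] j k by auto
        then show "g j < i" using less zs_le[of i "g j"] gn[of j] j k by (meson not_le order_trans trans_less_add1 less_le_trans)
      qed
      then have "card {..<k} \<le> card {..<i}" using card_mono[of "{..<i}" "g ` {..<k}"] card_image[OF inj] by simp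
      then show False using i by simp
    qed
    have "i \<in> g ` {..<?n}" unfolding permutes_image[OF g] using i k by simp
    then obtain j where j: "j < ?n" "g j = i" by auto
    have c: "\<bar>zs ! i - E ! j\<bar> \<le> \<eta>" using close'[OF j(1)] j(2) by simp
    show ?thesis
    proof (cases "j < d")
      case True
      then show ?thesis using c zi Enth[OF True] eF by (intro exI[of _ j]) auto
    next
      case False
      \<comment> \<open>The output is matched to a padding zero, so L <= 2 eta, and the eigenvalue
        at index k - 1 is within 3 eta of it; this is the source of the factor 3.\<close>
      then have "\<bar>zs ! i\<bar> \<le> \<eta>" using c E0[of j] j by simp
      then show ?thesis using zi k eF by (intro exI[of _ "k - 1"]) (auto simp: L_def)
    qed
  qed
  ultimately show ?thesis
    using \<sigma>(1) unfolding top_eigenvalues_approx_def L_def F_def by (intro conjI exI[of _ \<sigma>]) (auto simp: mult.assoc)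
qed

text \<open>Counts compare the sorted lists entrywise, and the sorting permutations carry this back
  to the lists as given. The conditions on negated lists control the negative eigenvalues.\<close>

lemma matching_of_counts:
  fixes evs mus zs :: "real list"
  assumes len: "length evs = d" "length mus = m"
    and zs: "mset zs = mset (mus @ replicate d 0)"
    and c1: "\<And>t. \<eta> < t \<Longrightarrow> cnt evs t \<le> cnt mus (t - \<eta>)"
    and c2: "\<And>t. \<eta> < t \<Longrightarrow> cnt mus t \<le> cnt evs (t - \<eta>)"
    and c3: "\<And>t. \<eta> < t \<Longrightarrow> cnt (map uminus evs) t \<le> cnt (map uminus mus) (t - \<eta>)"
    and c4: "\<And>t. \<eta> < t \<Longrightarrow> cnt (map uminus mus) t \<le> cnt (map uminus evs) (t - \<eta>)"
    and eta: "0 \<le> \<eta>"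
  shows "\<exists>g. g permutes {..<d + m} \<and> (\<forall>i<d + m. \<bar>zs ! g i - (evs @ replicate m 0) ! i\<bar> \<le> \<eta>)"
proof -
  let ?E = "evs @ replicate m 0" and ?Z = "mus @ replicate d 0"
  define xs where "xs = sort ?E"
  define ys where "ys = sort ?Z"
  have lens: "length xs = d + m" "length ys = d + m" "length zs = d + m"
    using len mset_eq_length[OF zs] by (auto simp: xs_def ys_def)
  have cx: "cnt xs t = cnt ?E t" and cy: "cnt ys t = cnt ?Z t" for t
    by (auto simp: xs_def ys_def intro!: cnt_mset)
  have lohi: "xs ! i - \<eta> \<le> ys ! i" "ys ! i - \<eta> \<le> xs ! i" if "i < d + m" for i
    using cnt_padded_le[of \<eta> evs mus, OF c1 c4 eta] cnt_padded_le[of \<eta> mus evs, OF c2 c3 eta] that lens len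
    by (auto intro!: sorted_nth_diff_le simp: cx cy) (auto simp: xs_def ys_def)
  have xy: "\<bar>ys ! i - xs ! i\<bar> \<le> \<eta>" if "i < d + m" for i using lohi[OF that] by linarith
  have "mset ?E = mset xs" "mset ys = mset zs" using zs by (auto simp: xs_def ys_def)
  then obtain p q where p: "p permutes {..<length xs}" "permute_list p xs = ?E"
    and q: "q permutes {..<length zs}" "permute_list q zs = ys"
    by (metis mset_eq_permutation)
  have "\<bar>zs ! (q \<circ> p) i - ?E ! i\<bar> \<le> \<eta>" if i: "i < d + m" for i
  proof -
    have pi: "p i < d + m" using permutes_in_image[OF p(1)] i lens by simp
    have "?E ! i = xs ! p i" using permute_list_nth[OF p(1), of i] i p(2) lens by simp
    moreover have "ys ! p i = zs ! q (p i)" using permute_list_nth[OF q(1), of "p i"] pi q(2) lens by simp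
    ultimately show ?thesis using xy[OF pi] by simp
  qed
  moreover have "q \<circ> p permutes {..<d + m}" using p(1) q(1) lens by (intro permutes_compose) auto
  ultimately show ?thesis by blast
qed

lemma spectral_decomp_uminus:
  "spectral_decomp n A \<mu> u \<Longrightarrow> spectral_decomp n (\<lambda>i j. - A i j) (\<lambda>k. - \<mu> k) u"
  by (simp add: spectral_decomp_def sum_negf)

lemma top_eigenvalues_approx_of_sketch:
  fixes y :: "nat \<Rightarrow> nat \<Rightarrow> real" and evs mus zs :: "real list"
  assumes k: "1 \<le> k" "k \<le> d" and len: "length evs = d" "length mus = m"
    and sev: "sorted_wrt (\<lambda>x y. \<bar>y\<bar> \<le> \<bar>x\<bar>) evs" and szs: "sorted_wrt (\<lambda>x y. \<bar>y\<bar> \<le> \<bar>x\<bar>) zs"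
    and zs: "mset zs = mset (mus @ replicate d 0)"
    and S: "S = {k. k < d \<and> e0 < \<bar>evs ! k\<bar>}"
    and gram: "\<And>a. \<bar>\<Sum>k\<in>S. \<Sum>l\<in>S. a k * a l * (ip m (y k) (y l) - (if k = l then \<bar>evs ! k\<bar> else 0))\<bar> \<le> \<delta> * (\<Sum>k\<in>S. (a k)\<^sup>2)"
    and res: "\<And>x. \<bar>ip m x (mv m B x) - (\<Sum>k\<in>S. sgn (evs ! k) * (ip m (y k) x)\<^sup>2)\<bar> \<le> \<rho> * ip m x x"
    and sp: "spectral_decomp m B (\<lambda>j. mus ! j) w"
    and \<delta>: "0 \<le> \<delta>" "\<delta> \<le> e0" "e0 \<le> \<eta>" "0 \<le> \<rho>" "\<delta> + \<rho> < \<eta>"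
    and eta: "3 * \<eta> \<le> \<epsilon> * frobenius_norm A"
  shows "top_eigenvalues_approx d k \<epsilon> A evs (\<lambda>i. zs ! i)"
proof -
  have fS: "finite S" by (simp add: S)
  \<comment> \<open>Stated for arbitrary signs of the eigenvalues so that it applies to both B and -
    B; the Gram bound depends only on the magnitudes and is shared. Eigenvalues of at least t > eta
    >= e0 all lie in \<open>S\<close>.\<close>
  have main: "card {k. k < d \<and> t \<le> lam k} \<le> card {j. j < m \<and> t - \<eta> \<le> \<mu> j}"
    "card {j. j < m \<and> t \<le> \<mu> j} \<le> card {k. k < d \<and> t - \<eta> \<le> lam k}"
    if sg: "\<And>k. \<bar>lam k\<bar> = \<bar>evs ! k\<bar>"
      and res': "\<And>x. \<bar>ip m x (mv m B' x) - (\<Sum>k\<in>S. sgn (lam k) * (ip m (y k) x)\<^sup>2)\<bar> \<le> \<rho> * ip m x x"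
      and sp': "spectral_decomp m B' \<mu> w" and t: "\<eta> < t" for lam \<mu> B' t
  proof -
    have gram': "\<bar>\<Sum>k\<in>S. \<Sum>l\<in>S. a k * a l * (ip m (y k) (y l) - (if k = l then \<bar>lam k\<bar> else 0))\<bar> \<le> \<delta> * (\<Sum>k\<in>S. (a k)\<^sup>2)" for a
      unfolding sg by (rule gram)
    have "{k. k < d \<and> t \<le> lam k} = {k \<in> S. t \<le> lam k}"
    proof -
      have "e0 < \<bar>evs ! k\<bar>" if "t \<le> lam k" for k using that t \<delta> sg[of k] by linarith
      then show ?thesis by (auto simp: S)
    qed
    also have "card \<dots> \<le> card {j. j < m \<and> t - \<delta> - \<rho> \<le> \<mu> j}"
      using \<delta> t by (intro sketch_eigenvalue_count_ge[OF fS gram' res' sp']) (auto simp: S sg)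
    also have "\<dots> \<le> card {j. j < m \<and> t - \<eta> \<le> \<mu> j}"
      using \<delta> by (intro card_mono) auto
    finally show "card {k. k < d \<and> t \<le> lam k} \<le> card {j. j < m \<and> t - \<eta> \<le> \<mu> j}" .
    have "card {j. j < m \<and> t \<le> \<mu> j} \<le> card {k \<in> S. t - \<eta> \<le> lam k}"
      using \<delta> t by (intro sketch_eigenvalue_count_le[OF fS gram' res' sp']) auto
    also have "\<dots> \<le> card {k. k < d \<and> t - \<eta> \<le> lam k}"
      by (intro card_mono) (auto simp: S)
    finally show "card {j. j < m \<and> t \<le> \<mu> j} \<le> card {k. k < d \<and> t - \<eta> \<le> lam k}" .
  qed
  have resm: "\<bar>ip m x (mv m (\<lambda>i j. - B i j) x) - (\<Sum>k\<in>S. sgn (- (evs ! k)) * (ip m (y k) x)\<^sup>2)\<bar> \<le> \<rho> * ip m x x" for x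
  proof -
    have "ip m x (mv m (\<lambda>i j. - B i j) x) = - ip m x (mv m B x)"
      by (simp add: ip_def mv_def sum_negf)
    moreover have "(\<Sum>k\<in>S. sgn (- (evs ! k)) * (ip m (y k) x)\<^sup>2) = - (\<Sum>k\<in>S. sgn (evs ! k) * (ip m (y k) x)\<^sup>2)"
      by (simp add: sgn_minus sum_negf)
    ultimately show ?thesis using res[of x] by simp
  qed
  have cm: "cnt (map uminus xs) t = card {i. i < length xs \<and> t \<le> - (xs ! i)}" for xs t
    unfolding cnt_card by (intro arg_cong[where f = card]) auto
  have "\<exists>g. g permutes {..<d + m} \<and> (\<forall>i<d + m. \<bar>zs ! g i - (evs @ replicate m 0) ! i\<bar> \<le> \<eta>)"
  proof (rule matching_of_counts[OF len zs])
    fix t assume t: "\<eta> < t"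
    note pos = main[OF refl res sp t] and neg = main[OF abs_minus_cancel resm spectral_decomp_uminus[OF sp] t]
    show "cnt evs t \<le> cnt mus (t - \<eta>)" "cnt mus t \<le> cnt evs (t - \<eta>)"
      using pos by (simp_all add: cnt_card len)
    show "cnt (map uminus evs) t \<le> cnt (map uminus mus) (t - \<eta>)"
      "cnt (map uminus mus) t \<le> cnt (map uminus evs) (t - \<eta>)"
      using neg by (simp_all add: cm len)
  qed (use \<delta> in auto)
  then obtain g where g: "g permutes {..<d + m}" "\<And>i. i < d + m \<Longrightarrow> \<bar>zs ! g i - (evs @ replicate m 0) ! i\<bar> \<le> \<eta>"
    by blast
  have "length zs = d + m" using mset_eq_length[OF zs] len by simp
  then show ?thesis
    using \<delta> eta g by (intro top_eigenvalues_approx_of_matching[OF k len(1) _ sev szs g(1)]) auto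
qed

section \<open>Characteristic polynomial and orthonormal eigenvectors\<close>

lemma char_poly_spectral_decomp:
  assumes A: "A \<in> carrier_mat n n" and sp: "spectral_decomp n (\<lambda>i j. A $$ (i, j)) \<mu> u"
  shows "char_poly A = (\<Prod>a\<leftarrow>map \<mu> [0..<n]. [:- a, 1:])"
proof -
  define P where "P = Matrix.mat n n (\<lambda>(i, k). u k i)"
  define D where "D = Matrix.mat n n (\<lambda>(k, l). if k = l then \<mu> k else 0)"
  have c: "P \<in> carrier_mat n n" "D \<in> carrier_mat n n" "P\<^sup>T \<in> carrier_mat n n" by (auto simp: P_def D_def)
  have PP: "P\<^sup>T * P = 1\<^sub>m n"
    using spectral_decomp_orth[OF sp]
    by (intro eq_matI) (auto simp: P_def scalar_prod_def ip_def lessThan_atLeast0)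
  have PD: "P * D = Matrix.mat n n (\<lambda>(i, k). \<mu> k * u k i)"
  proof (rule eq_matI)
    fix i k assume "i < dim_row (Matrix.mat n n (\<lambda>(i, k). \<mu> k * u k i))" "k < dim_col (Matrix.mat n n (\<lambda>(i, k). \<mu> k * u k i))"
    then have ik: "i < n" "k < n" by auto
    have "(P * D) $$ (i, k) = (\<Sum>l = 0..<n. u l i * (if l = k then \<mu> l else 0))"
      using ik by (simp add: P_def D_def scalar_prod_def)
    also have "\<dots> = (\<Sum>l = 0..<n. if l = k then \<mu> l * u l i else 0)"
      by (intro sum.cong refl) auto
    finally show "(P * D) $$ (i, k) = Matrix.mat n n (\<lambda>(i, k). \<mu> k * u k i) $$ (i, k)"
      using ik by simp
  qed (simp_all add: P_def D_def)
  have "A = P * D * P\<^sup>T"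
    unfolding PD using A spectral_decomp_entry[OF sp]
    by (intro eq_matI) (auto simp: P_def scalar_prod_def lessThan_atLeast0)
  moreover have "P * P\<^sup>T = 1\<^sub>m n" by (rule mat_mult_left_right_inverse[OF c(3,1) PP])
  ultimately have "similar_mat_wit A D P P\<^sup>T"
    using A c PP by (auto simp: similar_mat_wit_def Let_def)
  then have "char_poly A = char_poly D"
    by (intro char_poly_similar) (auto simp: similar_mat_def)
  also have "\<dots> = (\<Prod>a\<leftarrow>diag_mat D. [:- a, 1:])"
    using c(2) by (intro char_poly_upper_triangular) (auto simp: upper_triangular_def D_def)
  also have "diag_mat D = map \<mu> [0..<n]"
    by (simp add: diag_mat_def D_def)
  finally show ?thesis .
qed

lemma proots_linear_factors: "proots (\<Prod>a\<leftarrow>xs. [:- a, 1:]) = mset (xs :: 'a :: idom list)"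
proof (induction xs)
  case (Cons a xs)
  have "(\<Prod>a\<leftarrow>xs. [:- a, 1:]) \<noteq> (0 :: 'a poly)" by (auto simp: prod_list_zero_iff)
  then have "proots ([:- a, 1:] * (\<Prod>a\<leftarrow>xs. [:- a, 1:])) = {#a#} + mset xs"
    using Cons by (subst proots_mult) auto
  then show ?case by simp
qed simp

text \<open>The characteristic polynomial fixes only the multiset of eigenvalues, and ties leave the
  order open, so the eigenvectors are permuted to follow the given list.\<close>

lemma eigenvalues_spectral_decomp:
  assumes A: "A \<in> symmetric_mats d" and evs: "eigenvalues_by_magnitude A evs"
  shows "length evs = d" "\<exists>u. spectral_decomp d (\<lambda>i j. A $$ (i, j)) (\<lambda>k. evs ! k) u"
proof -
  have c: "A \<in> carrier_mat d d" and T: "A\<^sup>T = A" using A by (auto simp: symmetric_mats_def)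
  have "A $$ (i, j) = A $$ (j, i)" if "i < d" "j < d" for i j
    using T c that by (metis carrier_matD index_transpose_mat(1))
  then obtain \<mu> u where sp: "spectral_decomp d (\<lambda>i j. A $$ (i, j)) \<mu> u"
    using spectral_theorem[of d "\<lambda>i j. A $$ (i, j)"] by blast
  have "mset evs = mset (map \<mu> [0..<d])"
    using char_poly_spectral_decomp[OF c sp] evs proots_linear_factors
    unfolding eigenvalues_by_magnitude_def by metis
  moreover from this show len: "length evs = d" by (metis diff_zero length_map length_upt mset_eq_length)
  ultimately obtain p where p: "p permutes {..<length (map \<mu> [0..<d])}" "permute_list p (map \<mu> [0..<d]) = evs"
    using mset_eq_permutation by blast
  then have pd: "p permutes {..<d}" by simp
  have ev: "evs ! k = \<mu> (p k)" if "k < d" for k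
    using permute_list_nth[OF p(1), of k] p(2) that permutes_in_image[OF pd, of k] by simp
  have "spectral_decomp d (\<lambda>i j. A $$ (i, j)) (\<lambda>k. evs ! k) (\<lambda>k. u (p k))"
    unfolding spectral_decomp_def
  proof (intro conjI allI impI)
    fix k l assume "k < d" "l < d"
    then show "ip d (u (p k)) (u (p l)) = (if k = l then 1 else 0)"
      using spectral_decomp_orth[OF sp] permutes_in_image[OF pd] permutes_inj[OF pd]
      by (auto simp: inj_eq)
  next
    fix i j assume ij: "i < d" "j < d"
    have "A $$ (i, j) = (\<Sum>k<d. \<mu> k * u k i * u k j)" using spectral_decomp_entry[OF sp ij] .
    also have "\<dots> = (\<Sum>k<d. \<mu> (p k) * u (p k) i * u (p k) j)"
      using sum.permute[OF pd, of "\<lambda>k. \<mu> k * u k i * u k j"] by (simp add: o_def)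
    finally show "A $$ (i, j) = (\<Sum>k<d. evs ! k * u (p k) i * u (p k) j)" using ev by simp
  qed
  then show "\<exists>u. spectral_decomp d (\<lambda>i j. A $$ (i, j)) (\<lambda>k. evs ! k) u" by blast
qed

lemma frobenius_norm_spectral:
  assumes A: "A \<in> symmetric_mats d" and sp: "spectral_decomp d (\<lambda>i j. A $$ (i, j)) \<mu> u"
  shows "(frobenius_norm A)\<^sup>2 = (\<Sum>k<d. (\<mu> k)\<^sup>2)"
proof -
  have "(frobenius_norm A)\<^sup>2 = (\<Sum>i<d. \<Sum>j<d. (A $$ (i, j))\<^sup>2)"
    using A by (auto simp: frobenius_norm_def symmetric_mats_def intro!: real_sqrt_pow2 sum_nonneg)
  then show ?thesis using spectral_decomp_frobenius[OF sp] by simp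
qed

section \<open>Success of the sketch\<close>

text \<open>\<open>\<omega>\<close> bounds each of the error terms in operator norm; eigenvalues of magnitude at most \<open>\<omega> / 800\<close>
  count as tail.\<close>

definition good_signs :: "nat \<Rightarrow> nat \<Rightarrow> (nat \<Rightarrow> nat \<Rightarrow> real) \<Rightarrow> (nat \<Rightarrow> real) \<Rightarrow> real \<Rightarrow> (nat \<times> nat \<Rightarrow> real) \<Rightarrow> bool" where
  "good_signs m d u lam \<omega> s \<longleftrightarrow>
     (let S = {k. k < d \<and> \<omega> / 800 < \<bar>lam k\<bar>}; T = {k. k < d \<and> \<bar>lam k\<bar> \<le> \<omega> / 800};
          y = weighted_col m d u lam s in
      (\<forall>x. \<bar>ip m x (mv m (off_diag m (sketch_form d u T lam s)) x)\<bar> \<le> \<omega> * ip m x x) \<and>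
      (\<Sum>k\<in>S. \<Sum>l\<in>S. (ip m (y k) (y l) - (if k = l then \<bar>lam k\<bar> else 0))\<^sup>2) \<le> (\<omega> / 1600)\<^sup>2 \<and>
      (\<Sum>i<m. (sketch_form d u S lam s i i / m)\<^sup>2) \<le> \<omega>\<^sup>2)"

text \<open>Three failure events of probability at most 1 / 50 each: the tail by the net argument,
  the Gram matrix and the diagonal by Markov's inequality from their second moments.\<close>

lemma good_signs_probability:
  assumes orth: "\<And>k l. k < d \<Longrightarrow> l < d \<Longrightarrow> ip d (u k) (u l) = (if k = l then 1 else 0)"
    and frob: "(\<Sum>k<d. (lam k)\<^sup>2) = \<alpha>\<^sup>2" "0 < \<alpha>"
    and eps: "0 < \<epsilon>" "\<epsilon> < 1"
    and m: "2 * 10 ^ 22 / \<epsilon> ^ 4 \<le> real m"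
  shows "9 / 10 \<le> rad ({..<m} \<times> {..<d}) (\<lambda>s. of_bool (good_signs m d u lam (\<epsilon> * \<alpha> / 20) s))"
proof -
  let ?K = "{..<m} \<times> {..<d}"
  define \<omega> where "\<omega> = \<epsilon> * \<alpha> / 20"
  define S where "S = {k. k < d \<and> \<omega> / 800 < \<bar>lam k\<bar>}"
  define T where "T = {k. k < d \<and> \<bar>lam k\<bar> \<le> \<omega> / 800}"
  define y where "y = weighted_col m d u lam"
  define g1 where "g1 s \<longleftrightarrow> (\<forall>x. \<bar>ip m x (mv m (off_diag m (sketch_form d u T lam s)) x)\<bar> \<le> \<omega> * ip m x x)" for s
  define f2 where "f2 s = (\<Sum>k\<in>S. \<Sum>l\<in>S. (ip m (y s k) (y s l) - (if k = l then \<bar>lam k\<bar> else 0))\<^sup>2)" for s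
  define f3 where "f3 s = (\<Sum>i<m. (sketch_form d u S lam s i i / m)\<^sup>2)" for s
  have w: "0 < \<omega>" using eps frob by (simp add: \<omega>_def)
  have e4: "0 < \<epsilon> ^ 4" using eps by simp
  have e4': "2 * 10 ^ 22 \<le> \<epsilon> ^ 4 * m" using m e4 by (simp add: divide_le_eq mult.commute)
  have m0: "0 < m"
  proof (rule ccontr)
    assume "\<not> 0 < m"
    then show False using e4' by simp
  qed
  have fin: "finite S" "finite T" by (auto simp: S_def T_def)
  define t where "t = (\<Sum>k\<in>S. \<bar>lam k\<bar>)"
  have t0: "0 \<le> t" by (simp add: t_def sum_nonneg)
  \<comment> \<open>Every large |lam_k| exceeds omega / 800, so omega / 800 times it is at most its
    square; this makes t of order alpha / eps.\<close>
  have "\<omega> / 800 * t \<le> \<alpha>\<^sup>2"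
  proof -
    have "\<omega> / 800 * t \<le> (\<Sum>k\<in>S. (lam k)\<^sup>2)"
      unfolding t_def sum_distrib_left
    proof (rule sum_mono)
      fix k assume "k \<in> S"
      then have "\<omega> / 800 * \<bar>lam k\<bar> \<le> \<bar>lam k\<bar> * \<bar>lam k\<bar>"
        by (intro mult_right_mono) (auto simp: S_def)
      then show "\<omega> / 800 * \<bar>lam k\<bar> \<le> (lam k)\<^sup>2" by (simp add: power2_eq_square)
    qed
    also have "\<dots> \<le> (\<Sum>k<d. (lam k)\<^sup>2)" by (intro sum_mono2) (auto simp: S_def)
    finally show ?thesis using frob by simp
  qed
  then have "\<epsilon> / 16000 * t \<le> \<alpha>" using frob by (simp add: \<omega>_def power2_eq_square)
  then have te: "\<epsilon> * t \<le> 16000 * \<alpha>" by simp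
  \<comment> \<open>The requirement that fixes m: 51200 = 50 * 1024, 1024000000 = (20 * 1600)^2 and
    256000000 = 16000^2 have a product below 2 * 10^22.\<close>
  have key: "1024 * t\<^sup>2 / m / (\<omega> / 1600)\<^sup>2 \<le> 1 / 50"
  proof -
    have "(\<epsilon> * t)\<^sup>2 \<le> (16000 * \<alpha>)\<^sup>2" using te eps t0 by (intro power_mono) auto
    then have "\<epsilon>\<^sup>2 * t\<^sup>2 \<le> 256000000 * \<alpha>\<^sup>2" by (simp add: power_mult_distrib)
    then have "51200 * 1024000000 * (\<epsilon>\<^sup>2 * t\<^sup>2) \<le> 51200 * 1024000000 * (256000000 * \<alpha>\<^sup>2)" by simp
    also have "\<dots> \<le> (2 * 10 ^ 22) * \<alpha>\<^sup>2" by simp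
    also have "\<dots> \<le> (\<epsilon> ^ 4 * m) * \<alpha>\<^sup>2" using e4' by (intro mult_right_mono) auto
    finally have "\<epsilon>\<^sup>2 * (51200 * 1024000000 * t\<^sup>2) \<le> \<epsilon>\<^sup>2 * (\<epsilon>\<^sup>2 * m * \<alpha>\<^sup>2)"
      by (simp add: mult_ac power4_eq_xxxx power2_eq_square)
    then have "51200 * 1024000000 * t\<^sup>2 \<le> \<epsilon>\<^sup>2 * m * \<alpha>\<^sup>2" using eps by simp
    then have "50 * (1024 * t\<^sup>2) \<le> m * (\<omega> / 1600)\<^sup>2"
      by (simp add: \<omega>_def power_mult_distrib power_divide mult_ac)
    then show ?thesis using m0 w by (simp add: divide_simps mult_ac)
  qed
  have p1: "rad ?K (\<lambda>s. of_bool (\<not> g1 s)) \<le> 1 / 50"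
    unfolding g1_def
  proof (rule tail_sketch_bound[OF m0 w fin(2)])
    show "800 * \<bar>lam k\<bar> \<le> \<omega>" if "k \<in> T" for k using that by (simp add: T_def)
    have "(\<Sum>k\<in>T. (lam k)\<^sup>2) \<le> (\<Sum>k<d. (lam k)\<^sup>2)" by (intro sum_mono2) (auto simp: T_def)
    then have "313600 * (\<Sum>k\<in>T. (lam k)\<^sup>2) \<le> 313600 * \<alpha>\<^sup>2" using frob by simp
    also have "\<dots> \<le> \<omega>\<^sup>2 * m"
    proof -
      have "\<epsilon> ^ 4 * m \<le> \<epsilon>\<^sup>2 * m"
        using eps by (intro mult_right_mono power_decreasing) auto
      then have "125440000 \<le> \<epsilon>\<^sup>2 * m" using e4' by simp
      then have "125440000 * \<alpha>\<^sup>2 \<le> \<epsilon>\<^sup>2 * m * \<alpha>\<^sup>2" by (intro mult_right_mono) auto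
      then show ?thesis by (simp add: \<omega>_def power_mult_distrib power_divide mult_ac)
    qed
    finally show "313600 * (\<Sum>k\<in>T. (lam k)\<^sup>2) \<le> \<omega>\<^sup>2 * m" .
  qed (use orth in \<open>auto simp: T_def\<close>)
  have p2: "rad ?K (\<lambda>s. of_bool (\<not> f2 s \<le> (\<omega> / 1600)\<^sup>2)) \<le> 1 / 50"
  proof -
    have "rad ?K (\<lambda>s. of_bool (\<not> f2 s \<le> (\<omega> / 1600)\<^sup>2)) \<le> rad ?K f2 / (\<omega> / 1600)\<^sup>2"
      using w by (intro rad_markov) (auto simp: f2_def intro!: sum_nonneg)
    also have "\<dots> \<le> (1024 * t\<^sup>2 / m) / (\<omega> / 1600)\<^sup>2"
    proof (rule divide_right_mono)
      show "rad ?K f2 \<le> 1024 * t\<^sup>2 / m"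
        unfolding f2_def[abs_def] y_def t_def using orth by (intro rad_gram_error[OF m0 fin(1)]) (auto simp: S_def)
    qed simp
    finally show ?thesis using key by simp
  qed
  have p3: "rad ?K (\<lambda>s. of_bool (\<not> f3 s \<le> \<omega>\<^sup>2)) \<le> 1 / 50"
  proof -
    have "rad ?K (\<lambda>s. of_bool (\<not> f3 s \<le> \<omega>\<^sup>2)) \<le> rad ?K f3 / \<omega>\<^sup>2"
      using w by (intro rad_markov) (auto simp: f3_def intro!: sum_nonneg)
    also have "\<dots> \<le> (1024 * t\<^sup>2 / m) / \<omega>\<^sup>2"
    proof (rule divide_right_mono)
      show "rad ?K f3 \<le> 1024 * t\<^sup>2 / m"
        unfolding f3_def[abs_def] t_def using orth by (intro rad_diagonal_error[OF m0 fin(1)]) (auto simp: S_def)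
    qed simp
    also have "\<dots> \<le> (1024 * t\<^sup>2 / m) / (\<omega> / 1600)\<^sup>2"
      using w by (intro divide_left_mono) (auto simp: power_divide)
    finally show ?thesis using key by simp
  qed
  have "1 - 1 / 10 \<le> rad ?K (\<lambda>s. 1 - (of_bool (\<not> g1 s) + of_bool (\<not> f2 s \<le> (\<omega> / 1600)\<^sup>2) + of_bool (\<not> f3 s \<le> \<omega>\<^sup>2)))"
    unfolding rad_diff rad_add using p1 p2 p3 by (simp add: rad_const)
  also have "\<dots> \<le> rad ?K (\<lambda>s. of_bool (good_signs m d u lam \<omega> s))"
  proof (rule rad_mono)
    fix s
    have "good_signs m d u lam \<omega> s \<longleftrightarrow> g1 s \<and> f2 s \<le> (\<omega> / 1600)\<^sup>2 \<and> f3 s \<le> \<omega>\<^sup>2"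
      by (simp add: good_signs_def g1_def f2_def f3_def y_def S_def T_def Let_def)
    then show "1 - (of_bool (\<not> g1 s) + of_bool (\<not> f2 s \<le> (\<omega> / 1600)\<^sup>2) + of_bool (\<not> f3 s \<le> \<omega>\<^sup>2)) \<le> (of_bool (good_signs m d u lam \<omega> s) :: real)"
      by (cases "g1 s"; cases "f2 s \<le> (\<omega> / 1600)\<^sup>2"; cases "f3 s \<le> \<omega>\<^sup>2") simp_all
  qed
  finally show ?thesis by (simp add: \<omega>_def)
qed

lemma sketch_form_quadratic:
  fixes u :: "nat \<Rightarrow> nat \<Rightarrow> real"
  assumes m: "0 < m"
  shows "ip m x (mv m (\<lambda>i j. sketch_form d u S lam s i j / m) x) =
     (\<Sum>k\<in>S. sgn (lam k) * (ip m (weighted_col m d u lam s k) x)\<^sup>2)"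
proof -
  have "ip m x (mv m (\<lambda>i j. sketch_form d u S lam s i j / m) x) =
     (\<Sum>k\<in>S. (lam k / m) * ip m (proj d u s k) x * ip m (proj d u s k) x)"
    by (rule quadratic_rank_one_sum) (simp add: sketch_form_def sum_divide_distrib)
  also have "\<dots> = (\<Sum>k\<in>S. sgn (lam k) * (ip m (weighted_col m d u lam s k) x)\<^sup>2)"
  proof (intro sum.cong refl)
    fix k
    have "ip m (weighted_col m d u lam s k) x = sqrt (\<bar>lam k\<bar> / m) * ip m (proj d u s k) x"
      unfolding weighted_col_def[abs_def] by (rule ip_scale_left)
    then have "sgn (lam k) * (ip m (weighted_col m d u lam s k) x)\<^sup>2 = (sgn (lam k) * \<bar>lam k\<bar>) / m * (ip m (proj d u s k) x)\<^sup>2"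
      by (simp add: power_mult_distrib)
    then show "(lam k / m) * ip m (proj d u s k) x * ip m (proj d u s k) x = sgn (lam k) * (ip m (weighted_col m d u lam s k) x)\<^sup>2"
      by (simp add: sgn_mult_abs power2_eq_square)
  qed
  finally show ?thesis .
qed

text \<open>The residual 3 omega adds up the removed diagonal of the large part, the tail and the
  rounding. With the Gram error omega / 1600 it stays below the shift 5 omega, and three shifts stay
  within eps |A|_F = 20 omega.\<close>

lemma sketch_success:
  assumes A: "A \<in> symmetric_mats d" and evs: "eigenvalues_by_magnitude A evs"
    and u: "spectral_decomp d (\<lambda>i j. A $$ (i, j)) (\<lambda>k. evs ! k) u"
    and k: "1 \<le> k" "k \<le> d" and m: "0 < m"
    and \<omega>: "\<omega> = \<epsilon> * frobenius_norm A / 20" "0 < \<omega>"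
    and good: "good_signs m d u (\<lambda>k. evs ! k) \<omega> s"
    and B: "\<And>i j. i < m \<Longrightarrow> j < m \<Longrightarrow> \<bar>B i j - off_diag m (sketch_form d u {..<d} (\<lambda>k. evs ! k) s) i j\<bar> \<le> \<omega> / m"
    and sp: "spectral_decomp m B (\<lambda>j. mus ! j) w" "length mus = m"
    and zs: "mset zs = mset (mus @ replicate d 0)" "sorted_wrt (\<lambda>x y. \<bar>y\<bar> \<le> \<bar>x\<bar>) zs"
  shows "top_eigenvalues_approx d k \<epsilon> A evs (\<lambda>i. zs ! i)"
proof -
  define lam where "lam k = evs ! k" for k
  define S where "S = {k. k < d \<and> \<omega> / 800 < \<bar>lam k\<bar>}"
  define T where "T = {k. k < d \<and> \<bar>lam k\<bar> \<le> \<omega> / 800}"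
  define y where "y = weighted_col m d u lam s"
  define M where "M = off_diag m (sketch_form d u {..<d} lam s)"
  have g1: "\<bar>ip m x (mv m (off_diag m (sketch_form d u T lam s)) x)\<bar> \<le> \<omega> * ip m x x" for x
    using good unfolding good_signs_def Let_def lam_def[symmetric] by (auto simp: T_def)
  have g2: "(\<Sum>k\<in>S. \<Sum>l\<in>S. (ip m (y k) (y l) - (if k = l then \<bar>lam k\<bar> else 0))\<^sup>2) \<le> (\<omega> / 1600)\<^sup>2"
    using good unfolding good_signs_def Let_def lam_def[symmetric] lam_def[abs_def, symmetric] by (auto simp: S_def y_def)
  have g3: "(\<Sum>i<m. (sketch_form d u S lam s i i / m)\<^sup>2) \<le> \<omega>\<^sup>2"
    using good unfolding good_signs_def Let_def lam_def[symmetric] by (auto simp: S_def)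
  have split: "sketch_form d u {..<d} lam s i j = sketch_form d u S lam s i j + sketch_form d u T lam s i j" for i j
  proof -
    have "{..<d} = S \<union> T" "S \<inter> T = {}" "finite S" "finite T" by (auto simp: S_def T_def)
    then show ?thesis unfolding sketch_form_def by (simp add: sum.union_disjoint)
  qed
  have res: "\<bar>ip m x (mv m B x) - (\<Sum>k\<in>S. sgn (lam k) * (ip m (y k) x)\<^sup>2)\<bar> \<le> (3 * \<omega>) * ip m x x" for x
  proof -
    define D where "D i = sketch_form d u S lam s i i / m" for i
    have quadM: "ip m x (mv m M x) = (\<Sum>k\<in>S. sgn (lam k) * (ip m (y k) x)\<^sup>2) - (\<Sum>i<m. D i * (x i * x i))
       + ip m x (mv m (off_diag m (sketch_form d u T lam s)) x)"
    proof -
      have Meq: "M i j = sketch_form d u S lam s i j / m - (if j = i then D i else 0) + off_diag m (sketch_form d u T lam s) i j" for i j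
        by (simp add: M_def off_diag_def split D_def add_divide_distrib)
      have "ip m x (mv m M x) = (\<Sum>i<m. \<Sum>j<m. x i * (sketch_form d u S lam s i j / m) * x j
          - (if j = i then x i * D i * x j else 0) + x i * off_diag m (sketch_form d u T lam s) i j * x j)"
        unfolding ip_def mv_def sum_distrib_left by (intro sum.cong refl) (auto simp: Meq algebra_simps)
      also have "\<dots> = ip m x (mv m (\<lambda>i j. sketch_form d u S lam s i j / m) x) - (\<Sum>i<m. D i * (x i * x i))
         + ip m x (mv m (off_diag m (sketch_form d u T lam s)) x)"
        by (simp add: ip_def mv_def sum_distrib_left sum.distrib sum_subtractf mult_ac)
      finally show ?thesis unfolding sketch_form_quadratic[OF m] y_def .
    qed
    have diag: "\<bar>\<Sum>i<m. D i * (x i * x i)\<bar> \<le> \<omega> * ip m x x"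
    proof -
      have Di: "\<bar>D i\<bar> \<le> \<omega>" if "i < m" for i
      proof -
        have "(D i)\<^sup>2 \<le> (\<Sum>i<m. (D i)\<^sup>2)" using that by (intro member_le_sum) auto
        then have "(D i)\<^sup>2 \<le> \<omega>\<^sup>2" using g3 by (simp add: D_def)
        then show ?thesis using \<omega> by (simp add: abs_le_square_iff[symmetric])
      qed
      have "\<bar>\<Sum>i<m. D i * (x i * x i)\<bar> \<le> (\<Sum>i<m. \<bar>D i * (x i * x i)\<bar>)" by (rule sum_abs)
      also have "\<dots> \<le> (\<Sum>i<m. \<omega> * (x i * x i))"
        by (intro sum_mono) (use \<omega>(2) in \<open>auto simp: abs_mult intro!: mult_mono Di\<close>)
      finally show ?thesis by (simp add: ip_def sum_distrib_left)
    qed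
    \<comment> \<open>Entries within omega / m give a Frobenius distance of at most omega over the
      m^2 positions.\<close>
    have BM: "\<bar>ip m x (mv m B x) - ip m x (mv m M x)\<bar> \<le> \<omega> * ip m x x"
    proof -
      have "ip m x (mv m B x) - ip m x (mv m M x) = (\<Sum>i<m. \<Sum>j<m. x i * x j * (B i j - M i j))"
        by (simp add: ip_def mv_def sum_distrib_left sum_subtractf algebra_simps)
      moreover have "\<bar>\<Sum>i<m. \<Sum>j<m. x i * x j * (B i j - M i j)\<bar> \<le> (\<omega>) * (\<Sum>i<m. (x i)\<^sup>2)"
      proof (rule bilinear_frobenius_bound)
        have "(B i j - M i j)\<^sup>2 \<le> (\<omega> / m)\<^sup>2" if "i < m" "j < m" for i j
        proof -
          have "\<bar>B i j - M i j\<bar>\<^sup>2 \<le> (\<omega> / m)\<^sup>2"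
            using B[OF that] unfolding M_def lam_def[abs_def] by (intro power_mono) auto
          then show ?thesis by simp
        qed
        then have "(\<Sum>i<m. \<Sum>j<m. (B i j - M i j)\<^sup>2) \<le> (\<Sum>i<m. \<Sum>j<m. (\<omega> / m)\<^sup>2)"
          by (intro sum_mono) auto
        also have "\<dots> = \<omega>\<^sup>2" using m by (simp add: power_divide power2_eq_square)
        finally show "(\<Sum>i<m. \<Sum>j<m. (B i j - M i j)\<^sup>2) \<le> \<omega>\<^sup>2" .
      qed (use \<omega> in simp)
      ultimately show ?thesis by (simp add: ip_def power2_eq_square)
    qed
    show ?thesis using quadM diag BM g1[of x] by linarith
  qed
  have gram: "\<bar>\<Sum>k\<in>S. \<Sum>l\<in>S. a k * a l * (ip m (y k) (y l) - (if k = l then \<bar>lam k\<bar> else 0))\<bar> \<le> \<omega> / 1600 * (\<Sum>k\<in>S. (a k)\<^sup>2)" for a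
    using g2 \<omega>(2) by (intro bilinear_frobenius_bound) auto
  show ?thesis
  proof (rule top_eigenvalues_approx_of_sketch[OF k _ sp(2) _ zs(2,1) _ _ _ sp(1)])
    show "length evs = d" using eigenvalues_spectral_decomp(1)[OF A evs] .
    show "sorted_wrt (\<lambda>x y. \<bar>y\<bar> \<le> \<bar>x\<bar>) evs" using evs by (simp add: eigenvalues_by_magnitude_def)
    show "S = {k. k < d \<and> \<omega> / 800 < \<bar>evs ! k\<bar>}" by (simp add: S_def lam_def)
    show "\<bar>\<Sum>k\<in>S. \<Sum>l\<in>S. a k * a l * (ip m (y k) (y l) - (if k = l then \<bar>evs ! k\<bar> else 0))\<bar> \<le> \<omega> / 1600 * (\<Sum>k\<in>S. (a k)\<^sup>2)" for a
      using gram[of a] unfolding lam_def .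
    show "\<bar>ip m x (mv m B x) - (\<Sum>k\<in>S. sgn (evs ! k) * (ip m (y k) x)\<^sup>2)\<bar> \<le> (3 * \<omega>) * ip m x x" for x
      using res[of x] by (simp add: lam_def)
    show "3 * (5 * \<omega>) \<le> \<epsilon> * frobenius_norm A" using \<omega> by simp
  qed (use \<omega>(2) in auto)
qed

section \<open>The algorithm\<close>

text \<open>The pair (i, j) of rows is query number i m + j, and entry l of row i is the seed
  coordinate i d + l.\<close>

definition sketch_query :: "nat \<Rightarrow> nat \<Rightarrow> seed \<Rightarrow> nat \<Rightarrow> query" where
  "sketch_query m d s q =
     (Matrix.vec d (\<lambda>l. s ((q div m) * d + l)), Matrix.vec d (\<lambda>l. s ((q mod m) * d + l)))"

definition sketch_entry :: "nat \<Rightarrow> answers \<Rightarrow> nat \<Rightarrow> nat \<Rightarrow> real" where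
  "sketch_entry m a = off_diag m (\<lambda>i j. a (i * m + j))"

text \<open>The sketch is rounded to integer multiples of this mesh, so that the output is a measurable
  function although eigenvalues are selected by choice.\<close>

definition mesh :: "nat \<Rightarrow> nat \<Rightarrow> real \<Rightarrow> answers \<Rightarrow> real" where
  "mesh m d \<epsilon> a = \<epsilon> / (20 * d) * (\<Sum>i<m. \<Sum>j<m. \<bar>sketch_entry m a i j\<bar>) / (real m)\<^sup>2"

text \<open>Integer lists form a countable type, so every function of the rounded sketch is
  measurable. If all entries vanish, the mesh is 0 and division by it yields 0, which is the right
  value.\<close>

definition rounded_sketch :: "nat \<Rightarrow> nat \<Rightarrow> real \<Rightarrow> answers \<Rightarrow> int list" where
  "rounded_sketch m d \<epsilon> a = map (\<lambda>q. floor (sketch_entry m a (q div m) (q mod m) / mesh m d \<epsilon> a)) [0..<m * m]"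

definition padded_spectrum :: "nat \<Rightarrow> nat \<Rightarrow> (nat \<Rightarrow> nat \<Rightarrow> real) \<Rightarrow> real list \<Rightarrow> bool" where
  "padded_spectrum m d B zs \<longleftrightarrow> sorted_wrt (\<lambda>x y. \<bar>y\<bar> \<le> \<bar>x\<bar>) zs \<and>
     (\<exists>mus w. length mus = m \<and> mset zs = mset (mus @ replicate d 0) \<and> spectral_decomp m B (\<lambda>j. mus ! j) w)"

definition sketch_output :: "nat \<Rightarrow> nat \<Rightarrow> nat \<Rightarrow> real \<Rightarrow> seed \<times> answers \<Rightarrow> nat \<Rightarrow> real" where
  "sketch_output m d k \<epsilon> sa = (let a = snd sa; l = rounded_sketch m d \<epsilon> a in
     (\<lambda>i\<in>{..<k}. mesh m d \<epsilon> a * (SOME zs. padded_spectrum m d (\<lambda>i j. real_of_int (l ! (i * m + j))) zs) ! i))"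

text \<open>Seeds are arbitrary real sequences with the Borel sigma-algebra, so the uniform
  distribution on finitely many sign vectors is pushed forward to it.\<close>

definition sign_seeds :: "nat \<Rightarrow> seed measure" where
  "sign_seeds n = distr (measure_pmf (pmf_of_set (PiE {..<n} (\<lambda>_. {-1, 1})))) borel (\<lambda>s. s)"

lemma padded_spectrum_exists:
  assumes "\<And>i j. i < m \<Longrightarrow> j < m \<Longrightarrow> B i j = B j i"
  shows "\<exists>zs. padded_spectrum m d B zs"
proof -
  obtain \<mu> w where sp: "spectral_decomp m B \<mu> w" using spectral_theorem[of m B] assms by blast
  define mus where "mus = map \<mu> [0..<m]"
  define zs where "zs = rev (sort_key abs (mus @ replicate d 0))"
  have "spectral_decomp m B (\<lambda>j. mus ! j) w"
    using sp by (simp add: spectral_decomp_def mus_def)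
  moreover have "sorted_wrt (\<lambda>x y. \<bar>y\<bar> \<le> \<bar>x\<bar>) zs"
    using sorted_sort_key[of abs "mus @ replicate d 0"] by (simp add: zs_def sorted_wrt_rev sorted_wrt_map)
  moreover have "mset zs = mset (mus @ replicate d 0)" "length mus = m" by (auto simp: zs_def mus_def)
  ultimately show ?thesis unfolding padded_spectrum_def by blast
qed

text \<open>The algorithm selects a spectrum of the integer matrix and multiplies by the mesh
  afterwards; the result is a spectrum of the scaled matrix, which is the one close to the
  sketch.\<close>

lemma padded_spectrum_scale:
  assumes "padded_spectrum m d B zs" "0 \<le> c"
  shows "padded_spectrum m d (\<lambda>i j. c * B i j) (map ((*) c) zs)"
proof -
  obtain mus w where 1: "sorted_wrt (\<lambda>x y. \<bar>y\<bar> \<le> \<bar>x\<bar>) zs" "length mus = m"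
    "mset zs = mset (mus @ replicate d 0)" "spectral_decomp m B (\<lambda>j. mus ! j) w"
    using assms(1) by (auto simp: padded_spectrum_def)
  have "sorted_wrt (\<lambda>x y. \<bar>y\<bar> \<le> \<bar>x\<bar>) (map ((*) c) zs)"
    unfolding sorted_wrt_map by (rule sorted_wrt_mono_rel[OF _ 1(1)]) (auto simp: abs_mult intro: mult_left_mono)
  moreover have "mset (map ((*) c) zs) = mset (map ((*) c) mus @ replicate d 0)"
    using arg_cong[OF 1(3), of "image_mset ((*) c)"] by simp
  moreover have "spectral_decomp m (\<lambda>i j. c * B i j) (\<lambda>j. map ((*) c) mus ! j) w"
    using 1(2,4) by (simp add: spectral_decomp_def sum_distrib_left mult.assoc)
  ultimately show ?thesis using 1(2) unfolding padded_spectrum_def by (metis length_map)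
qed

lemma rad_reindex_rows:
  fixes m d :: nat
  assumes d: "0 < d"
  shows "rad {..<m * d} (\<lambda>s. F (\<lambda>(i, l)\<in>{..<m} \<times> {..<d}. s (i * d + l))) = rad ({..<m} \<times> {..<d}) F"
proof -
  let ?K = "{..<m} \<times> {..<d}"
  let ?S = "PiE {..<m * d} (\<lambda>_. {-1, 1 :: real})" and ?S' = "PiE ?K (\<lambda>_. {-1, 1 :: real})"
  define \<phi> where "\<phi> s = (\<lambda>(i, l)\<in>?K. s (i * d + l))" for s :: "nat \<Rightarrow> real"
  define \<psi> where "\<psi> s = (\<lambda>n\<in>{..<m * d}. s (n div d, n mod d))" for s :: "nat \<times> nat \<Rightarrow> real"
  have idx: "i * d + l < m * d" if "i < m" "l < d" for i l
  proof -
    have "i * d + l < Suc i * d" using that by simp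
    also have "\<dots> \<le> m * d" using that by (intro mult_le_mono1) simp
    finally show ?thesis .
  qed
  have dm: "n div d < m" "n mod d < d" if "n < m * d" for n
    using that d by (auto simp: less_mult_imp_div_less)
  have "bij_betw \<phi> ?S ?S'"
  proof (rule bij_betwI[where g = \<psi>])
    show "\<phi> \<in> ?S \<rightarrow> ?S'"
    proof
      fix s assume s: "s \<in> ?S"
      show "\<phi> s \<in> ?S'"
      proof (rule PiE_I)
        fix x assume "x \<in> ?K"
        then show "\<phi> s x \<in> {-1, 1}" using PiE_mem[OF s, of "fst x * d + snd x"] idx by (auto simp: \<phi>_def)
      next
        fix x assume "x \<notin> ?K"
        then show "\<phi> s x = undefined" by (simp add: \<phi>_def)
      qed
    qed
    show "\<psi> \<in> ?S' \<rightarrow> ?S"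
    proof
      fix s assume s: "s \<in> ?S'"
      show "\<psi> s \<in> ?S"
      proof (rule PiE_I)
        fix x assume "x \<in> {..<m * d}"
        then show "\<psi> s x \<in> {-1, 1}" using PiE_mem[OF s, of "(x div d, x mod d)"] dm by (auto simp: \<psi>_def)
      qed (simp add: \<psi>_def)
    qed
    show "\<psi> (\<phi> s) = s" if "s \<in> ?S" for s
    proof (rule ext)
      fix n
      show "\<psi> (\<phi> s) n = s n"
        using that dm[of n] PiE_arb[OF that, of n] by (cases "n < m * d") (auto simp: \<phi>_def \<psi>_def)
    qed
    show "\<phi> (\<psi> s) = s" if "s \<in> ?S'" for s
    proof (rule ext)
      fix x
      show "\<phi> (\<psi> s) x = s x"
        using idx[of "fst x" "snd x"] PiE_arb[OF that, of x] d by (cases "x \<in> ?K") (auto simp: \<phi>_def \<psi>_def)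
    qed
  qed
  then have "(\<Sum>s\<in>?S. F (\<phi> s)) = (\<Sum>s\<in>?S'. F s)" by (rule sum.reindex_bij_betw)
  then show ?thesis by (simp add: rad_def \<phi>_def card_cartesian_product)
qed

section \<open>Probability and measurability\<close>

lemma seed_measure_sign_seeds: "seed_measure (sign_seeds n)"
  unfolding seed_measure_def sign_seeds_def
  by (auto intro!: prob_space.prob_space_distr prob_space_measure_pmf)

lemma measure_sign_seeds:
  assumes "E \<in> sets borel"
  shows "measure (sign_seeds n) E = rad {..<n} (\<lambda>s. of_bool (s \<in> E))"
proof -
  let ?S = "PiE {..<n} (\<lambda>_. {-1, 1 :: real})"
  have fin: "finite ?S" "?S \<noteq> {}" by (auto simp: finite_signs PiE_eq_empty_iff)
  have "measure (sign_seeds n) E = measure (measure_pmf (pmf_of_set ?S)) E"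
    unfolding sign_seeds_def using assms by (subst measure_distr) auto
  also have "\<dots> = real (card (?S \<inter> E)) / real (card ?S)"
    using fin by (simp add: measure_pmf_of_set)
  also have "real (card (?S \<inter> E)) = (\<Sum>s\<in>?S. of_bool (s \<in> E))"
    using fin by (simp add: of_bool_def sum.If_cases Int_def)
  finally show ?thesis by (simp add: rad_def card_signs)
qed

lemma measurable_seed_coordinate [measurable]: "(\<lambda>s :: seed. s n) \<in> borel_measurable borel"
  by (intro borel_measurable_continuous_onI continuous_on_product_coordinates)

lemma sketch_query_batch:
  assumes "sets M = sets borel"
  shows "query_batch d n M (sketch_query m d)"
  unfolding query_batch_def sketch_query_def
  by (auto simp: measurable_cong_sets[OF assms refl])

lemma measurable_sketch_output:
  "sketch_output m d k \<epsilon> \<in> measurable (M \<Otimes>\<^sub>M answer_space (m * m)) (\<Pi>\<^sub>M i\<in>{..<k}. borel)"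
proof -
  let ?N = "answer_space (m * m)"
  have idx: "i * m + j < m * m" if "i < m" "j < m" for i j
  proof -
    have "i * m + j < Suc i * m" using that by simp
    also have "\<dots> \<le> m * m" using that by (intro mult_le_mono1) simp
    finally show ?thesis .
  qed
  have entry: "(\<lambda>a. sketch_entry m a i j) \<in> borel_measurable ?N" if "i < m" "j < m" for i j
  proof (cases "i = j")
    case False
    have "(\<lambda>a. a (i * m + j)) \<in> borel_measurable ?N"
      unfolding answer_space_def using idx[OF that] by (intro measurable_component_singleton) auto
    then show ?thesis using False by (simp add: sketch_entry_def off_diag_def)
  qed (simp add: sketch_entry_def off_diag_def)
  have mesh: "mesh m d \<epsilon> \<in> borel_measurable ?N"
    unfolding mesh_def[abs_def]
    by (intro borel_measurable_divide borel_measurable_times borel_measurable_const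
        borel_measurable_sum borel_measurable_abs entry) auto
  have round: "rounded_sketch m d \<epsilon> \<in> measurable ?N (count_space UNIV)"
  \<comment> \<open>In a countable target only preimages of single lists matter, and such a preimage
    is a finite conjunction of conditions on the entries.\<close>
  proof (rule measurable_count_space_eq2_countable[THEN iffD2], intro conjI ballI)
    fix l :: "int list"
    have "rounded_sketch m d \<epsilon> -` {l} \<inter> space ?N = {a \<in> space ?N. length l = m * m \<and>
       (\<forall>q\<in>{..<m * m}. floor (sketch_entry m a (q div m) (q mod m) / mesh m d \<epsilon> a) = l ! q)}"
      by (auto simp: rounded_sketch_def list_eq_iff_nth_eq)
    also have "\<dots> \<in> sets ?N"
    proof -
      have [measurable]: "(\<lambda>a. floor (sketch_entry m a (q div m) (q mod m) / mesh m d \<epsilon> a)) \<in> measurable ?N (count_space UNIV)"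
        if "q \<in> {..<m * m}" for q
      proof -
        have "0 < m" using that by (cases m) auto
        then have "q div m < m" "q mod m < m" using that by (auto simp: less_mult_imp_div_less)
        from entry[OF this] mesh show ?thesis by measurable
      qed
      show ?thesis by measurable
    qed
    finally show "rounded_sketch m d \<epsilon> -` {l} \<inter> space ?N \<in> sets ?N" .
  qed auto
  have out: "(\<lambda>a. mesh m d \<epsilon> a * (SOME zs. padded_spectrum m d (\<lambda>i j. real_of_int (rounded_sketch m d \<epsilon> a ! (i * m + j))) zs) ! i) \<in> borel_measurable ?N" for i
  proof -
    have "(\<lambda>a. (\<lambda>l. (SOME zs. padded_spectrum m d (\<lambda>i j. real_of_int (l ! (i * m + j))) zs) ! i) (rounded_sketch m d \<epsilon> a)) \<in> borel_measurable ?N"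
      by (rule measurable_compose[OF round]) simp
    with mesh show ?thesis by (intro borel_measurable_times) auto
  qed
  show ?thesis
    unfolding sketch_output_def[abs_def] Let_def
    by (intro measurable_restrict measurable_compose[OF measurable_snd out])
qed

text \<open>On a non-measurable event \<open>measure\<close> would take its default value 0. The
  quantifier over permutations is harmless since there are finitely many.\<close>

lemma measurable_top_eigenvalues_approx:
  assumes "\<And>i. i < k \<Longrightarrow> (\<lambda>s. f s i) \<in> borel_measurable M"
  shows "{s \<in> space M. top_eigenvalues_approx d k \<epsilon> A evs (f s)} \<in> sets M"
proof -
  have eq: "top_eigenvalues_approx d k \<epsilon> A evs (f s) \<longleftrightarrow>
    (\<exists>\<sigma>\<in>{\<sigma>. \<sigma> permutes {..<k}}. \<forall>i\<in>{..<k}. \<bar>evs ! i\<bar> \<ge> \<bar>evs ! (k - 1)\<bar> + 2 * \<epsilon> * frobenius_norm A \<longrightarrow>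
               \<bar>f s (\<sigma> i) - evs ! i\<bar> \<le> \<epsilon> * frobenius_norm A) \<and>
     (\<forall>i\<in>{..<k}. \<exists>j\<in>{..<d}. \<bar>evs ! j\<bar> \<ge> \<bar>evs ! (k - 1)\<bar> - \<epsilon> * frobenius_norm A \<and>
                  \<bar>f s i - evs ! j\<bar> \<le> \<epsilon> * frobenius_norm A)" for s
    unfolding top_eigenvalues_approx_def by auto
  have atom: "{s \<in> space M. \<bar>f s i - c\<bar> \<le> e} \<in> sets M" if "i \<in> {..<k}" for i c e
  proof -
    have [measurable]: "(\<lambda>s. f s i) \<in> borel_measurable M" using assms that by auto
    show ?thesis by measurable
  qed
  have "\<sigma> i \<in> {..<k}" if "\<sigma> \<in> {\<sigma>. \<sigma> permutes {..<k}}" "i \<in> {..<k}" for \<sigma> i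
    using permutes_in_image that by fastforce
  then show ?thesis unfolding eq
    by (intro sets.sets_Collect_conj sets.sets_Collect_finite_Ex sets.sets_Collect_countable_All' countable_finite
        sets.sets_Collect_imp sets.sets_Collect_const atom finite_permutations finite_lessThan) auto
qed

lemma top_eigenvalues_approx_cong:
  assumes "\<And>i. i < k \<Longrightarrow> f i = g i" "top_eigenvalues_approx d k \<epsilon> A evs f"
  shows "top_eigenvalues_approx d k \<epsilon> A evs g"
proof -
  obtain \<sigma> where \<sigma>: "\<sigma> permutes {..<k}"
    "\<forall>i<k. \<bar>evs ! i\<bar> \<ge> \<bar>evs ! (k - 1)\<bar> + 2 * \<epsilon> * frobenius_norm A \<longrightarrow> \<bar>f (\<sigma> i) - evs ! i\<bar> \<le> \<epsilon> * frobenius_norm A"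
    using assms(2) unfolding top_eigenvalues_approx_def by blast
  have "\<sigma> i < k" if "i < k" for i using permutes_in_image[OF \<sigma>(1)] that by simp
  then show ?thesis
    using assms \<sigma> unfolding top_eigenvalues_approx_def by (intro conjI exI[of _ \<sigma>]) auto
qed

lemma flat_index:
  fixes i j m n :: nat
  assumes "i < m" "j < n"
  shows "i * n + j < m * n" "(i * n + j) div n = i" "(i * n + j) mod n = j"
proof -
  have "i * n + j < Suc i * n" using assms by simp
  also have "\<dots> \<le> m * n" using assms by (intro mult_le_mono1) simp
  finally show "i * n + j < m * n" .
qed (use assms in auto)

lemma batch_answers_sketch_query:
  fixes i j m :: nat
  assumes A: "A \<in> symmetric_mats d" and sp: "spectral_decomp d (\<lambda>i j. A $$ (i, j)) lam u"
    and ij: "i < m" "j < m"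
  shows "batch_answers A (m * m) (sketch_query m d s) (i * m + j) =
     sketch_form d u {..<d} lam (\<lambda>(i, l)\<in>{..<m} \<times> {..<d}. s (i * d + l)) i j"
proof -
  let ?s = "\<lambda>(i, l)\<in>{..<m} \<times> {..<d}. s (i * d + l)"
  have c: "A \<in> carrier_mat d d" using A by (simp add: symmetric_mats_def)
  have "batch_answers A (m * m) (sketch_query m d s) (i * m + j) =
     Matrix.vec d (\<lambda>l. s (i * d + l)) \<bullet> (A *\<^sub>v Matrix.vec d (\<lambda>l. s (j * d + l)))"
    using flat_index[OF ij] by (simp add: batch_answers_def query_answer_def sketch_query_def)
  also have "\<dots> = ip d (\<lambda>l. s (i * d + l)) (mv d (\<lambda>i j. A $$ (i, j)) (\<lambda>l. s (j * d + l)))"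
    using c by (simp add: scalar_prod_def ip_def mv_def lessThan_atLeast0)
  also have "\<dots> = (\<Sum>k<d. lam k * ip d (u k) (\<lambda>l. s (i * d + l)) * ip d (u k) (\<lambda>l. s (j * d + l)))"
    by (intro quadratic_rank_one_sum spectral_decomp_entry[OF sp])
  also have "\<dots> = sketch_form d u {..<d} lam ?s i j"
  proof -
    have "proj d u ?s k i = ip d (u k) (\<lambda>l. s (i * d + l))" if "i < m" for k i
      unfolding proj_def ip_def using that by (intro sum.cong refl) auto
    then show ?thesis using ij by (simp add: sketch_form_def)
  qed
  finally show ?thesis .
qed

text \<open>Sign vectors reduce the answer to the sum of all |A_ij|, and Cauchy-Schwarz over the d^2
  positions gives the factor d. This is what relates the mesh, computed from the answers, to the
  unknown |A|_F.\<close>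

lemma abs_batch_answers_le:
  fixes i j m :: nat
  assumes A: "A \<in> symmetric_mats d" and s: "s \<in> PiE {..<m * d} (\<lambda>_. {-1, 1})"
    and ij: "i < m" "j < m"
  shows "\<bar>batch_answers A (m * m) (sketch_query m d s) (i * m + j)\<bar> \<le> d * frobenius_norm A"
proof -
  have c: "A \<in> carrier_mat d d" using A by (simp add: symmetric_mats_def)
  have s1: "\<bar>s (i * d + l)\<bar> = 1" if "i < m" "l < d" for i l
    using PiE_mem[OF s, of "i * d + l"] flat_index(1)[OF that] by auto
  have "batch_answers A (m * m) (sketch_query m d s) (i * m + j) =
     (\<Sum>l<d. \<Sum>l'<d. s (i * d + l) * (A $$ (l, l') * s (j * d + l')))"
    using flat_index[OF ij] c
    by (simp add: batch_answers_def query_answer_def sketch_query_def scalar_prod_def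
        lessThan_atLeast0 sum_distrib_left)
  also have "\<bar>\<dots>\<bar> \<le> (\<Sum>l<d. \<Sum>l'<d. \<bar>s (i * d + l) * (A $$ (l, l') * s (j * d + l'))\<bar>)"
    by (intro order_trans[OF sum_abs] sum_mono sum_abs)
  also have "\<dots> = (\<Sum>l<d. \<Sum>l'<d. \<bar>A $$ (l, l')\<bar>)"
    using ij by (intro sum.cong refl) (simp add: abs_mult s1)
  also have "\<dots> \<le> d * frobenius_norm A"
  proof (rule power2_le_imp_le)
    have "(\<Sum>l<d. \<Sum>l'<d. \<bar>A $$ (l, l')\<bar>)\<^sup>2 = (\<Sum>z\<in>{..<d} \<times> {..<d}. \<bar>A $$ z\<bar>)\<^sup>2"
      by (simp add: sum.cartesian_product case_prod_unfold)
    also have "\<dots> \<le> (real d)\<^sup>2 * (\<Sum>z\<in>{..<d} \<times> {..<d}. \<bar>A $$ z\<bar>\<^sup>2)"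
      using Cauchy_Schwarz_ineq_sum[of "\<lambda>_. 1" "\<lambda>z. \<bar>A $$ z\<bar>" "{..<d} \<times> {..<d}"]
      by (simp add: power2_eq_square[of "real d"])
    also have "(\<Sum>z\<in>{..<d} \<times> {..<d}. \<bar>A $$ z\<bar>\<^sup>2) = (frobenius_norm A)\<^sup>2"
    proof -
      have "(frobenius_norm A)\<^sup>2 = (\<Sum>i<d. \<Sum>j<d. (A $$ (i, j))\<^sup>2)"
        using c by (auto simp: frobenius_norm_def intro!: real_sqrt_pow2 sum_nonneg)
      then show ?thesis by (simp add: sum.cartesian_product case_prod_unfold)
    qed
    finally show "(\<Sum>l<d. \<Sum>l'<d. \<bar>A $$ (l, l')\<bar>)\<^sup>2 \<le> (d * frobenius_norm A)\<^sup>2"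
      by (simp add: power_mult_distrib)
    show "0 \<le> d * frobenius_norm A" by (simp add: frobenius_norm_def sum_nonneg)
  qed
  finally show ?thesis .
qed

lemma sketch_output_success:
  assumes A: "A \<in> symmetric_mats d" and evs: "eigenvalues_by_magnitude A evs"
    and u: "spectral_decomp d (\<lambda>i j. A $$ (i, j)) (\<lambda>k. evs ! k) u"
    and k: "1 \<le> k" "k \<le> d" and m: "0 < m" and eps: "0 < \<epsilon>" and frob: "0 < frobenius_norm A"
    and s: "s \<in> PiE {..<m * d} (\<lambda>_. {-1, 1})"
    and good: "good_signs m d u (\<lambda>k. evs ! k) (\<epsilon> * frobenius_norm A / 20) (\<lambda>(i, l)\<in>{..<m} \<times> {..<d}. s (i * d + l))"
  shows "top_eigenvalues_approx d k \<epsilon> A evs (sketch_output m d k \<epsilon> (s, batch_answers A (m * m) (sketch_query m d s)))"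
proof -
  let ?s = "\<lambda>(i, l)\<in>{..<m} \<times> {..<d}. s (i * d + l)"
  define a where "a = batch_answers A (m * m) (sketch_query m d s)"
  define \<omega> where "\<omega> = \<epsilon> * frobenius_norm A / 20"
  define M where "M = off_diag m (sketch_form d u {..<d} (\<lambda>k. evs ! k) ?s)"
  define h where "h = mesh m d \<epsilon> a"
  define Z where "Z i j = real_of_int (rounded_sketch m d \<epsilon> a ! (i * m + j))" for i j
  define zs where "zs = (SOME zs. padded_spectrum m d Z zs)"
  have w: "0 < \<omega>" using eps frob by (simp add: \<omega>_def)
  have d: "0 < d" using k by simp
  have entry: "sketch_entry m a i j = M i j" if "i < m" "j < m" for i j
    using batch_answers_sketch_query[OF A u that] by (simp add: sketch_entry_def M_def off_diag_def a_def)
  have sym: "M i j = M j i" for i j by (simp add: M_def off_diag_def sketch_form_def mult_ac)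
  have Z: "Z i j = real_of_int \<lfloor>M i j / h\<rfloor>" if "i < m" "j < m" for i j
    using flat_index[OF that] entry[OF that] by (simp add: Z_def rounded_sketch_def h_def)
  have absM: "\<bar>M i j\<bar> \<le> d * frobenius_norm A / m" if "i < m" "j < m" for i j
  proof -
    have "M i j = (if i = j then 0 else a (i * m + j) / m)"
      unfolding entry[OF that, symmetric] by (simp add: sketch_entry_def off_diag_def)
    then show ?thesis
      using abs_batch_answers_le[OF A s that] frob by (simp add: a_def abs_divide divide_right_mono)
  qed
  have sumM: "(\<Sum>i<m. \<Sum>j<m. \<bar>sketch_entry m a i j\<bar>) = (\<Sum>i<m. \<Sum>j<m. \<bar>M i j\<bar>)"
    by (intro sum.cong refl) (simp add: entry)
  have h0: "0 \<le> h" unfolding h_def mesh_def using eps by (intro divide_nonneg_nonneg mult_nonneg_nonneg sum_nonneg) auto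
  \<comment> \<open>The mesh is eps / (20 d) times the mean absolute entry of the sketch, and each
    entry is at most d |A|_F / m.\<close>
  have hle: "h \<le> \<omega> / m"
  proof -
    have "(\<Sum>i<m. \<Sum>j<m. \<bar>M i j\<bar>) \<le> (\<Sum>i<m. \<Sum>j<m. d * frobenius_norm A / m)"
      by (intro sum_mono absM) auto
    also have "\<dots> = m * (d * frobenius_norm A)" using m by simp
    finally have "h \<le> \<epsilon> / (20 * d) * (m * (d * frobenius_norm A)) / (real m)\<^sup>2"
      unfolding h_def mesh_def sumM using eps by (intro divide_right_mono mult_left_mono) auto
    also have "\<dots> = \<omega> / m" using m d by (simp add: \<omega>_def power2_eq_square)
    finally show ?thesis .
  qed
  have close: "\<bar>h * Z i j - M i j\<bar> \<le> \<omega> / m" if ij: "i < m" "j < m" for i j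
  proof -
    have "\<bar>h * Z i j - M i j\<bar> \<le> h"
    proof (cases "h = 0")
      \<comment> \<open>A zero mesh occurs only when all entries vanish, and then rounding is
        exact.\<close>
      case True
      then have "(\<Sum>i<m. \<Sum>j<m. \<bar>M i j\<bar>) = 0" using eps d m by (simp add: h_def mesh_def sumM)
      then have "M i j = 0" using ij by (simp add: sum_nonneg_eq_0_iff sum_nonneg)
      then show ?thesis using True by simp
    next
      case False
      then have h: "0 < h" using h0 by simp
      have "M i j / h - 1 < Z i j" "Z i j \<le> M i j / h" unfolding Z[OF ij] by linarith+
      then have "M i j - h < h * Z i j" "h * Z i j \<le> M i j" using h by (auto simp: field_simps)
      then show ?thesis by linarith
    qed
    then show ?thesis using hle by linarith
  qed
  have symZ: "Z i j = Z j i" if "i < m" "j < m" for i j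
    unfolding Z[OF that] Z[OF that(2,1)] sym[of i j] ..
  have "padded_spectrum m d Z zs"
    unfolding zs_def by (rule someI_ex[OF padded_spectrum_exists[OF symZ]])
  from padded_spectrum_scale[OF this h0]
  obtain mus w where sp: "sorted_wrt (\<lambda>x y. \<bar>y\<bar> \<le> \<bar>x\<bar>) (map ((*) h) zs)" "length mus = m"
    "mset (map ((*) h) zs) = mset (mus @ replicate d 0)" "spectral_decomp m (\<lambda>i j. h * Z i j) (\<lambda>j. mus ! j) w"
    unfolding padded_spectrum_def by blast
  have "top_eigenvalues_approx d k \<epsilon> A evs (\<lambda>i. map ((*) h) zs ! i)"
    using sketch_success[OF A evs u k m \<omega>_def w good[folded \<omega>_def] close[unfolded M_def] sp(4,2,3,1)] by simp
  moreover have "length zs = m + d" using mset_eq_length[OF sp(3)] sp(2) by simp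
  ultimately show ?thesis
    using k by (elim top_eigenvalues_approx_cong[rotated])
      (simp add: sketch_output_def Let_def a_def[symmetric] h_def zs_def Z_def[abs_def])
qed

text \<open>With |A|_F = 0 the scale omega degenerates. All answers are then 0, hence so are the
  mesh and every output, as are all eigenvalues.\<close>

lemma sketch_output_success_zero:
  assumes A: "A \<in> symmetric_mats d" and evs: "eigenvalues_by_magnitude A evs"
    and k: "1 \<le> k" "k \<le> d" and frob: "frobenius_norm A = 0"
    and s: "s \<in> PiE {..<m * d} (\<lambda>_. {-1, 1})"
  shows "top_eigenvalues_approx d k \<epsilon> A evs (sketch_output m d k \<epsilon> (s, batch_answers A (m * m) (sketch_query m d s)))"
proof -
  obtain u where u: "spectral_decomp d (\<lambda>i j. A $$ (i, j)) (\<lambda>k. evs ! k) u"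
    using eigenvalues_spectral_decomp(2)[OF A evs] by blast
  have ev0: "evs ! i = 0" if "i < d" for i
    using frobenius_norm_spectral[OF A u] frob that by (simp add: sum_nonneg_eq_0_iff)
  define a where "a = batch_answers A (m * m) (sketch_query m d s)"
  have "sketch_entry m a i j = 0" if "i < m" "j < m" for i j
    using abs_batch_answers_le[OF A s that] frob by (simp add: sketch_entry_def off_diag_def a_def)
  then have "mesh m d \<epsilon> a = 0" by (simp add: mesh_def)
  then have "sketch_output m d k \<epsilon> (s, a) i = 0" if "i < k" for i
    using that by (simp add: sketch_output_def Let_def)
  then show ?thesis
    unfolding top_eigenvalues_approx_def a_def[symmetric] using ev0 k frob
    by (auto intro!: exI[of _ id] exI[of _ 0] simp: permutes_id)
qed

lemma approximates_sketch:
  assumes k: "1 \<le> k" "k \<le> d" and eps: "0 < \<epsilon>" "\<epsilon> < 1" and m: "2 * 10 ^ 22 / \<epsilon> ^ 4 \<le> real m"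
  shows "approximates_top_eigenvalues d k \<epsilon> (sign_seeds (m * d))
    (\<lambda>A. nonadaptive_output A (m * m) (sketch_query m d) (sketch_output m d k \<epsilon>))"
  unfolding approximates_top_eigenvalues_def
proof (intro ballI allI impI)
  fix A evs assume A: "A \<in> symmetric_mats d" and evs: "eigenvalues_by_magnitude A evs"
  define O' where "O' s = sketch_output m d k \<epsilon> (s, batch_answers A (m * m) (sketch_query m d s))" for s
  let ?M = "sign_seeds (m * d)"
  have "0 < 2 * 10 ^ 22 / \<epsilon> ^ 4" using eps by simp
  then have m0: "0 < m" using m by (cases m) auto
  have d: "0 < d" using k by simp
  have sets: "sets ?M = sets borel" by (simp add: sign_seeds_def)
  have space: "space ?M = UNIV" by (simp add: sign_seeds_def)
  have c: "A \<in> carrier_mat d d" using A by (simp add: symmetric_mats_def)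
  have "(\<lambda>s. batch_answers A (m * m) (sketch_query m d s)) \<in> measurable borel (answer_space (m * m))"
    unfolding answer_space_def batch_answers_def
  proof (rule measurable_restrict)
    fix q
    have "(\<lambda>s. query_answer A (sketch_query m d s q)) = (\<lambda>s. \<Sum>l\<in>{0..<d}. s ((q div m) * d + l) * (\<Sum>l'\<in>{0..<d}. A $$ (l, l') * s ((q mod m) * d + l')))"
      using c by (simp add: query_answer_def sketch_query_def scalar_prod_def fun_eq_iff)
    then show "(\<lambda>s. query_answer A (sketch_query m d s q)) \<in> borel_measurable borel"
      by (simp add: borel_measurable_sum borel_measurable_times measurable_seed_coordinate)
  qed
  then have "(\<lambda>s. (s, batch_answers A (m * m) (sketch_query m d s))) \<in> measurable borel (borel \<Otimes>\<^sub>M answer_space (m * m))"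
    by (intro measurable_Pair) auto
  from measurable_compose[OF this measurable_sketch_output]
  have O': "O' \<in> measurable borel (\<Pi>\<^sub>M i\<in>{..<k}. borel)" by (simp add: O'_def[abs_def])
  have "(\<lambda>s. O' s i) \<in> borel_measurable borel" if "i < k" for i
    by (rule measurable_compose[OF O' measurable_component_singleton]) (use that in simp)
  from measurable_top_eigenvalues_approx[OF this]
  have E: "{s. top_eigenvalues_approx d k \<epsilon> A evs (O' s)} \<in> sets borel" by simp
  obtain u where u: "spectral_decomp d (\<lambda>i j. A $$ (i, j)) (\<lambda>k. evs ! k) u"
    using eigenvalues_spectral_decomp(2)[OF A evs] by blast
  have "9 / 10 \<le> rad {..<m * d} (\<lambda>s. of_bool (s \<in> {s. top_eigenvalues_approx d k \<epsilon> A evs (O' s)}))"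
  proof (cases "frobenius_norm A = 0")
    case True
    have "rad {..<m * d} (\<lambda>s. of_bool (s \<in> {s. top_eigenvalues_approx d k \<epsilon> A evs (O' s)})) = rad {..<m * d} (\<lambda>s. 1)"
      unfolding O'_def using sketch_output_success_zero[OF A evs k True] by (intro rad_cong) auto
    then show ?thesis by (simp add: rad_const)
  next
    case False
    then have frob: "0 < frobenius_norm A"
      by (simp add: frobenius_norm_def less_le sum_nonneg)
    let ?good = "good_signs m d u (\<lambda>k. evs ! k) (\<epsilon> * frobenius_norm A / 20)"
    have "9 / 10 \<le> rad ({..<m} \<times> {..<d}) (\<lambda>s. of_bool (?good s))"
      using spectral_decomp_orth[OF u] frobenius_norm_spectral[OF A u] frob eps m
      by (intro good_signs_probability) auto
    also have "\<dots> = rad {..<m * d} (\<lambda>s. of_bool (?good (\<lambda>(i, l)\<in>{..<m} \<times> {..<d}. s (i * d + l))))"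
      using rad_reindex_rows[OF d, of m "\<lambda>s. of_bool (?good s)"] by simp
    also have "\<dots> \<le> rad {..<m * d} (\<lambda>s. of_bool (s \<in> {s. top_eigenvalues_approx d k \<epsilon> A evs (O' s)}))"
      unfolding O'_def using sketch_output_success[OF A evs u k m0 eps(1) frob] by (intro rad_mono) auto
    finally show ?thesis .
  qed
  then show "9 / 10 \<le> measure ?M {s \<in> space ?M. top_eigenvalues_approx d k \<epsilon> A evs
      (nonadaptive_output A (m * m) (sketch_query m d) (sketch_output m d k \<epsilon>) s)}"
    using measure_sign_seeds[OF E, of "m * d"] by (simp add: space nonadaptive_output_def O'_def)
qed

theorem theorem40:
  "\<exists>C::real. C > 0 \<and>
     (\<forall>(k::nat) (d::nat) (\<epsilon>::real). 1 \<le> k \<and> k \<le> d \<and> 0 < \<epsilon> \<and> \<epsilon> < 1 \<longrightarrow>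
        (\<exists>m M q out.
            real m \<le> C * ((real k)\<^sup>2 / \<epsilon> ^ 12) * ln (real k + 1) \<and>
            nonadaptive_algorithm d k m M q out \<and>
            approximates_top_eigenvalues d k \<epsilon> M (\<lambda>A. nonadaptive_output A m q out)) \<and>
        (\<exists>m1 m2 M q1 q2 out.
            real (m1 + m2) \<le> C * ((real k)\<^sup>2 / \<epsilon> ^ 8) * ln (real k + 1) \<and>
            two_round_algorithm d k m1 m2 M q1 q2 out \<and>
            approximates_top_eigenvalues d k \<epsilon> M
              (\<lambda>A. two_round_output A m1 m2 q1 q2 out)))"
proof (intro exI[of _ "2 * 10 ^ 45 :: real"] conjI allI impI)
  fix k d :: nat and \<epsilon> :: real
  assume asm: "1 \<le> k \<and> k \<le> d \<and> 0 < \<epsilon> \<and> \<epsilon> < 1"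
  then have k: "1 \<le> k" "k \<le> d" and eps: "0 < \<epsilon>" "\<epsilon> < 1" by auto
  \<comment> \<open>The ceiling gives m <= 3 * 10^22 / eps^4, so m^2 <= 9 * 10^44 / eps^8. As k^2 ln
    (k + 1) is at least 1 / 2, the constant has to be at least twice 9 * 10^44.\<close>
  define m where "m = nat \<lceil>2 * 10 ^ 22 / \<epsilon> ^ 4\<rceil>"
  let ?M = "sign_seeds (m * d)" and ?q = "sketch_query m d" and ?out = "sketch_output m d k \<epsilon>"
  have m: "2 * 10 ^ 22 / \<epsilon> ^ 4 \<le> real m" by (simp add: m_def)
  have e4: "0 < \<epsilon> ^ 4" "\<epsilon> ^ 4 \<le> 1" using eps by (auto simp: power_le_one)
  have "real m \<le> 2 * 10 ^ 22 / \<epsilon> ^ 4 + 1"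
    using e4 by (simp add: m_def)
  also have "\<dots> \<le> 3 * 10 ^ 22 / \<epsilon> ^ 4" proof -
    have "1 \<le> 10 ^ 22 / \<epsilon> ^ 4" using e4 by (simp add: le_divide_eq)
    then show ?thesis by simp
  qed
  finally have "real m * real m \<le> (3 * 10 ^ 22 / \<epsilon> ^ 4) * (3 * 10 ^ 22 / \<epsilon> ^ 4)"
    using e4 by (intro mult_mono) auto
  also have "\<dots> = 9 * 10 ^ 44 / \<epsilon> ^ 8" by (simp flip: power_add)
  finally have mm: "real (m * m) \<le> 9 * 10 ^ 44 / \<epsilon> ^ 8" by simp
  have lnk: "1 / 2 \<le> (real k)\<^sup>2 * ln (real k + 1)"
  proof -
    have "1 / 2 \<le> ln (2 :: real)" using ln_le_minus_one[of "1 / 2 :: real"] by (simp add: ln_div)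
    also have "\<dots> \<le> ln (real k + 1)" using k by simp
    finally have "1 * (1 / 2) \<le> (real k)\<^sup>2 * ln (real k + 1)" using k by (intro mult_mono) auto
    then show ?thesis by simp
  qed
  have q8: "real (m * m) \<le> 2 * 10 ^ 45 * ((real k)\<^sup>2 / \<epsilon> ^ 8) * ln (real k + 1)"
  proof -
    have "9 * 10 ^ 44 \<le> 2 * 10 ^ 45 * ((real k)\<^sup>2 * ln (real k + 1))"
      using mult_left_mono[OF lnk, of "2 * 10 ^ 45"] by simp
    then have "9 * 10 ^ 44 / \<epsilon> ^ 8 \<le> 2 * 10 ^ 45 * ((real k)\<^sup>2 * ln (real k + 1)) / \<epsilon> ^ 8"
      using eps by (intro divide_right_mono) auto
    then show ?thesis using mm by simp
  qed
  have q12: "real (m * m) \<le> 2 * 10 ^ 45 * ((real k)\<^sup>2 / \<epsilon> ^ 12) * ln (real k + 1)"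
  proof -
    have "(real k)\<^sup>2 / \<epsilon> ^ 8 \<le> (real k)\<^sup>2 / \<epsilon> ^ 12"
      using eps by (intro divide_left_mono power_decreasing) auto
    then have "2 * 10 ^ 45 * ((real k)\<^sup>2 / \<epsilon> ^ 8) * ln (real k + 1) \<le> 2 * 10 ^ 45 * ((real k)\<^sup>2 / \<epsilon> ^ 12) * ln (real k + 1)"
      using k by (intro mult_right_mono mult_left_mono) auto
    then show ?thesis using q8 by linarith
  qed
  have batch: "query_batch d (m * m) ?M ?q"
    by (rule sketch_query_batch) (simp add: sign_seeds_def)
  have approx: "approximates_top_eigenvalues d k \<epsilon> ?M (\<lambda>A. nonadaptive_output A (m * m) ?q ?out)"
    using approximates_sketch[OF k eps m] .
  show "\<exists>m M q out. real m \<le> 2 * 10 ^ 45 * ((real k)\<^sup>2 / \<epsilon> ^ 12) * ln (real k + 1) \<and>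
      nonadaptive_algorithm d k m M q out \<and>
      approximates_top_eigenvalues d k \<epsilon> M (\<lambda>A. nonadaptive_output A m q out)"
    using q12 batch approx seed_measure_sign_seeds measurable_sketch_output
    unfolding nonadaptive_algorithm_def by blast
  \<comment> \<open>The two-round algorithm asks the same queries in its first batch and leaves the
    second batch empty, so the second query function takes a dummy value.\<close>
  define out2 where "out2 x = ?out (fst x)" for x :: "(seed \<times> answers) \<times> answers"
  have "two_round_algorithm d k (m * m) 0 ?M ?q (\<lambda>_ _. undefined) out2"
    using batch seed_measure_sign_seeds measurable_compose[OF measurable_fst measurable_sketch_output]
    by (simp add: two_round_algorithm_def query_batch_def out2_def[abs_def])
  moreover have "two_round_output A (m * m) 0 ?q (\<lambda>_ _. undefined) out2 = nonadaptive_output A (m * m) ?q ?out" for A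
    by (simp add: fun_eq_iff two_round_output_def nonadaptive_output_def out2_def Let_def)
  ultimately show "\<exists>m1 m2 M q1 q2 out. real (m1 + m2) \<le> 2 * 10 ^ 45 * ((real k)\<^sup>2 / \<epsilon> ^ 8) * ln (real k + 1) \<and>
      two_round_algorithm d k m1 m2 M q1 q2 out \<and>
      approximates_top_eigenvalues d k \<epsilon> M (\<lambda>A. two_round_output A m1 m2 q1 q2 out)"
    using q8 approx by (intro exI[of _ "m * m"] exI[of _ 0] exI[of _ ?M] exI[of _ ?q] exI[of _ "\<lambda>_ _. undefined"] exI[of _ out2]) simp
qed simp

end
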